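(* Let $b_1,\dots,b_6$ be complex numbers with $b_1\cdots b_6=q$, such that $b_i/b_j\notin q^{\mathbb Z}$ for $1\le i<j\le 6$ and $b_ib_j\notin q^{\mathbb Z}$ for $1\le i\le j\le 6$. There exists a functional $\mathbf J$ on the space $V$ (defined in the context) such that, for all integers $k_1,\dots,k_6$ with $k_1+\dots+k_6=0$, $$\mathbf J\left((b_1z^\pm)_{k_1}\cdots(b_6z^\pm)_{k_6}\right)=\frac{\prod_{1\leq i<j\leq 6}(b_ib_j)_{k_i+k_j}}{\prod_{j=1}^6q^{\binom{k_j}2}b_j^{k_j}}.$$ For generic values of $\lambda$, it is given by $$\mathbf J(f)=\frac{(q)_\infty\,\theta(\lambda^2)\prod_{1\leq i<j\leq 6}(b_ib_j)_\infty}{2\left\{\theta(\lambda b_1,\dots,\lambda b_6)-q\lambda^{-2}\theta(\lambda/b_1,\dots,\lambda/b_6)\right\}}\oint f\left(\frac{z+z^{-1}}2\right)\frac{(z^{\pm 2})_\infty\,\theta(\lambda z^\pm)}{(b_1z^{\pm},\dots,b_6z^{\pm})_\infty}\,\frac{dz}{2\pi\mathrm i z},$$ where the integration is over a positively oriented contour encircling all poles of the integrand of the form $z\in b_j q^{\mathbb Z}$ and no poles of the form $z\in b_j^{-1} q^{\mathbb Z}$ ($1\le j\le 6$).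
   Context: Throughout, $q$ is a fixed complex number with $0<|q|<1$ (the base $q$ is suppressed from the notation). For $k\in\mathbb Z_{\ge 0}$, $(a)_k=(1-a)(1-aq)\cdots(1-aq^{k-1})$; for $k\in\mathbb Z_{<0}$, $(a)_k=\left((1-aq^{-1})\cdots(1-aq^{k})\right)^{-1}$; $(a)_\infty=\prod_{j=0}^\infty(1-aq^j)$; $\theta(x)=(x)_\infty(q/x)_\infty$. Repeated arguments and $\pm$ denote products, e.g. $(bz^\pm)_k=(bz)_k(b/z)_k$, $(z^{\pm2})_\infty=(z^2)_\infty(z^{-2})_\infty$, $\theta(\lambda z^\pm)=\theta(\lambda z)\theta(\lambda/z)$, $\theta(x,y)=\theta(x)\theta(y)$. $V$ is the vector space of rational functions $f$ in the variable $(z+z^{-1})/2$ that are regular, including at infinity (the degree of the numerator does not exceed the degree of the denominator), except for possible single (simple) poles at the points with $z\in b_jq^{\mathbb Z_{<0}}$ or $z^{-1}\in b_jq^{\mathbb Z_{<0}}$, $1\leq j\leq 6$. A functional is a complex-valued linear functional. The contour (in $\mathbb C\setminus\{0\}$, encircling the origin) is allowed to depend on $f$. "Generic values of $\lambda$" means nonzero $\lambda$ for which the denominator in the prefactor does not vanish. *)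

theory Defs
  imports
    "HOL-Complex_Analysis.Complex_Analysis"
    "HOL-Computational_Algebra.Computational_Algebra"
    "HOL-Computational_Algebra.Field_as_Ring"
begin

definition qpoch :: "complex \<Rightarrow> complex \<Rightarrow> int \<Rightarrow> complex" where
  "qpoch q a k =
     (if k \<ge> 0 then \<Prod>i<nat k. 1 - a * q ^ i
      else inverse (\<Prod>i=1..nat (- k). 1 - a * q powi (- int i)))"

definition qpoch_inf :: "complex \<Rightarrow> complex \<Rightarrow> complex" where
  "qpoch_inf q a = (\<Prod>j. 1 - a * q ^ j)"

definition qtheta :: "complex \<Rightarrow> complex \<Rightarrow> complex" where
  "qtheta q x = qpoch_inf q x * qpoch_inf q (q / x)"

definition qpowers :: "complex \<Rightarrow> complex set" where
  "qpowers q = range (\<lambda>n::int. q powi n)"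

text \<open>
  Rational functions in the variable \<open>x = (z + 1/z) / 2\<close> are elements of the field of fractions
  \<^typ>\<open>complex poly fract\<close>. Evaluation uses the reduced representation, so it is the value of the
  rational function at every regular point (and 0 at a pole).
\<close>

definition eval_rat :: "complex poly fract \<Rightarrow> complex \<Rightarrow> complex" where
  "eval_rat f x = (case quot_of_fract f of (p, r) \<Rightarrow> poly p x / poly r x)"

definition joukowski :: "complex \<Rightarrow> complex" where
  "joukowski z = (z + inverse z) / 2"

definition allowed_poles :: "complex \<Rightarrow> (nat \<Rightarrow> complex) \<Rightarrow> complex set" where
  "allowed_poles q b =
     {joukowski z | z. z \<noteq> 0 \<and>
        (\<exists>j\<in>{1..6}. \<exists>m<0. z = b j * q powi m \<or> inverse z = b j * q powi m)}"

text \<open>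
  The numerator and denominator below are coprime, so the zeros of the denominator are exactly the
  finite poles, and the degree condition is regularity at infinity.
\<close>

definition V :: "complex \<Rightarrow> (nat \<Rightarrow> complex) \<Rightarrow> complex poly fract set" where
  "V q b = {f. case quot_of_fract f of (p, r) \<Rightarrow>
      degree p \<le> degree r \<and>
      (\<forall>x. poly r x = 0 \<longrightarrow> x \<in> allowed_poles q b \<and> order x r = 1)}"

definition linear_functional_on ::
    "complex poly fract set \<Rightarrow> (complex poly fract \<Rightarrow> complex) \<Rightarrow> bool" where
  "linear_functional_on S J \<longleftrightarrow>
     (\<forall>f\<in>S. \<forall>g\<in>S. J (f + g) = J f + J g) \<and>
     (\<forall>c. \<forall>f\<in>S. J (to_fract [:c:] * f) = c * J f)"

text \<open>The braces in the denominator of the prefactor.\<close>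

definition theta_difference :: "complex \<Rightarrow> (nat \<Rightarrow> complex) \<Rightarrow> complex \<Rightarrow> complex" where
  "theta_difference q b lam =
     (\<Prod>j=1..6. qtheta q (lam * b j)) - q * lam powi (-2) * (\<Prod>j=1..6. qtheta q (lam / b j))"

text \<open>The integrand, including the factor \<open>1 / (2 \<pi> \<i> z)\<close> of the measure.\<close>

definition integrand ::
    "complex \<Rightarrow> (nat \<Rightarrow> complex) \<Rightarrow> complex \<Rightarrow> complex poly fract \<Rightarrow> complex \<Rightarrow> complex" where
  "integrand q b lam f z =
     eval_rat f (joukowski z) *
     (qpoch_inf q (z\<^sup>2) * qpoch_inf q (z powi (-2)) * qtheta q (lam * z) * qtheta q (lam / z)) /
     (\<Prod>j=1..6. qpoch_inf q (b j * z) * qpoch_inf q (b j / z)) /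
     (2 * of_real pi * \<i> * z)"

text \<open>
  Positively oriented closed contours in \<open>\<complex> - {0}\<close> going once around the origin and once around every
  pole of \<open>F\<close> in \<open>b\<^sub>j q\<^sup>\<int>\<close>, and around no pole of \<open>F\<close> in \<open>b\<^sub>j\<^sup>-\<^sup>1 q\<^sup>\<int>\<close>. Encircling is expressed by winding
  numbers, so the path need not be simple. Only actual poles count: at some of the points the factors
  of the numerator may cancel the singularity.
\<close>

definition separating_contour ::
    "complex \<Rightarrow> (nat \<Rightarrow> complex) \<Rightarrow> (complex \<Rightarrow> complex) \<Rightarrow> (real \<Rightarrow> complex) \<Rightarrow> bool" where
  "separating_contour q b F \<gamma> \<longleftrightarrow>
     valid_path \<gamma> \<and> pathfinish \<gamma> = pathstart \<gamma> \<and>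
     0 \<notin> path_image \<gamma> \<and> winding_number \<gamma> 0 = 1 \<and>
     (\<forall>j\<in>{1..6}. \<forall>u\<in>qpowers q.
        (is_pole F (b j * u) \<longrightarrow>
           b j * u \<notin> path_image \<gamma> \<and> winding_number \<gamma> (b j * u) = 1) \<and>
        (is_pole F (inverse (b j) * u) \<longrightarrow>
           inverse (b j) * u \<notin> path_image \<gamma> \<and> winding_number \<gamma> (inverse (b j) * u) = 0))"

end

theory Submission
  imports Defs
begin

text \<open>
  Write \<open>I lam f\<close> for the contour integral of the statement, and \<open>(a)\<^sub>\<infinity>\<close> for \<open>qpoch_inf q a\<close>, abbreviated
  \<open>P a\<close>. Call the integrand for \<open>f = 1\<close> the weight.
  Multiplying it by one of the products in the statement only replaces every parameter
  \<open>b j\<close> by \<open>b j * q powi k j\<close>, and the condition on the sum of the exponents preserves the product \<open>q\<close> of the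
  parameters. So the value of the functional on such products amounts to one evaluation, that of
  \<open>I lam 1\<close> for all admissible parameters (\<open>six_parameter_integral\<close>). The dependence of the result on \<open>lam\<close> sits in
  the braces \<open>theta_difference\<close>, whose behaviour under the shift is elementary
  (\<open>theta_difference_shifted\<close>). Since the products span \<open>V\<close> (\<open>reduce_pole_order\<close>,
  \<open>has_value_exists\<close>), it follows for every \<open>f\<close> in \<open>V\<close> that the normalised integral does not depend on
  \<open>lam\<close>, and it can be defined by taking \<open>lam = b 1\<close>, which is generic.

  The six-parameter integral is determined by its dependence on \<open>lam\<close>. The functions
  \<open>\<theta> (lam z) \<theta> (lam / z)\<close> of \<open>lam\<close> lie in a space of dimension two, which is the content of
  \<open>three_term_relation\<close>, and at \<open>lam = b 1\<close> and \<open>lam = b 2\<close> the integrand degenerates to that of the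
  Nassrallah-Rahman integral. The identities between theta functions are proved by
  \<open>theta_quotient_zero\<close>, a form of Liouville's theorem: too many zeros force a function with a theta
  multiplier to vanish.

  The Nassrallah-Rahman integral (\<open>nassrallah_rahman\<close>) is evaluated by a first-order difference equation in
  one parameter (\<open>nr_step\<close>), which holds because a combination of the two integrands is a total
  difference \<open>g z - q g (q z)\<close>. Iteration moves all parameters to \<open>0\<close>, and the constant that is left
  comes from a case in which the integrand is a Laurent polynomial.

  No restriction on the size of the parameters is made, so the contours are governed by winding
  numbers alone. Two contours with the same winding numbers about the singularities give the same
  integral (\<open>contour_integral_eq_of_same_winding\<close>), and contours with suitable winding numbers exist
  (\<open>straddling_contour_exists\<close>). Such a contour stays valid when a parameter is multiplied by positive powers
  of \<open>q\<close> or replaced by \<open>0\<close>, so that the limit above is taken along a fixed contour.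
\<close>

section \<open>The infinite product and the theta function\<close>

locale q_base =
  fixes q :: complex
  assumes q_nz: "q \<noteq> 0" and q_lt_1: "norm q < 1"
begin

abbreviation P :: "complex \<Rightarrow> complex" where "P \<equiv> qpoch_inf q"
abbreviation \<theta> :: "complex \<Rightarrow> complex" where "\<theta> \<equiv> qtheta q"

lemma tendsto_mult_q_power: "(\<lambda>n. a * q ^ n) \<longlonglongrightarrow> 0"
  using LIMSEQ_power_zero[OF q_lt_1] tendsto_mult_right_zero by blast

lemma P_convergent: "convergent_prod (\<lambda>n. 1 - a * q ^ n)"
proof -
  have "summable (\<lambda>n. norm (1 - a * q ^ n - 1))"
    using q_lt_1 by (simp add: norm_mult norm_power summable_mult)
  then show ?thesis
    by (intro abs_convergent_prod_imp_convergent_prod summable_imp_abs_convergent_prod)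
qed

lemma P_LIMSEQ: "(\<lambda>n. \<Prod>i<n. 1 - a * q ^ i) \<longlonglongrightarrow> P a"
  using convergent_prod_LIMSEQ[OF P_convergent[of a]]
  unfolding qpoch_inf_def using LIMSEQ_lessThan_iff_atMost by blast

lemma P_uniform_limit: "uniform_limit (cball 0 R) (\<lambda>n a. \<Prod>i<n. 1 - a * q ^ i) P sequentially"
proof -
  have "uniformly_convergent_on (cball 0 R) (\<lambda>N a. \<Prod>n<N. 1 + (- (a * q ^ n)))"
  proof (rule uniformly_convergent_on_prod)
    show "uniformly_convergent_on (cball 0 R) (\<lambda>N x. \<Sum>n<N. norm (- (x * q ^ n)))"
    proof (rule Weierstrass_m_test')
      show "summable (\<lambda>n. \<bar>R\<bar> * norm q ^ n)"
        using q_lt_1 by (intro summable_mult summable_geometric) auto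
      show "norm (norm (- (x * q ^ n))) \<le> \<bar>R\<bar> * norm q ^ n" if "x \<in> cball 0 R" for n x
        using that by (auto simp: norm_mult norm_power intro!: mult_right_mono)
    qed
  qed (auto intro!: continuous_intros)
  then have ul: "uniform_limit (cball 0 R) (\<lambda>N a. \<Prod>n<N. 1 - a * q ^ n)
               (\<lambda>a. lim (\<lambda>N. \<Prod>n<N. 1 - a * q ^ n)) sequentially"
    by (simp add: uniformly_convergent_uniform_limit_iff)
  have eq: "(\<lambda>a. lim (\<lambda>N. \<Prod>n<N. 1 - a * q ^ n)) = P"
    using P_LIMSEQ limI by blast
  show ?thesis using ul unfolding eq .
qed

lemma P_holomorphic_UNIV: "P holomorphic_on UNIV"
proof (rule holomorphic_uniform_sequence[where f = "\<lambda>n a. \<Prod>i<n. 1 - a * q ^ i"])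
  fix x :: complex
  have "cball x 1 \<subseteq> cball 0 (norm x + 1)"
    by (auto simp: dist_norm) (metis add.commute norm_triangle_sub order_trans add_le_cancel_right norm_minus_commute)
  then show "\<exists>d>0. cball x d \<subseteq> UNIV \<and>
       uniform_limit (cball x d) (\<lambda>n a. \<Prod>i<n. 1 - a * q ^ i) P sequentially"
    using uniform_limit_on_subset[OF P_uniform_limit] by (intro exI[of _ 1]) auto
qed (auto intro!: holomorphic_intros)

lemma P_analytic [analytic_intros]: "f analytic_on A \<Longrightarrow> (\<lambda>z. P (f z)) analytic_on A"
  using analytic_on_compose[of f A P, unfolded o_def] P_holomorphic_UNIV
  by (meson analytic_on_subset analytic_on_open open_UNIV top_greatest)

lemma P_holomorphic [holomorphic_intros]:
  assumes "f holomorphic_on A" shows "(\<lambda>z. P (f z)) holomorphic_on A"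
  using holomorphic_on_compose[of f A P, unfolded o_def] assms P_holomorphic_UNIV
    holomorphic_on_subset by blast

lemma P_continuous [continuous_intros]:
  assumes "continuous_on A f" shows "continuous_on A (\<lambda>z. P (f z))"
  using continuous_on_compose2[of UNIV P A f] assms P_holomorphic_UNIV
    holomorphic_on_imp_continuous_on by blast

lemma P_tendsto: "(f \<longlongrightarrow> a) F \<Longrightarrow> ((\<lambda>x. P (f x)) \<longlongrightarrow> P a) F"
  using P_continuous[of UNIV "\<lambda>x. x"] by (simp add: continuous_on_eq_continuous_at isCont_tendsto_compose)

lemma P_0 [simp]: "P 0 = 1"
  by (simp add: qpoch_inf_def)

lemma P_shift: "P a = (1 - a) * P (a * q)"
proof (rule LIMSEQ_unique)
  show "(\<lambda>n. \<Prod>i<Suc n. 1 - a * q ^ i) \<longlonglongrightarrow> P a"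
    using P_LIMSEQ by (rule LIMSEQ_Suc)
  have "(\<lambda>n. (1 - a) * (\<Prod>i<n. 1 - a * q * q ^ i)) \<longlonglongrightarrow> (1 - a) * P (a * q)"
    by (intro tendsto_mult tendsto_const P_LIMSEQ)
  then show "(\<lambda>n. \<Prod>i<Suc n. 1 - a * q ^ i) \<longlonglongrightarrow> (1 - a) * P (a * q)"
    by (simp add: prod.lessThan_Suc_shift mult.assoc del: prod.lessThan_Suc)
qed

lemma P_shift_power: "P a = (\<Prod>i<n. 1 - a * q ^ i) * P (a * q ^ n)"
proof (induction n)
  case (Suc n)
  then show ?case using P_shift[of "a * q ^ n"] by (simp add: mult_ac)
qed simp

lemma P_eq_0_iff: "P a = 0 \<longleftrightarrow> (\<exists>n. a * q ^ n = 1)"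
proof
  assume "P a = 0"
  then have "(\<lambda>n. 1 - a * q ^ n) has_prod 0"
    using P_convergent[of a] by (metis convergent_prod_has_prod_iff qpoch_inf_def)
  then show "\<exists>n. a * q ^ n = 1" by (auto simp: has_prod_0_iff)
next
  assume "\<exists>n. a * q ^ n = 1"
  then obtain n where "a * q ^ n = 1" by blast
  then have "(\<Prod>i<Suc n. 1 - a * q ^ i) = 0" by auto
  with P_shift_power[of a "Suc n"] show "P a = 0" by simp
qed

lemma qpowers_iff: "x \<in> qpowers q \<longleftrightarrow> (\<exists>n. x = q powi n)"
  by (auto simp: qpowers_def)

lemma qpowers_nz: "x \<in> qpowers q \<Longrightarrow> x \<noteq> 0"
  using q_nz by (auto simp: qpowers_iff power_int_eq_0_iff)

lemma qpowers_inverse: "x \<in> qpowers q \<Longrightarrow> inverse x \<in> qpowers q"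
  by (metis power_int_minus qpowers_iff)

lemma qpowers_inverse_iff: "inverse x \<in> qpowers q \<longleftrightarrow> x \<in> qpowers q"
  using qpowers_inverse by force

lemma qpowers_mult: "x \<in> qpowers q \<Longrightarrow> y \<in> qpowers q \<Longrightarrow> x * y \<in> qpowers q"
  by (metis power_int_add q_nz qpowers_iff)

lemma qpowers_powi [simp, intro]: "q powi n \<in> qpowers q"
  by (auto simp: qpowers_iff)

lemma qpowers_1 [simp]: "1 \<in> qpowers q"
  by (metis power_int_0_right qpowers_iff)

lemma qpowers_mult_cancel: "y \<in> qpowers q \<Longrightarrow> x * y \<in> qpowers q \<longleftrightarrow> x \<in> qpowers q"
proof
  assume y: "y \<in> qpowers q" and "x * y \<in> qpowers q"
  then have "x * y * inverse y \<in> qpowers q" using qpowers_inverse qpowers_mult by blast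
  then show "x \<in> qpowers q" using qpowers_nz[OF y] by (simp add: mult.assoc)
qed (rule qpowers_mult)

lemma P_eq_0_imp_qpowers: assumes "P a = 0" shows "a \<in> qpowers q"
proof -
  obtain n where "a * q ^ n = 1" using assms by (auto simp: P_eq_0_iff)
  then have "a = q powi (- int n)"
    using q_nz by (simp add: power_int_minus field_simps)
  then show ?thesis by auto
qed

lemma P_q_nz: "P q \<noteq> 0"
proof
  assume "P q = 0"
  then obtain n where "q ^ Suc n = 1" by (auto simp: P_eq_0_iff)
  moreover have "norm (q ^ Suc n) < 1" using q_lt_1 q_nz
    by (metis norm_ge_zero norm_power power_Suc_less_one zero_less_norm_iff)
  ultimately show False by simp
qed

lemma q_powi_eq_1_iff: "q powi n = 1 \<longleftrightarrow> n = 0"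
proof
  assume *: "q powi n = 1"
  show "n = 0"
  proof (rule ccontr)
    assume "n \<noteq> 0"
    have "norm (q powi n) = 1" using * by simp
    then have n1: "norm q powi n = 1" by (simp add: norm_power_int)
    have pos: "norm q > 0" using q_nz by simp
    consider "n > 0" | "n < 0" using \<open>n \<noteq> 0\<close> by linarith
    then have "norm q ^ nat \<bar>n\<bar> = 1"
      using n1 by cases (auto simp: power_int_def power_inverse split: if_splits)
    moreover have "norm q ^ nat \<bar>n\<bar> < 1"
      using q_lt_1 pos \<open>n \<noteq> 0\<close> by (intro power_less_one_iff[THEN iffD2]) auto
    ultimately show False by simp
  qed
qed simp

lemma q_powi_inj: "q powi m = q powi n \<Longrightarrow> m = n"
  using q_powi_eq_1_iff[of "m - n"] q_nz by (simp add: power_int_diff power_int_eq_0_iff)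

lemma theta_shift: assumes "x \<noteq> 0" shows "\<theta> (q * x) = - \<theta> x / x"
proof -
  have "\<theta> (q * x) * x = P (q * x) * (x * P (1 / x))"
    using q_nz by (simp add: qtheta_def)
  also have "x * P (1 / x) = (x - 1) * P (q / x)"
    using P_shift[of "1 / x"] assms by (simp add: field_simps)
  also have "P (q * x) * ((x - 1) * P (q / x)) = - \<theta> x"
    using P_shift[of x] by (simp add: qtheta_def mult_ac) (simp add: algebra_simps)
  finally show ?thesis using assms by (simp add: field_simps)
qed

lemma theta_inverse: assumes "x \<noteq> 0" shows "\<theta> (1 / x) = - \<theta> x / x"
proof -
  have "\<theta> (1 / x) = \<theta> (q * x)"
    using q_nz assms by (simp add: qtheta_def mult_ac)
  then show ?thesis using theta_shift[OF assms] by simp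
qed

lemma theta_eq_0_iff: assumes "x \<noteq> 0" shows "\<theta> x = 0 \<longleftrightarrow> x \<in> qpowers q"
proof
  assume "\<theta> x = 0"
  then consider "P x = 0" | "P (q / x) = 0" by (auto simp: qtheta_def)
  then show "x \<in> qpowers q"
  proof cases
    case 2
    then have "q / x \<in> qpowers q" by (rule P_eq_0_imp_qpowers)
    moreover have "q \<in> qpowers q" by (metis power_int_1_right qpowers_iff)
    ultimately have "inverse x * q \<in> qpowers q" "q \<in> qpowers q" by (simp_all add: field_simps)
    then show ?thesis using qpowers_mult_cancel qpowers_inverse_iff by blast
  qed (rule P_eq_0_imp_qpowers)
next
  assume "x \<in> qpowers q"
  then obtain n where n: "x = q powi n" by (auto simp: qpowers_iff)
  show "\<theta> x = 0"
  proof (cases "n \<le> 0")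
    case True
    then have "x * q ^ nat (- n) = 1"
      using q_nz by (simp add: n power_int_def power_inverse)
    then show ?thesis by (auto simp: qtheta_def P_eq_0_iff)
  next
    case False
    then have "q ^ nat (n - 1) = q powi (n - 1)" by (simp add: power_int_def)
    then have "q / x * q ^ nat (n - 1) = 1"
      using q_nz by (simp add: n power_int_diff power_int_eq_0_iff)
    then show ?thesis unfolding qtheta_def using P_eq_0_iff by auto
  qed
qed

lemma theta_analytic [analytic_intros]:
  assumes "f analytic_on A" "\<And>z. z \<in> A \<Longrightarrow> f z \<noteq> 0"
  shows "(\<lambda>z. \<theta> (f z)) analytic_on A"
  unfolding qtheta_def using assms by (auto intro!: analytic_intros)

lemma theta_holomorphic [holomorphic_intros]:
  assumes "f holomorphic_on A" "\<And>z. z \<in> A \<Longrightarrow> f z \<noteq> 0"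
  shows "(\<lambda>z. \<theta> (f z)) holomorphic_on A"
  unfolding qtheta_def using assms by (auto intro!: holomorphic_intros)

lemma theta_has_derivative:
  assumes "x \<noteq> 0" shows "(\<theta> has_field_derivative deriv \<theta> x) (at x)"
proof -
  have "(\<lambda>z. \<theta> z) holomorphic_on -{0}" by (intro holomorphic_intros) auto
  then show ?thesis using assms by (intro holomorphic_derivI[where S = "-{0}"]) auto
qed

text \<open>
  At \<open>x = 1\<close> the factor \<open>1 - x\<close> is the only vanishing one; the other zeros are shifts of this one.
\<close>

lemma theta_simple_zero:
  assumes "x \<noteq> 0" "\<theta> x = 0" shows "deriv \<theta> x \<noteq> 0"
proof -
  have d1: "deriv \<theta> 1 \<noteq> 0"
  proof -
    define u where "u x = P (x * q) * P (q / x)" for x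
    have "(\<lambda>x. P (x * q) * P (q / x)) holomorphic_on -{0}" by (intro holomorphic_intros) auto
    then have "(u has_field_derivative deriv u 1) (at 1)"
      unfolding u_def by (intro holomorphic_derivI[where S = "-{0}"]) auto
    then have "((\<lambda>x. (1 - x) * u x) has_field_derivative (1 - 1) * deriv u 1 + (0 - 1) * u 1) (at 1)"
      by (intro derivative_eq_intros refl | simp)+
    moreover have "(\<lambda>x. (1 - x) * u x) = \<theta>"
    proof
      fix x show "(1 - x) * u x = \<theta> x"
        using P_shift[of x] by (simp add: u_def qtheta_def mult_ac)
    qed
    ultimately have "deriv \<theta> 1 = - u 1" by (intro DERIV_imp_deriv) simp
    then show ?thesis using P_q_nz by (simp add: u_def)
  qed
  have step: "deriv \<theta> (q * x) \<noteq> 0 \<longleftrightarrow> deriv \<theta> x \<noteq> 0" if x: "x \<noteq> 0" "\<theta> x = 0" for x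
  proof -
    have "((\<lambda>x. \<theta> (q * x)) has_field_derivative deriv \<theta> (q * x) * q) (at x)"
      using x q_nz by (intro DERIV_chain'[OF _ theta_has_derivative] derivative_eq_intros | simp)+
    moreover have "((\<lambda>x. - \<theta> x / x) has_field_derivative
        (- deriv \<theta> x * x - (- \<theta> x) * 1) / (x * x)) (at x)"
      using x by (intro derivative_intros theta_has_derivative | simp)+
    then have "((\<lambda>x. \<theta> (q * x)) has_field_derivative
        (- deriv \<theta> x * x - (- \<theta> x) * 1) / (x * x)) (at x)"
      by (rule has_field_derivative_transform_within_open[where S = "-{0}"])
         (use x theta_shift in auto)
    ultimately have "deriv \<theta> (q * x) * q = (- deriv \<theta> x * x - (- \<theta> x) * 1) / (x * x)"
      by (rule DERIV_unique)
    then have "deriv \<theta> (q * x) * q = - deriv \<theta> x / x"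
      using x by (simp add: field_simps)
    then show ?thesis using x q_nz by auto
  qed
  obtain n where n: "x = q powi n" using assms theta_eq_0_iff by (auto simp: qpowers_iff)
  have z: "\<theta> (q powi m) = 0" "q powi m \<noteq> 0" for m
    using theta_eq_0_iff q_nz by (auto simp: power_int_eq_0_iff)
  have "deriv \<theta> (q powi m) \<noteq> 0" for m
  proof (induction m rule: int_induct[of _ 0])
    case base then show ?case using d1 by simp
  next
    case (step1 i) then show ?case
      using step[OF z(2) z(1), of i] q_nz by (simp add: power_int_add mult.commute)
  next
    case (step2 i) then show ?case
      using step[OF z(2) z(1), of "i - 1"] q_nz by (simp add: power_int_diff mult.commute)
  qed
  then show ?thesis by (simp add: n)
qed

end

section \<open>Contours with prescribed winding numbers\<close>

lemma countable_isolated_points: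
  fixes S :: "real set"
  assumes "\<And>x. x \<in> S \<Longrightarrow> \<exists>e>0. \<forall>y\<in>S. \<bar>y - x\<bar> < e \<longrightarrow> y = x"
  shows "countable S"
proof -
  obtain F' where F': "F' \<subseteq> (\<lambda>x. {x}) ` S" "countable F'" "\<Union>F' = \<Union>((\<lambda>x. {x}) ` S)"
  proof (rule Lindelof_openin[where \<F> = "(\<lambda>x. {x}) ` S" and U = S])
    fix X assume "X \<in> (\<lambda>x. {x}) ` S"
    then obtain x where x: "x \<in> S" "X = {x}" by blast
    from assms[OF x(1)] obtain e where e: "e > 0" "\<forall>y\<in>S. \<bar>y - x\<bar> < e \<longrightarrow> y = x" by blast
    then have "{x} = S \<inter> ball x e" using x by (auto simp: dist_real_def abs_minus_commute)
    then show "openin (top_of_set S) X" using x by (metis open_ball openin_open)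
  qed
  have "S = (\<Union>X\<in>F'. X)" using F'(3) by auto
  moreover have "countable (\<Union>X\<in>F'. X)" using F' by (intro countable_UN) auto
  ultimately show ?thesis by simp
qed

text \<open>
  A contour may run through a point any number of times, but it does so with non-zero velocity at
  isolated, hence at most countably many, parameter values.
\<close>

lemma contour_integral_spike_countable:
  assumes N: "countable N" and \<gamma>: "valid_path \<gamma>"
    and eq: "\<And>z. z \<in> path_image \<gamma> - N \<Longrightarrow> f z = g z"
  shows "contour_integral \<gamma> f = contour_integral \<gamma> g"
proof -
  obtain S where S: "finite S" "\<gamma> C1_differentiable_on {0..1} - S"
    using \<gamma> by (auto simp: valid_path_def piecewise_C1_differentiable_on_def)
  define B where "B p = {t \<in> {0..1} - S. \<gamma> t = p \<and> vector_derivative \<gamma> (at t) \<noteq> 0}" for p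
  have "countable (B p)" for p
  proof (rule countable_isolated_points)
    fix t assume t: "t \<in> B p"
    define d where "d = vector_derivative \<gamma> (at t)"
    have d: "(\<gamma> has_vector_derivative d) (at t)" and "d \<noteq> 0"
      using S(2) t by (auto simp: B_def d_def C1_differentiable_on_eq vector_derivative_works)
    have "norm d / 2 > 0" using \<open>d \<noteq> 0\<close> by simp
    then obtain e where e: "e > 0" "\<And>y. norm (y - t) < e \<Longrightarrow>
        norm (\<gamma> y - \<gamma> t - (y - t) *\<^sub>R d) \<le> norm d / 2 * norm (y - t)"
      using d unfolding has_vector_derivative_def has_derivative_at_alt by blast
    have "y = t" if "y \<in> B p" "\<bar>y - t\<bar> < e" for y
    proof (rule ccontr)
      assume "y \<noteq> t"
      moreover have "\<gamma> y = \<gamma> t" using that t by (simp add: B_def)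
      ultimately have "\<bar>y - t\<bar> * norm d \<le> norm d / 2 * \<bar>y - t\<bar>" using e(2)[of y] that by simp
      then show False using \<open>y \<noteq> t\<close> \<open>d \<noteq> 0\<close> by simp
    qed
    then show "\<exists>e>0. \<forall>y\<in>B p. \<bar>y - t\<bar> < e \<longrightarrow> y = t" using e(1) by blast
  qed
  then have "countable (S \<union> (\<Union>p\<in>N. B p))" using N S(1) by (auto simp: countable_finite)
  then have neg: "negligible (S \<union> (\<Union>p\<in>N. B p))"
    by (simp add: negligible_iff_null_sets countable_imp_null_set_lborel null_sets_completionI)
  have "g (\<gamma> t) * vector_derivative \<gamma> (at t) = f (\<gamma> t) * vector_derivative \<gamma> (at t)"
    if t: "t \<in> {0..1} - (S \<union> (\<Union>p\<in>N. B p))" for t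
  proof (cases "\<gamma> t \<in> N")
    case True
    then have "vector_derivative \<gamma> (at t) = 0" using t by (auto simp: B_def)
    then show ?thesis by simp
  next
    case False
    then show ?thesis using eq[of "\<gamma> t"] t by (auto simp: path_image_def)
  qed
  then show ?thesis
    unfolding contour_integral_integral by (rule integral_spike[OF neg])
qed

lemma connected_open_valid_path:
  fixes D :: "complex set"
  assumes "open D" "connected D" "x \<in> D" "y \<in> D"
  obtains g where "valid_path g" "path_image g \<subseteq> D" "pathstart g = x" "pathfinish g = y"
  using connected_open_polynomial_connected[OF assms] valid_path_polynomial_function by metis

text \<open>
  Joining the two contours by a path and its reverse makes one closed path out of their difference,
  to which Cauchy's theorem applies.
\<close>

lemma contour_integral_eq_of_same_winding:
  assumes D: "open D" "connected D" and f: "f holomorphic_on D"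
    and g1: "valid_path g1" "pathfinish g1 = pathstart g1" "path_image g1 \<subseteq> D"
    and g2: "valid_path g2" "pathfinish g2 = pathstart g2" "path_image g2 \<subseteq> D"
    and w: "\<And>w. w \<notin> D \<Longrightarrow> winding_number g1 w = winding_number g2 w"
  shows "contour_integral g1 f = contour_integral g2 f"
proof -
  have "pathstart g1 \<in> D" "pathstart g2 \<in> D" using g1 g2 by auto
  then obtain p where p: "valid_path p" "path_image p \<subseteq> D" "pathstart p = pathstart g1"
      "pathfinish p = pathstart g2"
    using connected_open_valid_path[OF D] by metis
  define h where "h = g1 +++ (p +++ (reversepath g2 +++ reversepath p))"
  have int: "f contour_integrable_on g1" "f contour_integrable_on g2" "f contour_integrable_on p"
    using contour_integrable_holomorphic_simple[OF f D(1)] g1 g2 p by auto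
  have vr: "valid_path (reversepath g2)" "valid_path (reversepath p)"
    using g2 p by (auto simp: valid_path_imp_reverse)
  have "(f has_contour_integral 0) h"
  proof (rule Cauchy_theorem_global[OF D(1) f])
    show "valid_path h" using g1 g2 p vr by (simp add: h_def valid_path_join)
    show "pathfinish h = pathstart h" using g1 p by (simp add: h_def)
    show "path_image h \<subseteq> D" using g1 g2 p by (simp add: h_def path_image_join)
    fix x assume "x \<notin> D"
    then have "x \<notin> path_image g1" "x \<notin> path_image g2" "x \<notin> path_image p" using g1 g2 p by auto
    then have "winding_number h x = winding_number g1 x - winding_number g2 x"
      using g1 g2 p vr by (simp add: h_def winding_number_join winding_number_reversepath
          path_image_join valid_path_imp_path)
    then show "winding_number h x = 0" using w[OF \<open>x \<notin> D\<close>] by simp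
  qed
  then have "contour_integral h f = 0" by (rule contour_integral_unique)
  moreover have "contour_integral h f = contour_integral g1 f - contour_integral g2 f"
    using int g1 g2 p vr
    by (simp add: h_def contour_integral_reversepath contour_integrable_reversepath valid_path_join)
  ultimately show ?thesis by simp
qed

text \<open>
  The velocity of a contour need not be bounded, which uniform limits under the integral sign
  require; a polynomial loop has no such defect.
\<close>

lemma polynomial_loop:
  assumes S: "open S" and g: "valid_path g" "pathfinish g = pathstart g" "path_image g \<subseteq> S"
  obtains h B where "valid_path h" "pathfinish h = pathstart h" "path_image h \<subseteq> S"
    "\<And>f. f holomorphic_on S \<Longrightarrow> contour_integral h f = contour_integral g f"
    "\<And>t. t \<in> {0..1} \<Longrightarrow> norm (vector_derivative h (at t)) \<le> B"
proof -
  have pg: "path g" using g by (simp add: valid_path_imp_path)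
  obtain d where d: "d > 0" and near: "\<And>h. valid_path h \<Longrightarrow>
      (\<And>t. t \<in> {0..1} \<Longrightarrow> norm (h t - g t) < d) \<Longrightarrow> pathfinish h = pathstart h \<Longrightarrow>
      path_image h \<subseteq> S \<and> (\<forall>f. f holomorphic_on S \<longrightarrow> contour_integral h f = contour_integral g f)"
    using contour_integral_nearby_loops[OF S pg g(3)] g(1,2) by (metis diff_self norm_zero)
  obtain h where h: "polynomial_function h" "pathstart h = pathstart g" "pathfinish h = pathfinish g"
    "\<And>t. t \<in> {0..1} \<Longrightarrow> norm (h t - g t) < d"
    using path_approx_polynomial_function[OF pg d] by metis
  have vh: "valid_path h" using h(1) by (rule valid_path_polynomial_function)
  obtain h' where h': "polynomial_function h'" "\<And>x. (h has_vector_derivative (h' x)) (at x)"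
    using has_vector_derivative_polynomial_function[OF h(1)] by metis
  have "continuous_on {0..1} h'" using h'(1) by (rule continuous_on_polymonial_function)
  then have "bounded (h' ` {0..1})"
    by (intro compact_imp_bounded compact_continuous_image) auto
  then obtain B where "\<And>t. t \<in> {0..1} \<Longrightarrow> norm (h' t) \<le> B" by (metis bounded_iff image_eqI)
  moreover have "vector_derivative h (at t) = h' t" for t
    using h'(2) by (rule vector_derivative_at)
  ultimately show ?thesis using near[OF vh h(4)] h g vh by (intro that[of h B]) auto
qed

text \<open>
  Go along a path to a small circle around \<open>p\<close>, once around it and back the same way: the way there
  and the way back cancel, and the circle surrounds no other point outside \<open>D\<close>.
\<close>

lemma add_loop:
  assumes D: "open D" "connected D"
    and g: "valid_path g" "pathfinish g = pathstart g" "path_image g \<subseteq> D"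
    and p: "p \<notin> D" "r > 0" "cball p r - {p} \<subseteq> D" and s: "s = 1 \<or> s = (-1 :: complex)"
  obtains g' where "valid_path g'" "pathfinish g' = pathstart g'" "path_image g' \<subseteq> D"
    "winding_number g' p = winding_number g p + s"
    "\<And>w. w \<notin> D \<Longrightarrow> w \<noteq> p \<Longrightarrow> winding_number g' w = winding_number g w"
proof -
  define c where "c = (if s = 1 then circlepath p r else reversepath (circlepath p r))"
  have img: "path_image (circlepath p r) \<subseteq> cball p r - {p}" using p(2) by auto
  have c: "valid_path c" "path_image c \<subseteq> D" "pathstart c = p + r" "pathfinish c = p + r"
    using img p by (auto simp: c_def valid_path_imp_reverse)
  have notin: "w \<notin> path_image (circlepath p r)" if "w \<notin> D" for w using img p that by blast
  have cp: "winding_number c p = s"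
    using winding_number_circlepath_centre[OF p(2), of p] s notin[OF p(1)]
    by (auto simp: c_def winding_number_reversepath)
  have cw: "winding_number c w = 0" if "w \<notin> D" "w \<noteq> p" for w
  proof -
    have "w \<notin> cball p r" using that p by blast
    then have "winding_number (circlepath p r) w = 0"
      using img by (intro winding_number_zero_outside[where s = "cball p r"]) auto
    then show ?thesis using notin[OF that(1)] by (auto simp: c_def winding_number_reversepath)
  qed
  have "pathstart g \<in> D" "p + r \<in> D" using g c by auto
  then obtain a where a: "valid_path a" "path_image a \<subseteq> D" "pathstart a = pathstart g"
      "pathfinish a = p + r"
    using connected_open_valid_path[OF D] by metis
  have ra: "valid_path (reversepath a)" using a by (simp add: valid_path_imp_reverse)
  define g' where "g' = g +++ (a +++ (c +++ reversepath a))"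
  have wn: "winding_number g' w = winding_number g w + winding_number c w" if "w \<notin> D" for w
  proof -
    have "w \<notin> path_image g" "w \<notin> path_image c" "w \<notin> path_image a" using that g c a by auto
    then show ?thesis
      using g c a ra by (simp add: g'_def winding_number_join winding_number_reversepath
          path_image_join valid_path_imp_path)
  qed
  show ?thesis
  proof (rule that)
    show "valid_path g'" using g c a ra by (simp add: g'_def valid_path_join)
    show "pathfinish g' = pathstart g'" using g a by (simp add: g'_def)
    show "path_image g' \<subseteq> D" using g c a by (simp add: g'_def path_image_join)
  qed (use wn cp cw p in auto)
qed

lemma add_loops:
  assumes D: "open D" "connected D" and A: "finite A" "A \<inter> D = {}"
    and iso: "\<And>p. p \<in> A \<Longrightarrow> \<exists>r>0. cball p r - {p} \<subseteq> D" and s: "s = 1 \<or> s = (-1 :: complex)"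
    and g: "valid_path g" "pathfinish g = pathstart g" "path_image g \<subseteq> D"
  shows "\<exists>g'. valid_path g' \<and> pathfinish g' = pathstart g' \<and> path_image g' \<subseteq> D \<and>
    (\<forall>p\<in>A. winding_number g' p = winding_number g p + s) \<and>
    (\<forall>w. w \<notin> D \<longrightarrow> w \<notin> A \<longrightarrow> winding_number g' w = winding_number g w)"
  using A iso
proof (induction A rule: finite_induct)
  case empty
  then show ?case using g by blast
next
  case (insert p A)
  then obtain g1 where g1: "valid_path g1" "pathfinish g1 = pathstart g1" "path_image g1 \<subseteq> D"
    "\<forall>p\<in>A. winding_number g1 p = winding_number g p + s"
    "\<forall>w. w \<notin> D \<longrightarrow> w \<notin> A \<longrightarrow> winding_number g1 w = winding_number g w"
    by auto
  have "\<exists>r>0. cball p r - {p} \<subseteq> D" "p \<notin> D" using insert.prems by auto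
  then obtain r where r: "r > 0" "cball p r - {p} \<subseteq> D" "p \<notin> D" by blast
  obtain g2 where g2: "valid_path g2" "pathfinish g2 = pathstart g2" "path_image g2 \<subseteq> D"
    "winding_number g2 p = winding_number g1 p + s"
    "\<And>w. w \<notin> D \<Longrightarrow> w \<noteq> p \<Longrightarrow> winding_number g2 w = winding_number g1 w"
    using add_loop[OF D g1(1-3) r(3,1,2) s] by metis
  show ?case
  proof (intro exI[of _ g2] conjI ballI allI impI)
    fix x assume "x \<in> insert p A"
    then show "winding_number g2 x = winding_number g x + s"
    proof (cases "x = p")
      case False
      with \<open>x \<in> insert p A\<close> have "x \<in> A" "x \<notin> D" using insert.prems by auto
      then show ?thesis using g1(4) g2(5)[of x] False by simp
    qed (use g1(5) g2(4) r(3) insert.hyps in auto)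
  next
    fix w assume "w \<notin> D" "w \<notin> insert p A"
    then show "winding_number g2 w = winding_number g w" using g1 g2 by auto
  qed (use g2 in auto)
qed

lemma contour_integral_scale:
  assumes "valid_path \<gamma>"
  shows "contour_integral (\<lambda>t. c * \<gamma> t) f = contour_integral \<gamma> (\<lambda>z. c * f (c * z))"
proof -
  have "contour_integral ((\<lambda>z. c * z) \<circ> \<gamma>) f = contour_integral \<gamma> (\<lambda>w. deriv (\<lambda>z. c * z) w * f (c * w))"
    using assms by (intro contour_integral_comp_analyticW[where s = UNIV]) (auto intro!: analytic_intros)
  then show ?thesis by (simp add: o_def)
qed

lemma valid_path_scale:
  fixes c :: complex
  assumes "valid_path \<gamma>" shows "valid_path (\<lambda>t. c * \<gamma> t)"
  using valid_path_compose_analytic[OF assms, of "\<lambda>z. c * z" UNIV]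
  by (auto simp: o_def intro!: analytic_intros)

lemma path_image_scale: "path_image (\<lambda>t. c * \<gamma> t) = (\<lambda>z. c * z) ` path_image \<gamma>"
  by (auto simp: path_image_def)

lemma winding_number_scale:
  assumes "valid_path \<gamma>" "c \<noteq> 0" "z \<notin> path_image \<gamma>"
  shows "winding_number (\<lambda>t. c * \<gamma> t) (c * z) = winding_number \<gamma> z"
proof -
  have "c * z \<notin> path_image (\<lambda>t. c * \<gamma> t)" using assms by (auto simp: path_image_scale)
  moreover have "(\<lambda>w. c * (1 / (c * w - c * z))) = (\<lambda>w. 1 / (w - z))"
    using assms(2) by (simp add: fun_eq_iff flip: right_diff_distrib)
  ultimately show ?thesis
    using assms by (simp add: winding_number_valid_path valid_path_scale contour_integral_scale)
qed

context q_base begin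

text \<open>
  The inner sequences \<open>t q\<^sup>n\<close> are encircled, the outer ones \<open>t\<^sup>-\<^sup>1 q\<^sup>-\<^sup>n\<close> are not. The condition survives
  replacing \<open>t\<close> by \<open>t q\<^sup>k\<close> with \<open>k \<ge> 0\<close> and also by \<open>0\<close>, so one contour serves a whole sequence of
  parameters together with its limit.
\<close>

definition straddles :: "complex set \<Rightarrow> (real \<Rightarrow> complex) \<Rightarrow> bool" where
  "straddles T \<gamma> \<longleftrightarrow> valid_path \<gamma> \<and> pathfinish \<gamma> = pathstart \<gamma> \<and>
     0 \<notin> path_image \<gamma> \<and> winding_number \<gamma> 0 = 1 \<and>
     (\<forall>t\<in>T. \<forall>n. t * q ^ n \<notin> path_image \<gamma> \<and> winding_number \<gamma> (t * q ^ n) = 1 \<and>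
       (t \<noteq> 0 \<longrightarrow> 1 / (t * q ^ n) \<notin> path_image \<gamma> \<and> winding_number \<gamma> (1 / (t * q ^ n)) = 0))"

lemma finite_q_orbit_outside: assumes "c > 0" shows "finite {n. norm (t * q ^ n) \<ge> c}"
proof -
  have "\<forall>\<^sub>F n in sequentially. norm (t * q ^ n) < c"
    using tendsto_norm_zero[OF tendsto_mult_q_power[of t]] assms order_tendstoD(2) by blast
  then show ?thesis by (auto simp: eventually_cofinite not_less simp flip: cofinite_eq_sequentially)
qed

text \<open>
  The complement of the poles of \<open>\<Prod>t\<in>S. 1 / (t z)\<^sub>\<infinity>\<close> and \<open>\<Prod>t\<in>T. 1 / (t / z)\<^sub>\<infinity>\<close> in the punctured plane.
\<close>

definition pole_free :: "complex set \<Rightarrow> complex set \<Rightarrow> complex set" where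
  "pole_free S T = {z. z \<noteq> 0 \<and> (\<forall>t\<in>S. P (t * z) \<noteq> 0) \<and> (\<forall>t\<in>T. P (t / z) \<noteq> 0)}"

lemma not_pole_free_iff:
  "z \<notin> pole_free S T \<longleftrightarrow> z = 0 \<or> (\<exists>t\<in>S. \<exists>n. t \<noteq> 0 \<and> z = 1 / (t * q ^ n)) \<or>
     (\<exists>t\<in>T. \<exists>n. t \<noteq> 0 \<and> z = t * q ^ n)"
proof (cases "z = 0")
  case False
  then have "t * z * q ^ n = 1 \<longleftrightarrow> t \<noteq> 0 \<and> z = 1 / (t * q ^ n)"
    "t / z * q ^ n = 1 \<longleftrightarrow> t \<noteq> 0 \<and> z = t * q ^ n" for t n
    using q_nz by (auto simp: eq_divide_eq divide_eq_eq mult_ac)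
  then have "P (t * z) = 0 \<longleftrightarrow> (\<exists>n. t \<noteq> 0 \<and> z = 1 / (t * q ^ n))"
    "P (t / z) = 0 \<longleftrightarrow> (\<exists>n. t \<noteq> 0 \<and> z = t * q ^ n)" for t
    by (simp_all only: P_eq_0_iff)
  then show ?thesis using False by (simp add: pole_free_def)
qed (simp add: pole_free_def)

lemma pole_free_open_connected:
  assumes "finite S" "finite T"
  shows "open (pole_free S T)" "countable (- pole_free S T)" "connected (pole_free S T)"
proof -
  define H where "H z = (\<Prod>t\<in>S. P (t * z)) * (\<Prod>t\<in>T. P (t / z))" for z
  have "continuous_on (-{0}) H" unfolding H_def by (intro continuous_intros) auto
  then have "open (-{0} \<inter> H -` (-{0}))" by (intro continuous_open_preimage) auto
  moreover have "-{0} \<inter> H -` (-{0}) = pole_free S T"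
    using assms by (auto simp: pole_free_def H_def)
  ultimately show "open (pole_free S T)" by simp
  have "- pole_free S T \<subseteq> {0} \<union> (\<lambda>(t, n). 1 / (t * q ^ n)) ` (S \<times> UNIV) \<union>
      (\<lambda>(t, n). t * q ^ n) ` (T \<times> UNIV)"
    using not_pole_free_iff by fastforce
  then show "countable (- pole_free S T)"
    using assms by (elim countable_subset) (simp add: countable_finite)
  then have "connected (UNIV - (- pole_free S T))"
    by (intro connected_open_diff_countable) auto
  then show "connected (pole_free S T)" by (simp add: Diff_eq)
qed

lemma straddles_pole_free:
  assumes "straddles T \<gamma>" shows "path_image \<gamma> \<subseteq> pole_free T T"
proof
  fix z assume "z \<in> path_image \<gamma>"
  then show "z \<in> pole_free T T"
    using assms not_pole_free_iff[of z T T] unfolding straddles_def by blast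
qed

text \<open>
  A circle about the origin already has the right winding number at all but finitely many points,
  because the inner sequences tend to \<open>0\<close> and the outer ones to \<open>\<infinity>\<close>. Loops around the exceptional
  points correct the rest.
\<close>

lemma straddling_contour_exists:
  assumes T: "finite T" and sep: "\<And>s t n. s \<in> T \<Longrightarrow> t \<in> T \<Longrightarrow> s * t * q ^ n \<noteq> 1"
  shows "\<exists>\<gamma>. straddles T \<gamma>"
proof -
  define In where "In = {t * q ^ n |t n. t \<in> T - {0}}"
  define Out where "Out = {1 / (t * q ^ n) |t n. t \<in> T - {0}}"
  define D where "D = pole_free T T"
  have D_compl: "- D = {0} \<union> In \<union> Out"
    unfolding D_def In_def Out_def using not_pole_free_iff[of _ T T] by blast
  have "open D" "countable (- D)" "connected D"
    using pole_free_open_connected[OF T T] by (simp_all add: D_def)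
  have finIn: "finite {z \<in> In. norm z \<ge> c}" and finOut: "finite {z \<in> Out. norm z \<le> c}" if "c > 0" for c
  proof -
    have "{z \<in> In. norm z \<ge> c} \<subseteq> (\<Union>t\<in>T. (\<lambda>n. t * q ^ n) ` {n. norm (t * q ^ n) \<ge> c})"
      by (auto simp: In_def)
    then show "finite {z \<in> In. norm z \<ge> c}"
      using T finite_q_orbit_outside[OF that] by (elim finite_subset) auto
    have "{z \<in> Out. norm z \<le> c} \<subseteq>
        (\<Union>t\<in>T. (\<lambda>n. 1 / (t * q ^ n)) ` {n. norm (t * q ^ n) \<ge> 1 / c})"
    proof
      fix z assume "z \<in> {z \<in> Out. norm z \<le> c}"
      then obtain t n where z: "z = 1 / (t * q ^ n)" "t \<in> T" "t \<noteq> 0" "norm z \<le> c" by (auto simp: Out_def)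
      then have "norm (t * q ^ n) = 1 / norm z" by (simp add: norm_divide)
      moreover have "z \<noteq> 0" using z q_nz by simp
      ultimately have "norm (t * q ^ n) \<ge> 1 / c" using z(4) that by (simp add: frac_le)
      then show "z \<in> (\<Union>t\<in>T. (\<lambda>n. 1 / (t * q ^ n)) ` {n. norm (t * q ^ n) \<ge> 1 / c})"
        using z by blast
    qed
    then show "finite {z \<in> Out. norm z \<le> c}"
      using T finite_q_orbit_outside[of "1 / c"] that by (elim finite_subset) auto
  qed
  have iso: "\<exists>r>0. cball p r - {p} \<subseteq> D" if "p \<noteq> 0" for p
  proof -
    let ?c = "norm p"
    define F where "F = {0} \<union> {z \<in> In. norm z \<ge> ?c / 2} \<union> {z \<in> Out. norm z \<le> 2 * ?c}"
    have "finite F" using finIn[of "?c / 2"] finOut[of "2 * ?c"] that by (simp add: F_def)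
    then obtain d where d: "d > 0" "\<forall>x\<in>F. x \<noteq> p \<longrightarrow> d \<le> dist p x"
      using finite_set_avoid by blast
    define r where "r = min (d / 2) (?c / 2)"
    have "z \<in> D" if z: "z \<in> cball p r - {p}" for z
    proof (rule ccontr)
      assume "z \<notin> D"
      have n: "norm z \<ge> ?c / 2" "norm z \<le> 2 * ?c" "dist p z < d"
        using z d(1) norm_triangle_ineq2[of p z] norm_triangle_ineq3[of p z]
        by (auto simp: r_def dist_norm)
      with \<open>z \<notin> D\<close> have "z \<in> F" using D_compl by (auto simp: F_def)
      then show False using d z n by auto
    qed
    then have "cball p r - {p} \<subseteq> D" by blast
    moreover have "r > 0" using d that by (simp add: r_def)
    ultimately show ?thesis by blast
  qed
  \<comment> \<open>a radius that no point of the two kinds of sequences has\<close>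
  have "uncountable {0<..<1::real}" by (simp add: uncountable_open_interval)
  moreover have "countable (norm ` (- D))" using \<open>countable (- D)\<close> by simp
  ultimately obtain r where r: "0 < r" "r < 1" "r \<notin> norm ` (- D)"
    by (metis countable_subset greaterThanLessThan_iff subsetI)
  define g0 where "g0 = circlepath 0 r"
  have g0: "valid_path g0" "pathfinish g0 = pathstart g0" "path_image g0 \<subseteq> D"
    using r by (auto simp: g0_def image_iff)
  have w1: "winding_number g0 w = 1" if "norm w < r" for w
    using that by (simp add: g0_def winding_number_circlepath)
  have w0: "winding_number g0 w = 0" if "w \<notin> D" "\<not> norm w < r" for w
  proof -
    have "norm w \<noteq> r" using that r by (auto simp: image_iff)
    then show ?thesis unfolding g0_def using that r
      by (intro winding_number_zero_outside[where s = "cball 0 r"]) auto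
  qed
  define A where "A = {z \<in> In. norm z \<ge> r}"
  define B where "B = {z \<in> Out. norm z \<le> r}"
  have "In \<inter> Out = {}"
  proof (rule ccontr)
    assume "In \<inter> Out \<noteq> {}"
    then obtain s t m n where *: "s \<in> T" "t \<in> T" "s \<noteq> 0" "t \<noteq> 0" "s * q ^ m = 1 / (t * q ^ n)"
      by (auto simp: In_def Out_def)
    then have "s * t * q ^ (m + n) = 1" using q_nz by (simp add: power_add field_simps)
    then show False using sep * by blast
  qed
  have nz: "0 \<notin> In" "0 \<notin> Out" using q_nz by (auto simp: In_def Out_def)
  have AB: "finite A" "A \<inter> D = {}" "finite B" "B \<inter> D = {}"
    using finIn[of r] finOut[of r] r D_compl by (auto simp: A_def B_def)
  have isoA: "\<exists>r>0. cball p r - {p} \<subseteq> D" if "p \<in> A \<union> B" for p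
    using that nz by (intro iso) (auto simp: A_def B_def)
  obtain g1 where g1: "valid_path g1" "pathfinish g1 = pathstart g1" "path_image g1 \<subseteq> D"
    "\<And>p. p \<in> A \<Longrightarrow> winding_number g1 p = winding_number g0 p + 1"
    "\<And>w. w \<notin> D \<Longrightarrow> w \<notin> A \<Longrightarrow> winding_number g1 w = winding_number g0 w"
    using add_loops[OF \<open>open D\<close> \<open>connected D\<close> AB(1,2) _ _ g0, of 1] isoA by auto
  obtain g2 where g2: "valid_path g2" "pathfinish g2 = pathstart g2" "path_image g2 \<subseteq> D"
    "\<And>p. p \<in> B \<Longrightarrow> winding_number g2 p = winding_number g1 p - 1"
    "\<And>w. w \<notin> D \<Longrightarrow> w \<notin> B \<Longrightarrow> winding_number g2 w = winding_number g1 w"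
    using add_loops[OF \<open>open D\<close> \<open>connected D\<close> AB(3,4) _ _ g1(1-3), of "-1"] isoA by auto
  have inD: "z \<notin> D" if "z \<in> {0} \<union> In \<union> Out" for z using D_compl that by blast
  have wIn: "winding_number g2 z = 1" if "z \<in> In" for z
  proof -
    have "z \<notin> B" using that \<open>In \<inter> Out = {}\<close> by (auto simp: B_def)
    then have "winding_number g2 z = winding_number g1 z" using g2 that inD by auto
    moreover have "winding_number g1 z = 1"
      using that g1 inD w0 w1 by (cases "norm z \<ge> r") (auto simp: A_def)
    ultimately show ?thesis by simp
  qed
  have wOut: "winding_number g2 z = 0" if "z \<in> Out" for z
  proof -
    have "z \<notin> A" using that \<open>In \<inter> Out = {}\<close> by (auto simp: A_def)
    then have 1: "winding_number g1 z = winding_number g0 z" using g1 that inD by auto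
    have "norm z \<noteq> r" using r inD that by (auto simp: image_iff)
    then show ?thesis
      using that g2 inD w0 w1 1 by (cases "norm z \<le> r") (auto simp: B_def)
  qed
  have w2: "winding_number g2 0 = 1"
    using g2(5)[of 0] g1(5)[of 0] nz inD w1[of 0] r by (auto simp: A_def B_def)
  have "straddles T g2"
    unfolding straddles_def
  proof (intro conjI ballI allI impI)
    show "0 \<notin> path_image g2" using g2 inD by auto
    fix t n assume t: "t \<in> T"
    have "t = 0 \<or> t * q ^ n \<in> In" using t by (auto simp: In_def)
    then show "t * q ^ n \<notin> path_image g2" "winding_number g2 (t * q ^ n) = 1"
      using g2 inD wIn w2 by auto
    assume "t \<noteq> 0"
    then have "1 / (t * q ^ n) \<in> Out" using t by (auto simp: Out_def)
    then show "1 / (t * q ^ n) \<notin> path_image g2" "winding_number g2 (1 / (t * q ^ n)) = 0"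
      using g2 inD wOut by auto
  qed (use g2 w2 in auto)
  then show ?thesis by blast
qed

end

section \<open>The Nassrallah-Rahman integral\<close>

context q_base begin

definition PP :: "complex \<Rightarrow> complex \<Rightarrow> complex" where
  "PP t z = P (t * z) * P (t / z)"

definition nr_integrand ::
    "complex \<Rightarrow> complex \<Rightarrow> complex \<Rightarrow> complex \<Rightarrow> complex \<Rightarrow> complex \<Rightarrow> complex" where
  "nr_integrand a b c d e z =
     P (z\<^sup>2) * P (1 / z\<^sup>2) * PP (a * b * c * d * e) z /
     (PP a z * PP b z * PP c z * PP d z * PP e z) / z"

text \<open>
  The denominator in the evaluation of the Nassrallah-Rahman integral.
\<close>

definition pair_product :: "complex \<Rightarrow> complex \<Rightarrow> complex \<Rightarrow> complex \<Rightarrow> complex \<Rightarrow> complex" where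
  "pair_product a b c d e = P (a * b) * P (a * c) * P (a * d) * P (a * e) * P (b * c) *
     P (b * d) * P (b * e) * P (c * d) * P (c * e) * P (d * e)"

lemma PP_0 [simp]: "PP 0 z = 1"
  by (simp add: PP_def)

lemma PP_holomorphic [holomorphic_intros]: "0 \<notin> A \<Longrightarrow> (\<lambda>z. PP t z) holomorphic_on A"
  unfolding PP_def by (intro holomorphic_intros) auto

lemma nr_integrand_holomorphic: "nr_integrand a b c d e holomorphic_on pole_free {a,b,c,d,e} {a,b,c,d,e}"
  unfolding nr_integrand_def by (intro holomorphic_intros) (auto simp: pole_free_def PP_def)

text \<open>
  Both sides depend on \<open>b, c, d, e\<close> only through their elementary symmetric polynomials. Rewriting
  them so makes the identity small enough for Groebner bases.
\<close>

lemma nr_coefficient_identity: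
  fixes a b c d e z w :: complex
  defines "A \<equiv> a * b * c * d * e"
  assumes zw: "z * w = 1"
  shows "(1 - a*b) * (1 - a*c) * (1 - a*d) * (1 - a*e) *
           ((1 - z^2) * (1 - w^2) * (1 - A*z) * (1 - A*w) * w)
       - (1 - a*c*d*e) * (1 - a*b*d*e) * (1 - a*b*c*e) * (1 - a*b*c*d) *
           ((1 - z^2) * (1 - w^2) * (1 - a*z) * (1 - a*w) * w)
       = a * (1 - A * a) *
         ((1 - z^2) * (1 - A*z) * ((1 - a*w) * (1 - b*w) * (1 - c*w) * (1 - d*w) * (1 - e*w)) +
          w^2 * (1 - w^2) * (1 - A*w) * ((1 - a*z) * (1 - b*z) * (1 - c*z) * (1 - d*z) * (1 - e*z)))"
proof -
  define e1 e2 e3 e4 where "e1 = b + c + d + e" and "e2 = b*c + b*d + b*e + c*d + c*e + d*e"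
    and "e3 = b*c*d + b*c*e + b*d*e + c*d*e" and "e4 = b*c*d*e"
  have p: "(1 - b*x) * (1 - c*x) * (1 - d*x) * (1 - e*x) = 1 - e1*x + e2*x^2 - e3*x^3 + e4*x^4" for x
    unfolding e1_def e2_def e3_def e4_def by algebra
  have pa: "(1 - a*b) * (1 - a*c) * (1 - a*d) * (1 - a*e) = 1 - e1*a + e2*a^2 - e3*a^3 + e4*a^4"
    using p[of a] by (simp add: mult.commute)
  have py: "(1 - a*c*d*e) * (1 - a*b*d*e) * (1 - a*b*c*e) * (1 - a*b*c*d) =
      1 - a*e3 + a^2*e4*e2 - a^3*e4^2*e1 + a^4*e4^3"
    unfolding e1_def e2_def e3_def e4_def by algebra
  have A: "A = a * e4" by (simp add: A_def e4_def)
  have p5: "(1 - a*x) * (1 - b*x) * (1 - c*x) * (1 - d*x) * (1 - e*x) =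
      (1 - a*x) * (1 - e1*x + e2*x^2 - e3*x^3 + e4*x^4)" for x
    using p[of x] by (simp add: mult.assoc)
  have "(1 - e1*a + e2*a^2 - e3*a^3 + e4*a^4) *
           ((1 - z^2) * (1 - w^2) * (1 - a*e4*z) * (1 - a*e4*w) * w)
       - (1 - a*e3 + a^2*e4*e2 - a^3*e4^2*e1 + a^4*e4^3) *
           ((1 - z^2) * (1 - w^2) * (1 - a*z) * (1 - a*w) * w)
       = a * (1 - a*e4 * a) *
         ((1 - z^2) * (1 - a*e4*z) * ((1 - a*w) * (1 - e1*w + e2*w^2 - e3*w^3 + e4*w^4)) +
          w^2 * (1 - w^2) * (1 - a*e4*w) * ((1 - a*z) * (1 - e1*z + e2*z^2 - e3*z^3 + e4*z^4)))"
    using zw by algebra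
  then show ?thesis unfolding p5 pa py A .
qed

text \<open>
  This is \<open>nr_integrand\<close> times a rational function that cancels the outermost pole \<open>t\<close> of each sequence
  \<open>t q\<^sup>n\<close>. That leaves room to rescale a contour by \<open>q\<close> without crossing a pole.
\<close>

definition nr_antidifference ::
    "complex \<Rightarrow> complex \<Rightarrow> complex \<Rightarrow> complex \<Rightarrow> complex \<Rightarrow> complex \<Rightarrow> complex" where
  "nr_antidifference a b c d e z = a * (1 - a * b * c * d * e * a) *
     (P (z\<^sup>2) * P (q / z\<^sup>2) * P (a * b * c * d * e * z) * P (q * (a * b * c * d * e) / z)) /
     (P (a * z) * P (b * z) * P (c * z) * P (d * z) * P (e * z) *
      (P (q * a / z) * P (q * b / z) * P (q * c / z) * P (q * d / z) * P (q * e / z)))"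

text \<open>
  With all infinite products reduced to a common factor, this is \<open>nr_coefficient_identity\<close>.
\<close>

lemma nr_difference:
  assumes z: "z \<in> pole_free {a,b,c,d,e} {a,b,c,d,e}"
  shows "(1 - a*b) * (1 - a*c) * (1 - a*d) * (1 - a*e) * nr_integrand a b c d e z
     - (1 - a*c*d*e) * (1 - a*b*d*e) * (1 - a*b*c*e) * (1 - a*b*c*d) * nr_integrand (a * q) b c d e z
     = nr_antidifference a b c d e z - q * nr_antidifference a b c d e (q * z)"
proof -
  define A where "A = a * b * c * d * e"
  define w where "w = 1 / z"
  have z0: "z \<noteq> 0" using z by (simp add: pole_free_def)
  then have zw: "z * w = 1" by (simp add: w_def)
  define U where "U = (1 - a*z) * (1 - b*z) * (1 - c*z) * (1 - d*z) * (1 - e*z)"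
  define W where "W = (1 - a*w) * (1 - b*w) * (1 - c*w) * (1 - d*w) * (1 - e*w)"
  define N where "N = P (q^2 * z^2) * P (q / z^2) * P (q * A * z) * P (q * A / z)"
  define Pt where "Pt = P (q * a * z) * P (q * b * z) * P (q * c * z) * P (q * d * z) * P (q * e * z)"
  define Pw where "Pw = P (q * a / z) * P (q * b / z) * P (q * c / z) * P (q * d / z) * P (q * e / z)"
  have s1: "P (t * z) = (1 - t * z) * P (q * t * z)" and s2: "P (t / z) = (1 - t * w) * P (q * t / z)" for t
    using P_shift[of "t * z"] P_shift[of "t / z"] by (simp_all add: w_def mult_ac)
  note s5 = s1[of a] s1[of b] s1[of c] s1[of d] s1[of e] s2[of a] s2[of b] s2[of c] s2[of d] s2[of e]
  have z2: "P (z^2) = (1 - z^2) * (1 - q * z^2) * P (q^2 * z^2)"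
    using P_shift[of "z^2"] P_shift[of "z^2 * q"] by (simp add: mult_ac power2_eq_square)
  have w2: "P (1 / z^2) = (1 - w^2) * P (q / z^2)"
    using P_shift[of "1 / z^2"] by (simp add: w_def power_divide)
  have qw2: "q * P (q / (q * z)^2) = - ((1 - q * z^2) * w^2 * (1 - w^2) * P (q / z^2))"
  proof -
    have "P (q / (q * z)^2) = (1 - 1 / (q * z^2)) * P (1 / z^2)"
      using P_shift[of "q / (q * z)^2"] q_nz by (simp add: power2_eq_square)
    then show ?thesis using q_nz z0 w2 by (simp add: w_def field_simps)
  qed
  have nz: "U \<noteq> 0" "W \<noteq> 0" "Pt \<noteq> 0" "Pw \<noteq> 0"
    using z by (auto simp: pole_free_def U_def W_def Pt_def Pw_def s5)
  have den: "P (a * z) * P (b * z) * P (c * z) * P (d * z) * P (e * z) = U * Pt"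
      "P (a / z) * P (b / z) * P (c / z) * P (d / z) * P (e / z) = W * Pw"
    unfolding U_def W_def Pt_def Pw_def s5 by (simp_all add: mult_ac)
  have E: "nr_integrand a b c d e z =
      N * (1 - q * z^2) / (Pt * Pw) * ((1 - z^2) * (1 - w^2) * (1 - A*z) * (1 - A*w) * w) / (U * W)"
  proof -
    have "PP a z * PP b z * PP c z * PP d z * PP e z = (U * Pt) * (W * Pw)"
      unfolding PP_def den[symmetric] by (simp add: mult_ac)
    moreover have "P (z\<^sup>2) * P (1 / z\<^sup>2) * PP A z =
        N * (1 - q * z^2) * ((1 - z^2) * (1 - w^2) * (1 - A*z) * (1 - A*w))"
      unfolding PP_def s1[of A] s2[of A] z2 w2 N_def by (simp add: mult_ac)
    ultimately show ?thesis unfolding nr_integrand_def A_def[symmetric] by (simp add: w_def mult_ac)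
  qed
  have E': "nr_integrand (a * q) b c d e z =
      N * (1 - q * z^2) / (Pt * Pw) * ((1 - z^2) * (1 - w^2) * (1 - a*z) * (1 - a*w) * w) / (U * W)"
  proof -
    have "(1 - a*z) * (1 - a*w) * (PP (a * q) z * PP b z * PP c z * PP d z * PP e z) =
        PP a z * PP b z * PP c z * PP d z * PP e z"
      unfolding PP_def s1[of a] s2[of a] by (simp add: mult_ac)
    also have "\<dots> = (U * Pt) * (W * Pw)"
      unfolding PP_def den[symmetric] by (simp add: mult_ac)
    finally have 1: "(1 - a*z) * (1 - a*w) * (PP (a * q) z * PP b z * PP c z * PP d z * PP e z) =
        (U * Pt) * (W * Pw)" .
    have 2: "P (z\<^sup>2) * P (1 / z\<^sup>2) * PP (A * q) z = N * (1 - q * z^2) * ((1 - z^2) * (1 - w^2))"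
      unfolding PP_def z2 w2 N_def by (simp add: mult_ac)
    have 3: "a * q * b * c * d * e = A * q" by (simp add: A_def mult_ac)
    define X where "X = PP (a * q) z * PP b z * PP c z * PP d z * PP e z"
    have 5: "(1 - a*z) * (1 - a*w) \<noteq> 0" using nz by (simp add: U_def W_def)
    then have 4: "X = (U * Pt) * (W * Pw) / ((1 - a*z) * (1 - a*w))"
      using 1 unfolding X_def[symmetric] by (metis nonzero_mult_div_cancel_left)
    have "nr_integrand (a * q) b c d e z = N * (1 - q * z^2) * ((1 - z^2) * (1 - w^2)) / X / z"
      unfolding nr_integrand_def 3 2 X_def ..
    also have "\<dots> = N * (1 - q * z^2) * ((1 - z^2) * (1 - w^2)) * ((1 - a*z) * (1 - a*w)) / ((U * Pt) * (W * Pw)) * w"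
      unfolding 4 using 5 by (simp add: w_def)
    finally show ?thesis by (simp add: mult_ac)
  qed
  have G: "nr_antidifference a b c d e z =
      N * (1 - q * z^2) / (Pt * Pw) * (a * (1 - A * a) * ((1 - z^2) * (1 - A*z) * W)) / (U * W)"
  proof -
    have "nr_antidifference a b c d e z = a * (1 - A * a) *
        (P (z^2) * P (q / z^2) * P (A * z) * P (q * A / z)) / ((U * Pt) * Pw)"
      unfolding nr_antidifference_def den Pw_def A_def ..
    also have "\<dots> = a * (1 - A * a) * (N * (1 - q * z^2) * (1 - z^2) * (1 - A * z)) / ((U * Pt) * Pw)"
      unfolding z2 s1[of A] N_def by (simp add: mult_ac)
    finally show ?thesis using nz by (simp add: divide_simps mult_ac)
  qed
  have G': "q * nr_antidifference a b c d e (q * z) =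
      - (N * (1 - q * z^2) / (Pt * Pw) * (a * (1 - A * a) * (w^2 * (1 - w^2) * (1 - A*w) * U)) / (U * W))"
  proof -
    have "q * nr_antidifference a b c d e (q * z) = a * (1 - A * a) *
        (P (q^2 * z^2) * (q * P (q / (q * z)^2)) * P (q * A * z) * P (A / z)) / (Pt * (W * Pw))"
      unfolding nr_antidifference_def den(2)[symmetric] Pt_def A_def
      using q_nz by (simp add: mult_ac power_mult_distrib)
    also have "\<dots> = - (a * (1 - A * a) * (N * (1 - q * z^2) * w^2 * (1 - w^2) * (1 - A * w)) / (Pt * (W * Pw)))"
      unfolding qw2 s2[of A] N_def by (simp add: mult_ac)
    finally show ?thesis using nz by (simp add: divide_simps mult_ac)
  qed
  note id = nr_coefficient_identity[OF zw, of a b c d e, folded A_def U_def W_def]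
  define K where "K = N * (1 - q * z^2) / (Pt * Pw)"
  have comb: "x * (K * y / (U * W)) - x' * (K * y' / (U * W)) = K * v / (U * W) - - (K * v' / (U * W))"
    if "x * y - x' * y' = v + v'" for x y x' y' v v'
  proof -
    have "x * (K * y / (U * W)) - x' * (K * y' / (U * W)) = K * (x * y - x' * y') / (U * W)"
      by (simp add: algebra_simps diff_divide_distrib)
    then show ?thesis unfolding that by (simp add: algebra_simps add_divide_distrib)
  qed
  show ?thesis unfolding E E' G G' K_def[symmetric]
    by (rule comb) (use id in \<open>simp only: distrib_left\<close>)
qed

lemma nr_antidifference_holomorphic:
  "nr_antidifference a b c d e holomorphic_on pole_free {a,b,c,d,e} ((\<lambda>t. q * t) ` {a,b,c,d,e})"
  unfolding nr_antidifference_def by (intro holomorphic_intros) (auto simp: pole_free_def)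

lemma pole_free_shift:
  assumes "z \<in> pole_free T T"
  shows "z \<in> pole_free T ((\<lambda>t. q * t) ` T)" "q * z \<in> pole_free T ((\<lambda>t. q * t) ` T)"
proof -
  have 1: "P (t * (q * z)) \<noteq> 0" if "P (t * z) \<noteq> 0" for t
    using that P_shift[of "t * z"] by (auto simp: mult_ac)
  have 2: "P (q * t / z) \<noteq> 0" if "P (t / z) \<noteq> 0" for t
    using that P_shift[of "t / z"] by (auto simp: mult_ac)
  show "z \<in> pole_free T ((\<lambda>t. q * t) ` T)" using assms 2 by (simp add: pole_free_def)
  show "q * z \<in> pole_free T ((\<lambda>t. q * t) ` T)" using assms q_nz 1 by (simp add: pole_free_def)
qed

lemma nr_antidifference_shift:
  assumes g: "straddles {a,b,c,d,e} \<gamma>"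
  shows "contour_integral \<gamma> (\<lambda>z. q * nr_antidifference a b c d e (q * z)) =
         contour_integral \<gamma> (nr_antidifference a b c d e)"
proof -
  define T where "T = {a,b,c,d,e}"
  define D where "D = pole_free T ((\<lambda>t. q * t) ` T)"
  have "finite T" by (simp add: T_def)
  have D: "open D" "connected D" using pole_free_open_connected[of T "(\<lambda>t. q * t) ` T"] \<open>finite T\<close>
    by (simp_all add: D_def)
  have hol: "nr_antidifference a b c d e holomorphic_on D"
    using nr_antidifference_holomorphic by (simp add: D_def T_def)
  have g': "valid_path \<gamma>" "pathfinish \<gamma> = pathstart \<gamma>" using g by (auto simp: straddles_def)
  define g2 where "g2 = (\<lambda>t. q * \<gamma> t)"
  have outside: "(z = 0 \<or> (\<exists>t\<in>T. \<exists>n. t \<noteq> 0 \<and> z = 1 / (t * q ^ n)) \<or>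
      (\<exists>t\<in>T. \<exists>n. t \<noteq> 0 \<and> z = q * t * q ^ n))" if "z \<notin> D" for z
    using that unfolding D_def not_pole_free_iff by auto
  note str = g[unfolded straddles_def, folded T_def]
  have both: "z \<notin> path_image \<gamma> \<and> z / q \<notin> path_image \<gamma> \<and> winding_number \<gamma> z = winding_number \<gamma> (z / q)"
    if "z \<notin> D" for z
    using outside[OF that]
  proof (elim disjE bexE exE conjE)
    fix t n assume t: "t \<in> T" "t \<noteq> 0" "z = 1 / (t * q ^ n)"
    then have "z / q = 1 / (t * q ^ Suc n)" by (simp add: mult_ac)
    then show ?thesis using str t by metis
  next
    fix t n assume t: "t \<in> T" "t \<noteq> 0" "z = q * t * q ^ n"
    then have "z / q = t * q ^ n" "z = t * q ^ Suc n" using q_nz by (simp_all add: mult_ac)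
    then show ?thesis using str t by metis
  qed (use str in simp)
  have "contour_integral \<gamma> (nr_antidifference a b c d e) = contour_integral g2 (nr_antidifference a b c d e)"
  proof (rule contour_integral_eq_of_same_winding[OF D hol])
    show "path_image \<gamma> \<subseteq> D" using both by blast
    show "path_image g2 \<subseteq> D"
      using both q_nz by (force simp: g2_def path_image_scale)
    show "valid_path g2" "pathfinish g2 = pathstart g2"
      using g' by (auto simp: g2_def valid_path_scale pathfinish_def pathstart_def)
    show "winding_number \<gamma> w = winding_number g2 w" if "w \<notin> D" for w
      using winding_number_scale[OF g'(1) q_nz, of "w / q"] both[OF that] q_nz by (simp add: g2_def)
  qed (use g' in auto)
  also have "\<dots> = contour_integral \<gamma> (\<lambda>z. q * nr_antidifference a b c d e (q * z))"
    unfolding g2_def using contour_integral_scale[OF g'(1)] .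
  finally show ?thesis ..
qed

lemma straddles_shift:
  assumes "straddles (insert a T) \<gamma>" shows "straddles (insert (a * q ^ k) T) \<gamma>"
proof -
  have "a * q ^ k * q ^ n = a * q ^ (k + n)" for n by (simp add: power_add)
  moreover have "a * q ^ k \<noteq> 0 \<Longrightarrow> a \<noteq> 0" by simp
  ultimately show ?thesis using assms unfolding straddles_def by (metis insert_iff)
qed

lemma straddles_zero: "straddles (insert a T) \<gamma> \<Longrightarrow> straddles (insert 0 T) \<gamma>"
  by (auto simp: straddles_def)

lemma straddles_integrable:
  assumes "straddles {a,b,c,d,e} \<gamma>" shows "nr_integrand a b c d e contour_integrable_on \<gamma>"
  using assms straddles_pole_free[OF assms] pole_free_open_connected[of "{a,b,c,d,e}" "{a,b,c,d,e}"]
  by (intro contour_integrable_holomorphic_simple[OF nr_integrand_holomorphic]) (auto simp: straddles_def)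

text \<open>
  With this normalisation the difference equation has polynomial coefficients and stays meaningful
  when parameters vanish.
\<close>

definition nr_integral where
  "nr_integral \<gamma> a b c d e = pair_product a b c d e * contour_integral \<gamma> (nr_integrand a b c d e)"

text \<open>
  The total difference integrates to zero, which relates the integrals for \<open>a\<close> and \<open>a q\<close>.
\<close>

lemma nr_step:
  assumes g: "straddles {a,b,c,d,e} \<gamma>"
  shows "nr_integral \<gamma> a b c d e =
    (1 - a*c*d*e) * (1 - a*b*d*e) * (1 - a*b*c*e) * (1 - a*b*c*d) * nr_integral \<gamma> (a * q) b c d e"
proof -
  define X where "X = (1 - a*b) * (1 - a*c) * (1 - a*d) * (1 - a*e)"
  define Y where "Y = (1 - a*c*d*e) * (1 - a*b*d*e) * (1 - a*b*c*e) * (1 - a*b*c*d)"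
  have g': "straddles {a * q, b, c, d, e} \<gamma>" using straddles_shift[OF g, of 1] by simp
  have D: "path_image \<gamma> \<subseteq> pole_free {a,b,c,d,e} {a,b,c,d,e}" using straddles_pole_free[OF g] .
  have v: "valid_path \<gamma>" using g by (simp add: straddles_def)
  have oD: "open (pole_free {a,b,c,d,e} {a,b,c,d,e})" by (intro pole_free_open_connected) auto
  have "nr_antidifference a b c d e holomorphic_on pole_free {a,b,c,d,e} {a,b,c,d,e}"
    by (rule holomorphic_on_subset[OF nr_antidifference_holomorphic]) (blast dest: pole_free_shift)
  then have i1: "nr_antidifference a b c d e contour_integrable_on \<gamma>"
    by (rule contour_integrable_holomorphic_simple[OF _ oD v D])
  have "(nr_antidifference a b c d e \<circ> (\<lambda>z. q * z)) holomorphic_on pole_free {a,b,c,d,e} {a,b,c,d,e}"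
    by (rule holomorphic_on_compose, intro holomorphic_intros,
        rule holomorphic_on_subset[OF nr_antidifference_holomorphic])
       (blast dest: pole_free_shift)
  then have "(\<lambda>z. q * nr_antidifference a b c d e (q * z)) holomorphic_on pole_free {a,b,c,d,e} {a,b,c,d,e}"
    unfolding o_def by (rule holomorphic_on_mult[OF holomorphic_on_const])
  then have i2: "(\<lambda>z. q * nr_antidifference a b c d e (q * z)) contour_integrable_on \<gamma>"
    by (rule contour_integrable_holomorphic_simple[OF _ oD v D])
  have "X * contour_integral \<gamma> (nr_integrand a b c d e) - Y * contour_integral \<gamma> (nr_integrand (a * q) b c d e)
      = contour_integral \<gamma> (\<lambda>z. X * nr_integrand a b c d e z - Y * nr_integrand (a * q) b c d e z)"
    using straddles_integrable[OF g] straddles_integrable[OF g']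
    by (simp add: contour_integral_diff contour_integral_lmul contour_integrable_lmul)
  also have "\<dots> = contour_integral \<gamma> (\<lambda>z. nr_antidifference a b c d e z - q * nr_antidifference a b c d e (q * z))"
    using nr_difference D unfolding X_def Y_def by (intro contour_integral_cong) auto
  also have "\<dots> = 0"
    using i1 i2 nr_antidifference_shift[OF g] by (simp add: contour_integral_diff)
  finally have "X * contour_integral \<gamma> (nr_integrand a b c d e) =
      Y * contour_integral \<gamma> (nr_integrand (a * q) b c d e)" by simp
  moreover have "pair_product a b c d e = X * pair_product (a * q) b c d e"
    unfolding pair_product_def X_def
    using P_shift[of "a * b"] P_shift[of "a * c"] P_shift[of "a * d"] P_shift[of "a * e"]
    by (simp add: mult_ac)
  ultimately show ?thesis unfolding nr_integral_def Y_def[symmetric] by (simp add: mult_ac)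
qed

text \<open>
  The integrand is jointly continuous in \<open>z\<close> and in its first parameter, which runs through the
  compact set \<open>{a q\<^sup>n} \<union> {0}\<close>, so it converges uniformly on a fixed contour.
\<close>

lemma nr_integral_tendsto:
  assumes g: "straddles {a,b,c,d,e} \<gamma>"
  shows "(\<lambda>n. nr_integral \<gamma> (a * q ^ n) b c d e) \<longlonglongrightarrow> nr_integral \<gamma> 0 b c d e"
proof -
  define T where "T = {a,b,c,d,e}"
  have D: "path_image \<gamma> \<subseteq> pole_free T T" "open (pole_free T T)"
    using straddles_pole_free[OF g] pole_free_open_connected[of T T] by (simp_all add: T_def)
  have v: "valid_path \<gamma>" "pathfinish \<gamma> = pathstart \<gamma>" using g by (auto simp: straddles_def)
  obtain h B where h: "valid_path h" "pathfinish h = pathstart h" "path_image h \<subseteq> pole_free T T"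
    "\<And>f. f holomorphic_on pole_free T T \<Longrightarrow> contour_integral h f = contour_integral \<gamma> f"
    "\<And>t. t \<in> {0..1} \<Longrightarrow> norm (vector_derivative h (at t)) \<le> B"
    using polynomial_loop[OF D(2) v D(1)] by metis
  define K where "K = insert 0 (range (\<lambda>n. a * q ^ n))"
  have "compact K" unfolding K_def
    using compact_sequence_with_limit[OF tendsto_mult_q_power[of a]] by simp
  have PK: "P (x * z) \<noteq> 0" "P (x / z) \<noteq> 0" if "x \<in> K" "z \<in> pole_free T T" for x z
  proof -
    have "a \<in> T" by (simp add: T_def)
    then have a: "P (a * z) \<noteq> 0" "P (a / z) \<noteq> 0" using that(2) by (auto simp: pole_free_def)
    have "P (a * q ^ n * z) \<noteq> 0" "P (a * q ^ n / z) \<noteq> 0" for n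
    proof -
      have "P (a * z * q ^ n) \<noteq> 0" "P (a / z * q ^ n) \<noteq> 0"
        using a P_shift_power[of "a * z" n] P_shift_power[of "a / z" n] by auto
      then show "P (a * q ^ n * z) \<noteq> 0" "P (a * q ^ n / z) \<noteq> 0" by (simp_all add: mult_ac)
    qed
    then show "P (x * z) \<noteq> 0" "P (x / z) \<noteq> 0"
      using that(1) by (auto simp: K_def)
  qed
  have K: "PP x z \<noteq> 0" if "x \<in> K" "z \<in> pole_free T T" for x z
    using PK[OF that] by (simp add: PP_def)
  have PPt: "PP t z \<noteq> 0" if "t \<in> T" "z \<in> pole_free T T" for t z
    using that by (auto simp: PP_def pole_free_def)
  have hol: "nr_integrand x b c d e holomorphic_on pole_free T T" if "x \<in> K" for x
    unfolding nr_integrand_def using that K PPt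
    by (intro holomorphic_intros) (auto simp: pole_free_def T_def)
  have "contour_integral h (nr_integrand x b c d e) = contour_integral \<gamma> (nr_integrand x b c d e)"
    if "x \<in> K" for x using h(4) hol that by blast
  moreover have "a * q ^ n \<in> K" "0 \<in> K" for n by (auto simp: K_def)
  ultimately have "contour_integral h (nr_integrand (a * q ^ n) b c d e) =
      contour_integral \<gamma> (nr_integrand (a * q ^ n) b c d e)"
    "contour_integral h (nr_integrand 0 b c d e) = contour_integral \<gamma> (nr_integrand 0 b c d e)" for n
    by blast+
  moreover have "(\<lambda>n. contour_integral h (nr_integrand (a * q ^ n) b c d e)) \<longlonglongrightarrow>
      contour_integral h (nr_integrand 0 b c d e)"
  proof (rule contour_integral_uniform_limit(2)[OF _ _ h(5) h(1)])
    show "\<forall>\<^sub>F n in sequentially. nr_integrand (a * q ^ n) b c d e contour_integrable_on h"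
      using contour_integrable_holomorphic_simple[OF hol D(2) h(1,3)]
      by (intro always_eventually) (auto simp: K_def)
    let ?F = "\<lambda>(x, z). nr_integrand x b c d e z"
    have nz: "snd p \<noteq> 0" "PP (fst p) (snd p) * PP b (snd p) * PP c (snd p) * PP d (snd p) * PP e (snd p) \<noteq> 0"
      if "p \<in> K \<times> path_image h" for p
    proof -
      have "fst p \<in> K" "snd p \<in> pole_free T T" using that h(3) by auto
      then show "snd p \<noteq> 0"
        "PP (fst p) (snd p) * PP b (snd p) * PP c (snd p) * PP d (snd p) * PP e (snd p) \<noteq> 0"
        using K PPt[of b] PPt[of c] PPt[of d] PPt[of e]
        by (simp_all add: T_def pole_free_def)
    qed
    have cPP: "continuous_on (K \<times> path_image h) (\<lambda>p. PP (f p) (snd p))"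
      if "continuous_on (K \<times> path_image h) f" for f
      unfolding PP_def using that nz(1) by (intro continuous_intros) auto
    have "continuous_on (K \<times> path_image h) ?F"
      unfolding nr_integrand_def case_prod_beta
      by (intro continuous_on_divide continuous_on_mult cPP P_continuous continuous_on_power
          continuous_on_fst continuous_on_snd continuous_on_id continuous_on_const ballI)
        (use nz in auto)
    moreover have "compact (K \<times> path_image h)"
      using \<open>compact K\<close> h(1) by (intro compact_Times compact_valid_path_image)
    ultimately have uc: "uniformly_continuous_on (K \<times> path_image h) ?F"
      by (rule compact_uniformly_continuous)
    show "uniform_limit (path_image h) (\<lambda>n. nr_integrand (a * q ^ n) b c d e)
        (nr_integrand 0 b c d e) sequentially"
      unfolding uniform_limit_iff
    proof (intro allI impI)
      fix \<epsilon> :: real assume "\<epsilon> > 0"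
      then obtain \<delta> where \<delta>: "\<delta> > 0" "\<And>x y. x \<in> K \<times> path_image h \<Longrightarrow> y \<in> K \<times> path_image h \<Longrightarrow>
          dist y x < \<delta> \<Longrightarrow> dist (?F y) (?F x) < \<epsilon>"
        using uc unfolding uniformly_continuous_on_def by metis
      have "\<forall>\<^sub>F n in sequentially. dist (a * q ^ n) 0 < \<delta>"
        using tendsto_mult_q_power[of a] \<delta>(1) by (rule tendstoD)
      then show "\<forall>\<^sub>F n in sequentially. \<forall>z\<in>path_image h.
          dist (nr_integrand (a * q ^ n) b c d e z) (nr_integrand 0 b c d e z) < \<epsilon>"
      proof eventually_elim
        case (elim n)
        show ?case
        proof
          fix z assume "z \<in> path_image h"
          then show "dist (nr_integrand (a * q ^ n) b c d e z) (nr_integrand 0 b c d e z) < \<epsilon>"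
            using \<delta>(2)[of "(0, z)" "(a * q ^ n, z)"] elim by (auto simp: K_def dist_Pair_Pair)
        qed
      qed
    qed
  qed simp_all
  ultimately have "(\<lambda>n. contour_integral \<gamma> (nr_integrand (a * q ^ n) b c d e)) \<longlonglongrightarrow>
      contour_integral \<gamma> (nr_integrand 0 b c d e)"
    by simp
  moreover have "(\<lambda>n. pair_product (a * q ^ n) b c d e) \<longlonglongrightarrow> pair_product 0 b c d e"
    unfolding pair_product_def
    by (intro tendsto_mult P_tendsto tendsto_mult_q_power tendsto_const)
  ultimately show ?thesis unfolding nr_integral_def by (intro tendsto_mult)
qed

text \<open>
  Iterating the difference equation sends the first parameter to \<open>0\<close>, and the polynomial factors
  build up infinite products.
\<close>

lemma nr_integral_reduce:
  assumes g: "straddles {a,b,c,d,e} \<gamma>"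
  shows "nr_integral \<gamma> a b c d e =
    P (a*c*d*e) * P (a*b*d*e) * P (a*b*c*e) * P (a*b*c*d) * nr_integral \<gamma> 0 b c d e"
proof -
  have *: "nr_integral \<gamma> a b c d e =
      (\<Prod>i<n. 1 - a*c*d*e * q ^ i) * (\<Prod>i<n. 1 - a*b*d*e * q ^ i) * (\<Prod>i<n. 1 - a*b*c*e * q ^ i) *
      (\<Prod>i<n. 1 - a*b*c*d * q ^ i) * nr_integral \<gamma> (a * q ^ n) b c d e" for n
  proof (induction n)
    case (Suc n)
    have "straddles {a * q ^ n, b, c, d, e} \<gamma>" using straddles_shift[OF g] .
    note nr_step[OF this]
    with Suc show ?case by (simp add: mult_ac)
  qed simp
  have "(\<lambda>n. (\<Prod>i<n. 1 - a*c*d*e * q ^ i) * (\<Prod>i<n. 1 - a*b*d*e * q ^ i) * (\<Prod>i<n. 1 - a*b*c*e * q ^ i) *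
      (\<Prod>i<n. 1 - a*b*c*d * q ^ i) * nr_integral \<gamma> (a * q ^ n) b c d e) \<longlonglongrightarrow>
      P (a*c*d*e) * P (a*b*d*e) * P (a*b*c*e) * P (a*b*c*d) * nr_integral \<gamma> 0 b c d e"
    by (intro tendsto_mult P_LIMSEQ nr_integral_tendsto g)
  then show ?thesis unfolding *[symmetric] by (simp add: LIMSEQ_const_iff)
qed

lemma nr_integral_rotate: "nr_integral \<gamma> a b c d e = nr_integral \<gamma> b c d e a"
proof -
  have "nr_integrand a b c d e = nr_integrand b c d e a"
    by (rule ext) (simp add: nr_integrand_def mult_ac)
  moreover have "pair_product a b c d e = pair_product b c d e a"
    by (simp add: pair_product_def mult_ac)
  ultimately show ?thesis by (simp add: nr_integral_def)
qed

lemma nr_integral_via_zero: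
  assumes g: "straddles {a,b,c,d,e} \<gamma>"
  shows "nr_integral \<gamma> a b c d e =
    P (b*c*d*e) * P (a*c*d*e) * P (a*b*d*e) * P (a*b*c*e) * P (a*b*c*d) * nr_integral \<gamma> 0 0 0 0 0"
proof -
  have "straddles {b,c,d,e,0} \<gamma>" "straddles {c,d,e,0,0} \<gamma>" "straddles {d,e,0,0,0} \<gamma>"
    "straddles {e,0,0,0,0} \<gamma>"
    using g straddles_zero[OF g] by (auto simp: straddles_def)
  from this[THEN nr_integral_reduce] nr_integral_reduce[OF g]
    nr_integral_rotate[of \<gamma> 0 b c d e] nr_integral_rotate[of \<gamma> 0 c d e 0]
    nr_integral_rotate[of \<gamma> 0 d e 0 0] nr_integral_rotate[of \<gamma> 0 e 0 0 0]
  show ?thesis by (simp add: mult_ac)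
qed

text \<open>
  The right-hand side \<open>H\<close> satisfies \<open>H z = (1 - z\<^sup>2) H (s z)\<close>. Iterating this produces the
  product on the left, since \<open>H 0 = 1\<close>.
\<close>

lemma P_square: assumes "s\<^sup>2 = q" shows "P (z\<^sup>2) = P z * P (- z) * P (s * z) * P (- (s * z))"
proof -
  define H where "H z = P z * P (- z) * P (s * z) * P (- (s * z))" for z
  have Hs: "H z = (1 - z\<^sup>2) * H (s * z)" for z
  proof -
    have zq: "z * q = s * (s * z)" "- z * q = - (s * (s * z))"
      using assms by (auto simp: power2_eq_square)
    have "P z * P (- z) = ((1 - z) * P (z * q)) * ((1 - (- z)) * P (- z * q))"
      by (simp only: flip: P_shift)
    also have "\<dots> = (1 - z\<^sup>2) * (P (z * q) * P (- z * q))"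
      by (simp add: power2_eq_square algebra_simps)
    finally have "P z * P (- z) = (1 - z\<^sup>2) * (P (s * (s * z)) * P (- (s * (s * z))))"
      unfolding zq .
    then show ?thesis by (simp add: H_def)
  qed
  have it: "H z = (\<Prod>i<n. 1 - z\<^sup>2 * q ^ i) * H (s ^ n * z)" for n
  proof (induction n)
    case (Suc n)
    have "(s ^ n * z)\<^sup>2 = z\<^sup>2 * q ^ n" unfolding assms[symmetric]
      by (simp add: power_mult_distrib power_mult[symmetric] mult.commute)
    with Suc Hs[of "s ^ n * z"] show ?case by (simp add: mult_ac)
  qed simp
  have "norm s ^ 2 < 1" using q_lt_1 assms by (simp add: norm_power[symmetric])
  then have "norm s < 1" by (simp add: power_less_one_iff abs_square_less_1)
  then have "(\<lambda>n. s ^ n * z) \<longlonglongrightarrow> 0" using LIMSEQ_power_zero tendsto_mult_left_zero by blast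
  moreover have "continuous_on UNIV H" unfolding H_def by (intro continuous_intros)
  then have "isCont H 0" by (simp add: continuous_on_eq_continuous_at)
  ultimately have "(\<lambda>n. H (s ^ n * z)) \<longlonglongrightarrow> H 0" by (rule isCont_tendsto_compose[rotated])
  then have "(\<lambda>n. (\<Prod>i<n. 1 - z\<^sup>2 * q ^ i) * H (s ^ n * z)) \<longlonglongrightarrow> P (z\<^sup>2) * H 0"
    by (intro tendsto_mult P_LIMSEQ)
  then have "H z = P (z\<^sup>2) * H 0" unfolding it[symmetric] by (simp add: LIMSEQ_const_iff)
  then show ?thesis by (simp add: H_def)
qed

text \<open>
  The remaining constant can be read off from any single case. For the parameters \<open>q, -q, s, -s, 0\<close>
  with \<open>s\<^sup>2 = q\<close> the integrand is a Laurent polynomial, by the duplication formula above.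
\<close>

lemma nr_integral_unit_circle:
  "P q * nr_integral (circlepath 0 1) 0 0 0 0 0 = 4 * of_real pi * \<i>"
proof -
  define s where "s = csqrt q"
  have s: "s\<^sup>2 = q" by (simp add: s_def)
  then have s0: "s \<noteq> 0" using q_nz by auto
  have "norm s ^ 2 < 1" using q_lt_1 s by (simp add: norm_power[symmetric])
  then have s1: "norm s < 1" by (simp add: power_less_one_iff abs_square_less_1)
  let ?g = "circlepath 0 1 :: real \<Rightarrow> complex"
  have str: "straddles {q, -q, s, -s, 0} ?g"
  proof -
    have less: "norm (t * q ^ n) < 1" if "norm t < 1" for t n
    proof -
      have "norm q ^ n \<le> 1" using q_lt_1 by (intro power_le_one) auto
      then have "norm t * norm q ^ n \<le> norm t" by (intro mult_left_le) auto
      then show ?thesis using that by (simp add: norm_mult norm_power)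
    qed
    have in1: "winding_number ?g z = 1" if "norm z < 1" for z
      using that by (simp add: winding_number_circlepath)
    have out1: "z \<notin> path_image ?g \<and> winding_number ?g z = 0" if "norm z > 1" for z
      using that winding_number_zero_outside[where s = "cball 0 1" and \<gamma> = ?g and z = z] by auto
    have "t * q ^ n \<notin> path_image ?g \<and> winding_number ?g (t * q ^ n) = 1 \<and>
        (t \<noteq> 0 \<longrightarrow> 1 / (t * q ^ n) \<notin> path_image ?g \<and> winding_number ?g (1 / (t * q ^ n)) = 0)"
      if "norm t < 1" for t n
    proof (intro conjI impI)
      show "t * q ^ n \<notin> path_image ?g" "winding_number ?g (t * q ^ n) = 1"
        using less[OF that, of n] in1 by auto
      assume "t \<noteq> 0"
      then have "norm (1 / (t * q ^ n)) > 1" using less[OF that, of n] q_nz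
        by (simp add: norm_divide)
      then show "1 / (t * q ^ n) \<notin> path_image ?g" "winding_number ?g (1 / (t * q ^ n)) = 0"
        using out1 by auto
    qed
    moreover have "norm t < 1" if "t \<in> {q, -q, s, -s, 0}" for t using that s1 q_lt_1 by auto
    ultimately have main: "\<forall>t\<in>{q, -q, s, -s, 0}. \<forall>n. t * q ^ n \<notin> path_image ?g \<and>
        winding_number ?g (t * q ^ n) = 1 \<and>
        (t \<noteq> 0 \<longrightarrow> 1 / (t * q ^ n) \<notin> path_image ?g \<and> winding_number ?g (1 / (t * q ^ n)) = 0)"
      by blast
    show ?thesis unfolding straddles_def using in1[of 0] by (intro conjI main) auto
  qed
  define L where "L z = 2 / z - z - 1 / z ^ 3" for z :: complex
  have int: "contour_integral ?g (nr_integrand q (-q) s (-s) 0) = contour_integral ?g L"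
  proof (rule contour_integral_cong)
    fix z assume "z \<in> path_image ?g"
    then have z: "z \<in> pole_free {q, -q, s, -s, 0} {q, -q, s, -s, 0}"
      using straddles_pole_free[OF str] by blast
    then have z0: "z \<noteq> 0" by (simp add: pole_free_def)
    have *: "P (x\<^sup>2) = (1 - x\<^sup>2) * (P (q * x) * P (- q * x) * P (s * x) * P (- s * x))" for x
    proof -
      have "P (x\<^sup>2) = ((1 - x) * P (x * q)) * ((1 - (- x)) * P (- x * q)) * P (s * x) * P (- (s * x))"
        by (simp only: P_square[OF s] flip: P_shift)
      also have "\<dots> = (1 - x\<^sup>2) * (P (x * q) * P (- x * q) * P (s * x) * P (- (s * x)))"
        by (simp add: power2_eq_square algebra_simps)
      finally show ?thesis by (simp add: mult.commute)
    qed
    define X where "X = PP q z * PP (-q) z * PP s z * PP (-s) z"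
    have X0: "X \<noteq> 0" using z by (auto simp: X_def PP_def pole_free_def)
    have "P (z\<^sup>2) * P ((1 / z)\<^sup>2) = (1 - z\<^sup>2) * (1 - (1 / z)\<^sup>2) * X"
      unfolding * X_def PP_def by (simp add: mult_ac)
    then have "nr_integrand q (-q) s (-s) 0 z = (1 - z\<^sup>2) * (1 - (1 / z)\<^sup>2) / z"
      using X0 unfolding nr_integrand_def X_def[symmetric] by (simp add: power_divide)
    also have "\<dots> = L z" using z0 by (simp add: L_def field_simps power2_eq_square power3_eq_cube)
    finally show "nr_integrand q (-q) s (-s) 0 z = L z" .
  qed simp
  have "(L has_contour_integral 4 * of_real pi * \<i>) ?g"
  proof -
    have "((\<lambda>z. 2 / (z - 0)) has_contour_integral (2 * of_real pi * \<i> * 2)) ?g"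
      using Cauchy_integral_circlepath[of 0 1 "\<lambda>_. 2" 0] by simp
    moreover have "((\<lambda>z. - z - 1 / z ^ 3) has_contour_integral 0) ?g"
    proof (rule Cauchy_theorem_primitive[where S = "-{0}" and f = "\<lambda>z. - z\<^sup>2 / 2 + 1 / (2 * z\<^sup>2)"])
      fix z :: complex assume "z \<in> -{0}"
      then show "((\<lambda>z. - z\<^sup>2 / 2 + 1 / (2 * z\<^sup>2)) has_field_derivative (- z - 1 / z ^ 3)) (at z within - {0})"
        by (auto intro!: derivative_eq_intros simp: field_simps power2_eq_square power3_eq_cube)
    qed auto
    ultimately have "((\<lambda>z. 2 / (z - 0) + (- z - 1 / z ^ 3)) has_contour_integral
        (2 * of_real pi * \<i> * 2 + 0)) ?g"
      by (rule has_contour_integral_add)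
    then show ?thesis by (simp add: L_def[abs_def] algebra_simps)
  qed
  then have J: "contour_integral ?g (nr_integrand q (-q) s (-s) 0) = 4 * of_real pi * \<i>"
    unfolding int by (rule contour_integral_unique)
  have pp: "pair_product q (-q) s (-s) 0 * P q = P (q ^ 3)"
  proof -
    have "P q * (P s * P (- s) * P (- q)) = P q"
      using P_square[OF s, of s] s by (simp add: power2_eq_square[symmetric] mult_ac)
    then have euler: "P s * P (- s) * P (- q) = 1" using P_q_nz by simp
    define u v where "u = P (q * s) * P (- (q * s))" and "v = P (- q\<^sup>2)"
    have 1: "P s * P (- s) = (1 - q) * u"
    proof -
      have "P s * P (- s) = ((1 - s) * P (s * q)) * ((1 - (- s)) * P (- s * q))"
        by (simp only: flip: P_shift)
      also have "\<dots> = (1 - s\<^sup>2) * (P (s * q) * P (- s * q))"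
        by (simp add: power2_eq_square algebra_simps)
      finally show ?thesis by (simp add: s u_def mult.commute)
    qed
    have 2: "P (- q) = (1 + q) * v" using P_shift[of "- q"] by (simp add: v_def power2_eq_square)
    have 3: "P q = (1 - q) * (1 - q\<^sup>2) * P (q ^ 3)"
      using P_shift[of q] P_shift[of "q\<^sup>2"] by (simp add: power2_eq_square power3_eq_cube mult_ac)
    have "pair_product q (-q) s (-s) 0 = v * u * u * P (- q)"
      unfolding pair_product_def u_def v_def using s by (simp add: power2_eq_square mult_ac)
    then have "pair_product q (-q) s (-s) 0 * P q =
       ((1 - q) * u * P (- q)) * ((1 - q) * u * ((1 + q) * v)) * P (q ^ 3)"
      unfolding 3 by (simp add: power2_eq_square algebra_simps)
    then show ?thesis using euler unfolding 1 2[symmetric] by simp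
  qed
  have "P q * nr_integral ?g q (-q) s (-s) 0 = P (q ^ 3) * (4 * of_real pi * \<i>)"
    using pp unfolding nr_integral_def J by (metis mult.assoc mult.commute)
  moreover have "nr_integral ?g q (-q) s (-s) 0 = P (q ^ 3) * nr_integral ?g 0 0 0 0 0"
    using nr_integral_via_zero[OF str] s by (simp add: power3_eq_cube power2_eq_square mult_ac)
  moreover have "P (q ^ 3) \<noteq> 0"
    using P_q_nz P_shift_power[of q 2] by (auto simp: power2_eq_square power3_eq_cube mult_ac)
  ultimately show ?thesis by simp
qed

text \<open>
  All parameters are sent to \<open>0\<close> one after the other, and what is left does not depend on them.
\<close>

theorem nassrallah_rahman:
  assumes g: "straddles {a,b,c,d,e} \<gamma>"
  shows "P q * (pair_product a b c d e * contour_integral \<gamma> (nr_integrand a b c d e)) =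
    4 * of_real pi * \<i> * (P (b*c*d*e) * P (a*c*d*e) * P (a*b*d*e) * P (a*b*c*e) * P (a*b*c*d))"
proof -
  have g': "valid_path \<gamma>" "pathfinish \<gamma> = pathstart \<gamma>" "0 \<notin> path_image \<gamma>" "winding_number \<gamma> 0 = 1"
    using g by (auto simp: straddles_def)
  have "nr_integral \<gamma> 0 0 0 0 0 = nr_integral (circlepath 0 1) 0 0 0 0 0"
  proof -
    have "connected (- {0 :: complex})"
      by (intro connected_punctured_universe) simp
    moreover have "nr_integrand 0 0 0 0 0 holomorphic_on -{0}"
      unfolding nr_integrand_def by (intro holomorphic_intros) auto
    ultimately have "contour_integral \<gamma> (nr_integrand 0 0 0 0 0) =
        contour_integral (circlepath 0 1) (nr_integrand 0 0 0 0 0)"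
      using g' by (intro contour_integral_eq_of_same_winding[where D = "-{0}"])
        (auto simp: winding_number_circlepath_centre)
    then show ?thesis by (simp add: nr_integral_def)
  qed
  then show ?thesis
    using nr_integral_via_zero[OF g] nr_integral_unit_circle unfolding nr_integral_def[symmetric]
    by (simp add: mult_ac)
qed

end

section \<open>Functions with a theta multiplier\<close>

context q_base begin

lemma theta_shift_quasi_zero:
  assumes m: "\<And>z. z \<noteq> 0 \<Longrightarrow> m z \<noteq> 0" "\<And>z. z \<noteq> 0 \<Longrightarrow> f (q * z) = m z * f z"
    and z: "z \<noteq> 0" and w: "w \<in> qpowers q"
  shows "f (z * w) = 0 \<longleftrightarrow> f z = (0 :: complex)"
proof -
  have step: "f (q * z) = 0 \<longleftrightarrow> f z = 0" if "z \<noteq> 0" for z using m that by auto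
  obtain n where n: "w = q powi n" using w by (auto simp: qpowers_iff)
  have "f (z * q powi n) = 0 \<longleftrightarrow> f z = 0"
  proof (induction n rule: int_induct[of _ 0])
    case (step1 i)
    have eq: "z * q powi (i + 1) = q * (z * q powi i)" using q_nz by (simp add: power_int_add)
    show ?case unfolding eq using step1 step[of "z * q powi i"] z q_nz
      by (simp add: power_int_eq_0_iff)
  next
    case (step2 i)
    have eq: "q * (z * q powi (i - 1)) = z * q powi i" using q_nz by (simp add: power_int_diff)
    show ?case using step2 step[of "z * q powi (i - 1)"] z q_nz unfolding eq
      by (simp add: power_int_eq_0_iff)
  qed simp
  then show ?thesis by (simp add: n)
qed

lemma fundamental_annulus:
  assumes "z \<noteq> 0"
  obtains n where "norm q \<le> norm (z * q powi n)" "norm (z * q powi n) \<le> 1"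
proof -
  define L where "L = - ln (norm q)"
  have L: "L > 0" using q_nz q_lt_1 by (simp add: L_def)
  define n where "n = \<lceil>ln (norm z) / L\<rceil>"
  have "ln (norm q powi n) = of_int n * ln (norm q)"
    using q_nz by (simp add: ln_powr flip: powr_real_of_int')
  then have "ln (norm (z * q powi n)) = ln (norm z) + of_int n * ln (norm q)"
    using assms q_nz by (simp add: norm_mult norm_power_int ln_mult power_int_eq_0_iff)
  then have ln: "ln (norm (z * q powi n)) = ln (norm z) - of_int n * L" by (simp add: L_def)
  have "of_int n \<ge> ln (norm z) / L" "of_int n < ln (norm z) / L + 1" unfolding n_def by linarith+
  then have "of_int n * L \<ge> ln (norm z)" "of_int n * L < ln (norm z) + L"
    using L by (simp_all add: field_simps)
  then have "ln (norm (z * q powi n)) \<le> ln 1" "ln (norm q) \<le> ln (norm (z * q powi n))"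
    using ln by (simp_all add: L_def)
  moreover have "norm (z * q powi n) > 0" using assms q_nz by (simp add: power_int_eq_0_iff)
  ultimately show ?thesis
    using q_nz that[of n] ln_le_cancel_iff[of "norm (z * q powi n)" 1]
      ln_le_cancel_iff[of "norm q" "norm (z * q powi n)"] by auto
qed

text \<open>
  The values on the annulus \<open>\<bar>q\<bar> \<le> \<bar>z\<bar> \<le> 1\<close> are all values, so \<open>H \<circ> exp\<close> is entire and bounded.
\<close>

lemma elliptic_constant:
  assumes H: "H holomorphic_on -{0}" and per: "\<And>z. z \<noteq> 0 \<Longrightarrow> H (q * z) = H z"
    and z: "z \<noteq> 0" "w \<noteq> 0"
  shows "H z = H w"
proof -
  have pn: "H (z * q powi n) = H z" if "z \<noteq> 0" for z n
  proof -
    have "H (z * q powi n) - H z = 0 \<longleftrightarrow> H z - H z = 0"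
      by (rule theta_shift_quasi_zero[where m = "\<lambda>_. 1" and f = "\<lambda>x. H x - H z"])
         (use that per in auto)
    then show ?thesis by simp
  qed
  let ?K = "cball (0 :: complex) 1 - ball 0 (norm q)"
  have "continuous_on ?K H"
    using q_nz by (intro holomorphic_on_imp_continuous_on holomorphic_on_subset[OF H]) auto
  moreover have "compact ?K" by (intro compact_diff) auto
  ultimately have "bounded (H ` ?K)" by (intro compact_imp_bounded compact_continuous_image)
  then obtain B where B: "norm (H z) \<le> B" if "z \<in> ?K" for z by (metis bounded_iff image_eqI)
  have "norm (H z) \<le> B" if nz: "z \<noteq> 0" for z
  proof -
    obtain n where "norm q \<le> norm (z * q powi n)" "norm (z * q powi n) \<le> 1"
      using fundamental_annulus[OF nz] by blast
    then have "norm (H (z * q powi n)) \<le> B" by (intro B) auto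
    then show ?thesis using pn[OF nz] by simp
  qed
  then have "bounded (range (H \<circ> exp))" by (intro boundedI[where B = B]) auto
  moreover have "(H \<circ> exp) holomorphic_on UNIV"
    by (rule holomorphic_on_compose_gen[OF _ H]) (auto intro: holomorphic_intros)
  ultimately have "(H \<circ> exp) constant_on UNIV" by (rule Liouville_theorem[rotated])
  then obtain c where "\<And>x. H (exp x) = c" by (auto simp: constant_on_def)
  then show ?thesis using z by (metis exp_Ln)
qed

text \<open>
  The quotient \<open>f / g\<close> is elliptic, and it has no poles since \<open>f\<close> vanishes at the zeros of \<open>g\<close>, which
  are simple. So it is constant, and the extra zero \<open>z0\<close> makes the constant \<open>0\<close>.
\<close>

lemma theta_quotient_zero:
  assumes f: "f holomorphic_on -{0}" and g: "g holomorphic_on -{0}"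
    and m: "\<And>z. z \<noteq> 0 \<Longrightarrow> m z \<noteq> 0" "\<And>z. z \<noteq> 0 \<Longrightarrow> f (q * z) = m z * f z"
      "\<And>z. z \<noteq> 0 \<Longrightarrow> g (q * z) = m z * g z"
    and zeros: "\<And>z. z \<noteq> 0 \<Longrightarrow> g z = 0 \<Longrightarrow> f z = 0 \<and> deriv g z \<noteq> 0"
    and z0: "z0 \<noteq> 0" "g z0 \<noteq> 0" "f z0 = 0" and z: "z \<noteq> 0"
  shows "f z = 0"
proof -
  define F where "F z = f z / g z" for z
  have an: "f analytic_on -{0}" "g analytic_on -{0}" using f g by (simp_all add: analytic_on_open open_Compl)
  have "F meromorphic_on -{0}" unfolding F_def[abs_def]
    using an by (intro meromorphic_intros analytic_on_imp_meromorphic_on)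
  then have iso: "isolated_singularity_at F z" if "z \<noteq> 0" for z
    using that by (intro meromorphic_on_isolated_singularity) (auto intro: meromorphic_on_subset)
  have lim: "\<exists>c. F \<midarrow>z\<rightarrow> c" if "z \<noteq> 0" for z
  proof (cases "g z = 0")
    case True
    have "F \<midarrow>z\<rightarrow> deriv f z / deriv g z" unfolding F_def
    proof (rule lhopital_complex_simple)
      show "(f has_field_derivative deriv f z) (at z)" "(g has_field_derivative deriv g z) (at z)"
        using that by (auto intro!: holomorphic_derivI[OF f] holomorphic_derivI[OF g] open_Compl)
    qed (use True zeros[OF that True] in auto)
    then show ?thesis by blast
  next
    case False
    have "f \<midarrow>z\<rightarrow> f z" "g \<midarrow>z\<rightarrow> g z"
      using an that by (auto intro!: isContD analytic_at_imp_isCont elim: analytic_on_subset)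
    then show ?thesis unfolding F_def using False by (auto intro: tendsto_divide)
  qed
  define H where "H = remove_sings F"
  have FH: "F \<midarrow>z\<rightarrow> H z" if "z \<noteq> 0" for z
    using lim[OF that] unfolding H_def by (metis remove_sings_eqI)
  have "H analytic_on {z}" if "z \<noteq> 0" for z
    unfolding H_def using lim[OF that] remove_sings_analytic_at[OF iso[OF that]] by blast
  then have "H holomorphic_on -{0}"
    by (intro analytic_imp_holomorphic) (subst analytic_on_analytic_at, auto)
  moreover have "H (q * z) = H z" if "z \<noteq> 0" for z
  proof -
    have "q * z \<noteq> 0" using that q_nz by simp
    have "((\<lambda>u. q * u) \<longlongrightarrow> q * z) (at z)" by (intro tendsto_intros)
    moreover have "\<forall>\<^sub>F u in at z. q * u \<noteq> q * z"
      using q_nz by (auto simp: eventually_at_filter)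
    ultimately have "((\<lambda>u. F (q * u)) \<longlongrightarrow> H (q * z)) (at z)"
      using FH[OF \<open>q * z \<noteq> 0\<close>] by (rule tendsto_compose_eventually[rotated])
    moreover have "\<forall>\<^sub>F u in at z. F (q * u) = F u"
    proof -
      have "\<forall>\<^sub>F u in at z. u \<in> -{0}" using that by (intro eventually_at_in_open') auto
      then show ?thesis by eventually_elim (auto simp: F_def m)
    qed
    ultimately have "(F \<longlongrightarrow> H (q * z)) (at z)" by (rule Lim_transform_eventually)
    then show ?thesis using FH[OF that] LIM_unique by blast
  qed
  ultimately have const: "H z = H w" if "z \<noteq> 0" "w \<noteq> 0" for z w
    using elliptic_constant that by blast
  have HF: "H z = F z" if "z \<noteq> 0" "g z \<noteq> 0" for z
  proof -
    have "F analytic_on {z}" unfolding F_def[abs_def]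
      using an that by (intro analytic_intros) (auto elim: analytic_on_subset)
    then show ?thesis by (simp add: H_def)
  qed
  have "F z0 = 0" using z0 by (simp add: F_def)
  show ?thesis
  proof (cases "g z = 0")
    case False
    then have "F z = 0" using const[OF z z0(1)] HF z z0 \<open>F z0 = 0\<close> by metis
    then show ?thesis using False by (simp add: F_def)
  qed (use zeros z in blast)
qed

lemma deriv_mult_nz:
  assumes "f holomorphic_on -{0}" "g holomorphic_on -{0}" "z \<noteq> 0"
    and "f z = 0 \<Longrightarrow> deriv f z \<noteq> 0 \<and> g z \<noteq> 0" "g z = 0 \<Longrightarrow> deriv g z \<noteq> 0 \<and> f z \<noteq> 0"
    and "f z * g z = 0"
  shows "deriv (\<lambda>z. f z * g z) z \<noteq> 0"
proof -
  have "deriv (\<lambda>z. f z * g z) z = f z * deriv g z + deriv f z * g z"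
    using assms(1-3) by (intro deriv_mult) (auto intro: holomorphic_on_imp_differentiable_at)
  then show ?thesis using assms(4-6) by auto
qed

lemma theta_linear_simple_zero:
  assumes "c \<noteq> 0" "z \<noteq> 0" "\<theta> (z * c) = 0" shows "deriv (\<lambda>z. \<theta> (z * c)) z \<noteq> 0"
proof -
  have "((\<lambda>z. \<theta> (z * c)) has_field_derivative deriv \<theta> (z * c) * c) (at z)"
    using assms by (intro DERIV_chain'[OF _ theta_has_derivative] derivative_eq_intros | simp)+
  then show ?thesis using theta_simple_zero[of "z * c"] assms by (simp add: DERIV_imp_deriv)
qed

lemma theta_square_simple_zero:
  assumes "z \<noteq> 0" "\<theta> (z\<^sup>2) = 0" shows "deriv (\<lambda>z. \<theta> (z\<^sup>2)) z \<noteq> 0"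
proof -
  have "((\<lambda>z. \<theta> (z\<^sup>2)) has_field_derivative deriv \<theta> (z\<^sup>2) * (2 * z)) (at z)"
    using assms by (intro DERIV_chain'[OF _ theta_has_derivative]) (auto intro!: derivative_eq_intros)
  then show ?thesis using theta_simple_zero[of "z\<^sup>2"] assms by (simp add: DERIV_imp_deriv)
qed

definition \<Theta> :: "complex \<Rightarrow> complex \<Rightarrow> complex" where
  "\<Theta> x lam = \<theta> (lam * x) * \<theta> (lam / x)"

lemma Theta_holomorphic [holomorphic_intros]:
  assumes "x \<noteq> 0" "0 \<notin> A" shows "\<Theta> x holomorphic_on A"
  unfolding \<Theta>_def[abs_def] using assms by (intro holomorphic_intros) auto

lemma Theta_shift:
  assumes "x \<noteq> 0" "lam \<noteq> 0" shows "\<Theta> x (q * lam) = \<Theta> x lam / lam\<^sup>2"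
  using theta_shift[of "lam * x"] theta_shift[of "lam / x"] assms
  by (simp add: \<Theta>_def power2_eq_square mult_ac)

lemma Theta_inverse:
  assumes "x \<noteq> 0" "lam \<noteq> 0" shows "\<Theta> x (1 / lam) = \<Theta> x lam / lam\<^sup>2"
  using theta_inverse[of "lam * x"] theta_inverse[of "lam / x"] assms
  by (simp add: \<Theta>_def power2_eq_square mult_ac)

lemma Theta_eq_0_iff:
  assumes "x \<noteq> 0" "lam \<noteq> 0"
  shows "\<Theta> x lam = 0 \<longleftrightarrow> lam * x \<in> qpowers q \<or> lam / x \<in> qpowers q"
  using assms theta_eq_0_iff by (simp add: \<Theta>_def)

lemma Theta_simple_zero:
  assumes x: "x \<noteq> 0" "x\<^sup>2 \<notin> qpowers q" and lam: "lam \<noteq> 0" "\<Theta> x lam = 0"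
  shows "deriv (\<Theta> x) lam \<noteq> 0"
proof -
  have "\<not> (lam * x \<in> qpowers q \<and> lam / x \<in> qpowers q)"
  proof
    assume *: "lam * x \<in> qpowers q \<and> lam / x \<in> qpowers q"
    then have "lam * x * inverse (lam / x) \<in> qpowers q" using qpowers_mult qpowers_inverse by blast
    then show False using x lam by (simp add: power2_eq_square field_simps)
  qed
  then have excl: "\<not> (\<theta> (lam * x) = 0 \<and> \<theta> (lam / x) = 0)" using theta_eq_0_iff lam x by simp
  have "deriv (\<lambda>z. \<theta> (z * x) * \<theta> (z / x)) lam \<noteq> 0"
  proof (rule deriv_mult_nz)
    show "(\<lambda>z. \<theta> (z * x)) holomorphic_on -{0}" "(\<lambda>z. \<theta> (z / x)) holomorphic_on -{0}"
      using x by (auto intro!: holomorphic_intros)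
    show "deriv (\<lambda>z. \<theta> (z * x)) lam \<noteq> 0 \<and> \<theta> (lam / x) \<noteq> 0" if "\<theta> (lam * x) = 0"
      using that excl theta_linear_simple_zero[of x lam] x lam by auto
    show "deriv (\<lambda>z. \<theta> (z / x)) lam \<noteq> 0 \<and> \<theta> (lam * x) \<noteq> 0" if "\<theta> (lam / x) = 0"
      using that excl theta_linear_simple_zero[of "1 / x" lam] x lam by auto
  qed (use lam in \<open>auto simp: \<Theta>_def\<close>)
  then show ?thesis by (simp add: \<Theta>_def[abs_def])
qed

text \<open>
  Both sides have the same multiplier and the same behaviour under inversion as functions of \<open>lam\<close>,
  and they agree at \<open>u\<close> and \<open>v\<close>. So their difference vanishes at the zeros of \<open>\<Theta> u\<close> and at one more point.
\<close>

lemma three_term_relation: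
  assumes nz: "x \<noteq> 0" "u \<noteq> 0" "v \<noteq> 0" "lam \<noteq> 0"
    and gen: "u\<^sup>2 \<notin> qpowers q" "u * v \<notin> qpowers q" "v / u \<notin> qpowers q"
  shows "\<Theta> x lam * \<Theta> v u * \<Theta> u v = \<Theta> x u * \<Theta> u v * \<Theta> v lam + \<Theta> x v * \<Theta> v u * \<Theta> u lam"
proof -
  define f where "f lam = \<Theta> x lam * \<Theta> v u * \<Theta> u v - \<Theta> x u * \<Theta> u v * \<Theta> v lam - \<Theta> x v * \<Theta> v u * \<Theta> u lam" for lam
  have 1: "\<Theta> y y = 0" if "y \<noteq> 0" for y using Theta_eq_0_iff[OF that that] that by simp
  have fm: "f (q * z) = 1 / z\<^sup>2 * f z" "f (1 / z) = 1 / z\<^sup>2 * f z" if "z \<noteq> 0" for z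
    using that nz by (simp_all add: f_def Theta_shift Theta_inverse algebra_simps diff_divide_distrib add_divide_distrib)
  have fu: "f u = 0" "f v = 0" using 1 nz by (simp_all add: f_def)
  have "f lam = 0"
  proof (rule theta_quotient_zero[where f = f and g = "\<Theta> u" and m = "\<lambda>z. 1 / z\<^sup>2" and ?z0.0 = v])
    show "f holomorphic_on -{0}" "\<Theta> u holomorphic_on -{0}"
      unfolding f_def[abs_def] using nz by (auto intro!: holomorphic_intros)
    show "\<Theta> u v \<noteq> 0" using Theta_eq_0_iff[of u v] nz gen by (simp add: mult.commute)
    fix z assume z: "z \<noteq> 0" "\<Theta> u z = 0"
    have qz: "f (y * w) = 0 \<longleftrightarrow> f y = 0" if "y \<noteq> 0" "w \<in> qpowers q" for y w
      using that fm(1) by (intro theta_shift_quasi_zero[where m = "\<lambda>z. 1 / z\<^sup>2"]) auto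
    have "f (1 / u) = 0" using fm(2)[of u] fu nz by simp
    moreover have "z * u \<in> qpowers q \<or> z / u \<in> qpowers q" using z Theta_eq_0_iff nz by simp
    ultimately have "f z = 0"
      using qz[of "1 / u" "z * u"] qz[of u "z / u"] nz fu by auto
    then show "f z = 0 \<and> deriv (\<Theta> u) z \<noteq> 0" using Theta_simple_zero z nz gen by blast
  qed (use nz fu fm Theta_shift in auto)
  then show ?thesis by (simp add: f_def algebra_simps)
qed

section \<open>The integral with six parameters\<close>

definition six_integrand :: "(nat \<Rightarrow> complex) \<Rightarrow> complex \<Rightarrow> complex \<Rightarrow> complex" where
  "six_integrand c lam z =
     P (z\<^sup>2) * P (1 / z\<^sup>2) * (\<theta> (lam * z) * \<theta> (lam / z)) / (\<Prod>j=1..6. PP (c j) z) / z"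

definition pairs :: "(nat \<Rightarrow> complex) \<Rightarrow> complex" where
  "pairs c = (\<Prod>i=1..6. \<Prod>j\<in>{i<..6}. P (c i * c j))"

lemma prod_six: "(\<Prod>j=1..6. f j) = f 1 * f 2 * f 3 * f 4 * f 5 * (f (6::nat) :: complex)"
  by (simp add: numeral_eq_Suc prod.atLeast_Suc_atMost mult_ac)

lemma pairs_explicit:
  "pairs c = P (c 1 * c 2) * P (c 1 * c 3) * P (c 1 * c 4) * P (c 1 * c 5) * P (c 1 * c 6) *
     pair_product (c 2) (c 3) (c 4) (c 5) (c 6)"
proof -
  have "{1<..6::nat} = {2,3,4,5,6}" "{2<..6::nat} = {3,4,5,6}" "{3<..6::nat} = {4,5,6}"
    "{4<..6::nat} = {5,6}" "{5<..6::nat} = {6}" "{6<..6::nat} = {}" by auto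
  then show ?thesis unfolding pairs_def prod_six by (simp add: pair_product_def mult_ac)
qed

text \<open>
  At \<open>lam = a\<close> the theta functions cancel \<open>(a z, a / z)\<^sub>\<infinity>\<close> in the denominator and leave
  \<open>(q z / a, q / (a z))\<^sub>\<infinity>\<close>. As \<open>q / a\<close> is the product of the other five parameters, this is a
  Nassrallah-Rahman integrand.
\<close>

lemma six_integrand_at_parameter:
  assumes abc: "a * (b * c * d * e * f) = q" and g: "straddles {a,b,c,d,e,f} \<gamma>"
  shows "P q * (P (a * b) * P (a * c) * P (a * d) * P (a * e) * P (a * f) * pair_product b c d e f) *
    contour_integral \<gamma> (\<lambda>z. P (z\<^sup>2) * P (1 / z\<^sup>2) * (\<theta> (a * z) * \<theta> (a / z)) /
       (PP a z * PP b z * PP c z * PP d z * PP e z * PP f z) / z) =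
    4 * of_real pi * \<i> * (\<theta> (a * b) * \<theta> (a * c) * \<theta> (a * d) * \<theta> (a * e) * \<theta> (a * f))"
proof -
  have nz: "a \<noteq> 0" "b \<noteq> 0" "c \<noteq> 0" "d \<noteq> 0" "e \<noteq> 0" "f \<noteq> 0" using abc q_nz by auto
  have g5: "straddles {b,c,d,e,f} \<gamma>" using g by (auto simp: straddles_def)
  have "contour_integral \<gamma> (\<lambda>z. P (z\<^sup>2) * P (1 / z\<^sup>2) * (\<theta> (a * z) * \<theta> (a / z)) /
       (PP a z * PP b z * PP c z * PP d z * PP e z * PP f z) / z) =
     contour_integral \<gamma> (nr_integrand b c d e f)"
  proof (rule contour_integral_cong)
    fix z assume "z \<in> path_image \<gamma>"
    then have z: "z \<noteq> 0" "PP a z \<noteq> 0" using straddles_pole_free[OF g] by (auto simp: pole_free_def PP_def)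
    have "b * c * d * e * f = q / a" using abc nz by (simp add: field_simps)
    then have "\<theta> (a * z) * \<theta> (a / z) = PP a z * PP (b * c * d * e * f) z"
      using nz z by (simp add: qtheta_def PP_def mult_ac)
    then show "P (z\<^sup>2) * P (1 / z\<^sup>2) * (\<theta> (a * z) * \<theta> (a / z)) /
       (PP a z * PP b z * PP c z * PP d z * PP e z * PP f z) / z = nr_integrand b c d e f z"
      using z(2) by (simp add: nr_integrand_def mult.assoc)
  qed simp
  moreover have "q / (a * b) = c * d * e * f" "q / (a * c) = b * d * e * f" "q / (a * d) = b * c * e * f"
    "q / (a * e) = b * c * d * f" "q / (a * f) = b * c * d * e"
    using nz by (simp_all add: abc[symmetric] mult_ac)
  ultimately show ?thesis using nassrallah_rahman[OF g5] by (simp add: qtheta_def mult_ac)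
qed

lemma theta_difference_shift:
  assumes c: "(\<Prod>j=1..6. c j) = q" and z: "z \<noteq> 0"
  shows "theta_difference q c (q * z) = 1 / (z ^ 6 * q) * theta_difference q c z"
proof -
  have cnz: "c j \<noteq> 0" if "j \<in> {1..6}" for j using c q_nz that by (metis finite_atLeastAtMost prod_zero)
  have "(\<Prod>j=1..6. \<theta> (q * z * c j)) = (\<Prod>j=1..6. - (\<theta> (z * c j) / (z * c j)))"
    using z cnz theta_shift by (intro prod.cong) (auto simp: mult.assoc)
  also have "\<dots> = (\<Prod>j=1..6. \<theta> (z * c j)) / (z ^ 6 * q)"
    using c by (simp add: prod_dividef prod.distrib prod_uminus)
  finally have 1: "(\<Prod>j=1..6. \<theta> (q * z * c j)) = (\<Prod>j=1..6. \<theta> (z * c j)) / (z ^ 6 * q)" .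
  have "(\<Prod>j=1..6. \<theta> (q * z / c j)) = (\<Prod>j=1..6. - (\<theta> (z / c j) / (z / c j)))"
  proof (intro prod.cong refl)
    fix j assume "j \<in> {1..6::nat}"
    then show "\<theta> (q * z / c j) = - (\<theta> (z / c j) / (z / c j))"
      using theta_shift[of "z / c j"] z cnz by simp
  qed
  also have "\<dots> = (\<Prod>j=1..6. \<theta> (z / c j)) / (z ^ 6 / q)"
    using c by (simp add: prod_dividef prod.distrib prod_uminus)
  finally have 2: "(\<Prod>j=1..6. \<theta> (q * z / c j)) = (\<Prod>j=1..6. \<theta> (z / c j)) / (z ^ 6 / q)" .
  show ?thesis unfolding theta_difference_def 1 2 using z q_nz
    by (simp add: power_int_minus field_simps power2_eq_square)
qed

lemma theta_difference_inverse:
  assumes c: "(\<Prod>j=1..6. c j) = q" and z: "z \<noteq> 0"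
  shows "theta_difference q c (1 / z) = - theta_difference q c z / z ^ 4"
proof -
  have cnz: "c j \<noteq> 0" if "j \<in> {1..6}" for j using c q_nz that by (metis finite_atLeastAtMost prod_zero)
  have "(\<Prod>j=1..6. \<theta> (1 / z * c j)) = (\<Prod>j=1..6. - (\<theta> (z / c j) / (z / c j)))"
  proof (intro prod.cong refl)
    fix j assume "j \<in> {1..6::nat}"
    then show "\<theta> (1 / z * c j) = - (\<theta> (z / c j) / (z / c j))"
      using theta_inverse[of "z / c j"] z cnz by simp
  qed
  also have "\<dots> = (\<Prod>j=1..6. \<theta> (z / c j)) / (z ^ 6 / q)"
    using c by (simp add: prod_dividef prod.distrib prod_uminus)
  finally have 1: "(\<Prod>j=1..6. \<theta> (1 / z * c j)) = (\<Prod>j=1..6. \<theta> (z / c j)) / (z ^ 6 / q)" .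
  have "(\<Prod>j=1..6. \<theta> (1 / z / c j)) = (\<Prod>j=1..6. - (\<theta> (z * c j) / (z * c j)))"
  proof (intro prod.cong refl)
    fix j assume "j \<in> {1..6::nat}"
    then show "\<theta> (1 / z / c j) = - (\<theta> (z * c j) / (z * c j))"
      using theta_inverse[of "z * c j"] z cnz by simp
  qed
  also have "\<dots> = (\<Prod>j=1..6. \<theta> (z * c j)) / (z ^ 6 * q)"
    using c by (simp add: prod_dividef prod.distrib prod_uminus)
  finally have 2: "(\<Prod>j=1..6. \<theta> (1 / z / c j)) = (\<Prod>j=1..6. \<theta> (z * c j)) / (z ^ 6 * q)" .
  have p: "(1 / z) powi (-2) = z ^ 2" "z powi (-2) = 1 / z ^ 2"
    using z by (simp_all add: power_int_minus power_divide inverse_eq_divide)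
  have zp: "z ^ 6 = z ^ 2 * z ^ 4" by (simp add: power_add[symmetric])
  show ?thesis unfolding theta_difference_def 1 2 p zp using z q_nz by (simp add: field_simps)
qed

text \<open>
  If \<open>z\<^sup>2 = q\<^sup>k\<close>, then inversion followed by \<open>k\<close> shifts fixes \<open>z\<close>, but these two functional equations
  together change the sign of the theta difference. The proof first shifts to \<open>k \<in> {0, 1}\<close>.
\<close>

lemma theta_difference_zero:
  assumes c: "(\<Prod>j=1..6. c j) = q" and z: "z \<noteq> 0" "z\<^sup>2 \<in> qpowers q"
  shows "theta_difference q c z = 0"
proof -
  let ?D = "theta_difference q c"
  obtain k where k: "z\<^sup>2 = q powi k" using z by (auto simp: qpowers_iff)
  define y where "y = z * q powi (- (k div 2))"
  have y0: "y \<noteq> 0" using z q_nz by (simp add: y_def power_int_eq_0_iff)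
  have "y\<^sup>2 = q powi k * (q powi (- (k div 2)) * q powi (- (k div 2)))"
    unfolding y_def k[symmetric] by (simp add: power2_eq_square)
  also have "\<dots> = q powi (k + (- (k div 2) + - (k div 2)))"
    by (metis power_int_add q_nz)
  also have "k + (- (k div 2) + - (k div 2)) = k mod 2" by (simp add: minus_mult_div_eq_mod[symmetric])
  finally have y2: "y\<^sup>2 = q powi (k mod 2)" .
  have zy: "?D y = 0 \<longleftrightarrow> ?D z = 0" unfolding y_def
    by (rule theta_shift_quasi_zero[where m = "\<lambda>z. 1 / (z ^ 6 * q)"])
       (use z q_nz theta_difference_shift[OF c] in auto)
  have "?D y = - ?D y"
  proof (cases "k mod 2 = 0")
    case True
    then have "y\<^sup>2 = 1" using y2 by simp
    moreover have "y ^ 4 = (y\<^sup>2)\<^sup>2" by (simp flip: power_mult)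
    ultimately have "1 / y = y" "y ^ 4 = 1" using y0 by (auto simp: power2_eq_square field_simps)
    then show ?thesis using theta_difference_inverse[OF c y0] by simp
  next
    case False
    then have "k mod 2 = 1" by presburger
    then have yq: "y\<^sup>2 = q" using y2 by simp
    then have e: "q * (1 / y) = y" using y0 by (simp add: power2_eq_square field_simps)
    have "?D y = 1 / ((1 / y) ^ 6 * q) * ?D (1 / y)"
      using theta_difference_shift[OF c, of "1 / y"] y0 unfolding e by simp
    also have "\<dots> = 1 / ((1 / y) ^ 6 * y\<^sup>2) * (- ?D y / y ^ 4)"
      using theta_difference_inverse[OF c y0] yq by simp
    also have "\<dots> = - ?D y" using y0 by (simp add: field_simps power_add[symmetric])
    finally show ?thesis .
  qed
  then show ?thesis using zy by simp
qed

lemma six_integrand_integrable: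
  assumes g: "straddles (c ` {1..6}) \<gamma>" and lam: "lam \<noteq> 0"
  shows "six_integrand c lam contour_integrable_on \<gamma>"
proof (rule contour_integrable_holomorphic_simple)
  let ?D = "pole_free (c ` {1..6}) (c ` {1..6})"
  show "six_integrand c lam holomorphic_on ?D"
    unfolding six_integrand_def[abs_def] using lam
    by (intro holomorphic_intros) (auto simp: pole_free_def PP_def)
  show "open ?D" by (intro pole_free_open_connected) auto
qed (use g straddles_pole_free[OF g] in \<open>auto simp: straddles_def\<close>)

text \<open>
  By the three-term relation the integral is a combination of its values at \<open>lam = c 1\<close> and
  \<open>lam = c 2\<close>, which are known. Hence both sides are holomorphic in \<open>lam\<close> and have the same
  multiplier, both vanish for \<open>lam\<^sup>2 \<in> q\<^sup>\<int>\<close>, and they agree at \<open>c 1\<close>, \<open>1 / c 1\<close> and \<open>c 2\<close>. These are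
  enough zeros to make their difference vanish, by comparison with \<open>\<theta> (lam\<^sup>2) \<Theta> (c 1) lam\<close>.
\<close>

theorem six_parameter_integral:
  assumes c: "(\<Prod>j=1..6. c j) = q"
    and gen: "(c 1)\<^sup>2 \<notin> qpowers q" "c 1 * c 2 \<notin> qpowers q" "c 2 / c 1 \<notin> qpowers q"
    and gen2: "(c 2)\<^sup>2 \<notin> qpowers q"
    and g: "straddles (c ` {1..6}) \<gamma>" and lam: "lam \<noteq> 0"
  shows "P q * \<theta> (lam\<^sup>2) * pairs c * contour_integral \<gamma> (six_integrand c lam) =
    4 * of_real pi * \<i> * theta_difference q c lam"
proof -
  have cnz: "c j \<noteq> 0" if "j \<in> {1..6}" for j
    using c q_nz that by (metis finite_atLeastAtMost prod_zero)
  define u v where "u = c 1" and "v = c 2"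
  have nz: "u \<noteq> 0" "v \<noteq> 0" using cnz by (auto simp: u_def v_def)
  note gen' = gen[folded u_def v_def]
  define I where "I lam = contour_integral \<gamma> (six_integrand c lam)" for lam
  define p where "p = 4 * of_real pi * \<i>"
  define K where "K = P q * pairs c"
  have im: "c ` {1..6} = {c 1, c 2, c 3, c 4, c 5, c 6}"
  proof -
    have "{1..6::nat} = {1,2,3,4,5,6}" by auto
    then show ?thesis by simp
  qed
  have atu: "K * I u * \<theta> (u\<^sup>2) = p * theta_difference q c u"
  proof -
    have e: "c 1 * (c 2 * c 3 * c 4 * c 5 * c 6) = q" using c unfolding prod_six by (simp add: mult_ac)
    have g': "straddles {c 1, c 2, c 3, c 4, c 5, c 6} \<gamma>" using g unfolding im .
    have D: "theta_difference q c u = \<theta> (u\<^sup>2) * (\<theta> (u * c 2) * \<theta> (u * c 3) * \<theta> (u * c 4) * \<theta> (u * c 5) * \<theta> (u * c 6))"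
      using theta_eq_0_iff[of 1] nz unfolding theta_difference_def prod_six u_def
      by (simp add: power2_eq_square mult_ac)
    show ?thesis
      using six_integrand_at_parameter[OF e g']
      unfolding p_def K_def I_def six_integrand_def[abs_def] prod_six pairs_explicit u_def D[unfolded u_def]
      by (simp add: mult_ac)
  qed
  have atv: "K * I v * \<theta> (v\<^sup>2) = p * theta_difference q c v"
  proof -
    have e: "c 2 * (c 1 * c 3 * c 4 * c 5 * c 6) = q" using c unfolding prod_six by (simp add: mult_ac)
    have g': "straddles {c 2, c 1, c 3, c 4, c 5, c 6} \<gamma>" using g unfolding im by (simp add: insert_commute)
    have D: "theta_difference q c v = \<theta> (v\<^sup>2) * (\<theta> (v * c 1) * \<theta> (v * c 3) * \<theta> (v * c 4) * \<theta> (v * c 5) * \<theta> (v * c 6))"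
      using theta_eq_0_iff[of 1] nz unfolding theta_difference_def prod_six v_def
      by (simp add: power2_eq_square mult_ac)
    have pr: "pairs c = P (c 2 * c 1) * P (c 2 * c 3) * P (c 2 * c 4) * P (c 2 * c 5) * P (c 2 * c 6) *
        pair_product (c 1) (c 3) (c 4) (c 5) (c 6)"
      unfolding pairs_explicit pair_product_def by (simp add: mult_ac)
    show ?thesis
      using six_integrand_at_parameter[OF e g']
      unfolding p_def K_def I_def six_integrand_def[abs_def] prod_six pr v_def D[unfolded v_def]
      by (simp add: mult_ac)
  qed
  have I3: "I lam * \<Theta> v u * \<Theta> u v = I u * \<Theta> u v * \<Theta> v lam + I v * \<Theta> v u * \<Theta> u lam"
    if lam: "lam \<noteq> 0" for lam
  proof -
    have S: "six_integrand c lam z * (\<Theta> v u * \<Theta> u v) =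
        six_integrand c u z * (\<Theta> u v * \<Theta> v lam) + six_integrand c v z * (\<Theta> v u * \<Theta> u lam)"
      if "z \<in> path_image \<gamma>" for z
    proof -
      have z: "z \<noteq> 0" using g that by (auto simp: straddles_def)
      define X where "X = P (z\<^sup>2) * P (1 / z\<^sup>2) / (\<Prod>j=1..6. PP (c j) z) / z"
      have "six_integrand c l z = X * \<Theta> z l" for l by (simp add: six_integrand_def X_def \<Theta>_def)
      then show ?thesis using three_term_relation[OF z nz lam gen'] by (simp add: algebra_simps)
    qed
    have i: "six_integrand c l contour_integrable_on \<gamma>" if "l \<noteq> 0" for l
      using six_integrand_integrable[OF g that] .
    have "I lam * (\<Theta> v u * \<Theta> u v) = contour_integral \<gamma> (\<lambda>z. six_integrand c lam z * (\<Theta> v u * \<Theta> u v))"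
      unfolding I_def by (rule contour_integral_rmul[OF i[OF lam], symmetric])
    also have "\<dots> = contour_integral \<gamma> (\<lambda>z. six_integrand c u z * (\<Theta> u v * \<Theta> v lam) +
        six_integrand c v z * (\<Theta> v u * \<Theta> u lam))"
      using S by (intro contour_integral_cong) auto
    also have "\<dots> = I u * (\<Theta> u v * \<Theta> v lam) + I v * (\<Theta> v u * \<Theta> u lam)"
      unfolding I_def using i nz
      by (simp add: contour_integral_add contour_integral_rmul contour_integrable_rmul)
    finally show ?thesis by (simp add: mult_ac)
  qed
  let ?D = "theta_difference q c"
  \<comment> \<open>the difference of the two sides, multiplied by the denominators of the three-term relation\<close>
  define \<Psi> where "\<Psi> lam = p * ?D lam * \<Theta> v u * \<Theta> u v -
      \<theta> (lam\<^sup>2) * (K * (I u * \<Theta> u v * \<Theta> v lam + I v * \<Theta> v u * \<Theta> u lam))" for lam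
  have T0: "\<Theta> y y = 0" if "y \<noteq> 0" for y using Theta_eq_0_iff[OF that that] that by simp
  have th2: "\<theta> ((q * z)\<^sup>2) = \<theta> (z\<^sup>2) / (q * z ^ 4)" "\<theta> ((1 / z)\<^sup>2) = - \<theta> (z\<^sup>2) / z\<^sup>2" if "z \<noteq> 0" for z
  proof -
    have "(q * z)\<^sup>2 = q * (q * z\<^sup>2)" by (simp add: power2_eq_square)
    then have "\<theta> ((q * z)\<^sup>2) = \<theta> (z\<^sup>2) / z\<^sup>2 / (q * z\<^sup>2)"
      using theta_shift[of "q * z\<^sup>2"] theta_shift[of "z\<^sup>2"] that q_nz by simp
    then show "\<theta> ((q * z)\<^sup>2) = \<theta> (z\<^sup>2) / (q * z ^ 4)" by (simp add: power2_eq_square power4_eq_xxxx mult_ac)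
    show "\<theta> ((1 / z)\<^sup>2) = - \<theta> (z\<^sup>2) / z\<^sup>2"
      using theta_inverse[of "z\<^sup>2"] that by (simp add: power_divide)
  qed
  have Psi_shift: "\<Psi> (q * z) = 1 / (z ^ 6 * q) * \<Psi> z" if "z \<noteq> 0" for z
  proof -
    have "z ^ 6 = z ^ 4 * z\<^sup>2" by (simp add: power_add[symmetric])
    then have e: "1 / (q * z ^ 4) * (1 / z\<^sup>2) = 1 / (z ^ 6 * q)" by simp
    have "\<Psi> (q * z) = 1 / (z ^ 6 * q) * (p * ?D z * \<Theta> v u * \<Theta> u v) -
       (1 / (q * z ^ 4) * (1 / z\<^sup>2)) * (\<theta> (z\<^sup>2) * (K * (I u * \<Theta> u v * \<Theta> v z + I v * \<Theta> v u * \<Theta> u z)))"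
      unfolding \<Psi>_def th2(1)[OF that] Theta_shift[OF nz(1) that] Theta_shift[OF nz(2) that]
        theta_difference_shift[OF c that] by (simp add: algebra_simps add_divide_distrib)
    then show ?thesis unfolding e \<Psi>_def by (simp add: algebra_simps)
  qed
  have Psi_inv: "\<Psi> (1 / z) = - (1 / z ^ 4) * \<Psi> z" if "z \<noteq> 0" for z
  proof -
    have e: "1 / z\<^sup>2 * (1 / z\<^sup>2) = 1 / z ^ 4" by (simp add: power_add[symmetric])
    have "\<Psi> (1 / z) = - (1 / z ^ 4) * (p * ?D z * \<Theta> v u * \<Theta> u v) +
       (1 / z\<^sup>2 * (1 / z\<^sup>2)) * (\<theta> (z\<^sup>2) * (K * (I u * \<Theta> u v * \<Theta> v z + I v * \<Theta> v u * \<Theta> u z)))"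
      unfolding \<Psi>_def th2(2)[OF that] Theta_inverse[OF nz(1) that] Theta_inverse[OF nz(2) that]
        theta_difference_inverse[OF c that] by (simp add: algebra_simps add_divide_distrib)
    then show ?thesis unfolding e \<Psi>_def by (simp add: algebra_simps)
  qed
  have Psi_u: "\<Psi> u = 0" "\<Psi> v = 0"
    unfolding \<Psi>_def T0[OF nz(1)] T0[OF nz(2)] atu[symmetric] atv[symmetric]
    by (simp_all add: algebra_simps)
  have "\<Psi> lam = 0"
  proof (rule theta_quotient_zero[where f = \<Psi> and g = "\<lambda>z. \<theta> (z\<^sup>2) * \<Theta> u z"
        and m = "\<lambda>z. 1 / (z ^ 6 * q)" and ?z0.0 = v])
    show "\<theta> (v\<^sup>2) * \<Theta> u v \<noteq> 0"
      using Theta_eq_0_iff[of u v] theta_eq_0_iff[of "v\<^sup>2"] nz gen' gen2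
      by (simp add: mult.commute v_def[symmetric])
    show "\<Psi> holomorphic_on -{0}"
    proof -
      have "?D holomorphic_on -{0}"
        unfolding theta_difference_def[abs_def] using cnz by (intro holomorphic_intros) auto
      then show ?thesis unfolding \<Psi>_def[abs_def] using nz by (intro holomorphic_intros) auto
    qed
    have h1: "(\<lambda>z. \<theta> (z\<^sup>2)) holomorphic_on -{0}" "\<Theta> u holomorphic_on -{0}"
      using nz by (auto intro!: holomorphic_intros)
    then show "(\<lambda>z. \<theta> (z\<^sup>2) * \<Theta> u z) holomorphic_on -{0}" by (rule holomorphic_on_mult)
    fix z :: complex assume z: "z \<noteq> 0"
    have "z ^ 6 = z ^ 4 * z\<^sup>2" by (simp add: power_add[symmetric])
    then show "\<theta> ((q * z)\<^sup>2) * \<Theta> u (q * z) = 1 / (z ^ 6 * q) * (\<theta> (z\<^sup>2) * \<Theta> u z)"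
      unfolding th2(1)[OF z] Theta_shift[OF nz(1) z] by simp
    have qz: "\<Psi> (y * w) = 0 \<longleftrightarrow> \<Psi> y = 0" if "y \<noteq> 0" "w \<in> qpowers q" for y w
      using that Psi_shift q_nz by (intro theta_shift_quasi_zero[where m = "\<lambda>z. 1 / (z ^ 6 * q)"]) auto
    have excl: "\<Theta> u z \<noteq> 0" if "\<theta> (z\<^sup>2) = 0"
    proof
      assume "\<Theta> u z = 0"
      then consider "z * u \<in> qpowers q" | "z / u \<in> qpowers q" using Theta_eq_0_iff nz z by blast
      moreover have zz: "z\<^sup>2 \<in> qpowers q" using that theta_eq_0_iff z by simp
      ultimately show False
      proof cases
        case 1
        then have "u\<^sup>2 * z\<^sup>2 \<in> qpowers q" using qpowers_mult[OF 1 1] by (simp add: power2_eq_square mult_ac)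
        then show False using qpowers_mult_cancel[OF zz] gen' by blast
      next
        case 2
        then have "(z / u) * (z / u) \<in> qpowers q" using qpowers_mult by blast
        then have "inverse (u\<^sup>2) * z\<^sup>2 \<in> qpowers q" by (simp add: power2_eq_square field_simps)
        then show False using qpowers_mult_cancel[OF zz] qpowers_inverse_iff gen' by blast
      qed
    qed
    assume g0: "\<theta> (z\<^sup>2) * \<Theta> u z = 0"
    have "\<Psi> z = 0"
    proof (cases "\<theta> (z\<^sup>2) = 0")
      case True
      then have "?D z = 0" using theta_difference_zero[OF c z] theta_eq_0_iff z by simp
      then show ?thesis using True by (simp add: \<Psi>_def)
    next
      case False
      then have "z * u \<in> qpowers q \<or> z / u \<in> qpowers q" using g0 Theta_eq_0_iff nz z by simp
      moreover have "\<Psi> (1 / u) = 0" using Psi_inv[of u] Psi_u nz by simp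
      ultimately show ?thesis
        using qz[of "1 / u" "z * u"] qz[of u "z / u"] nz Psi_u by auto
    qed
    moreover have "deriv (\<lambda>z. \<theta> (z\<^sup>2) * \<Theta> u z) z \<noteq> 0"
      using h1 z excl g0 theta_square_simple_zero Theta_simple_zero[OF nz(1) gen'(1)]
      by (intro deriv_mult_nz) auto
    ultimately show "\<Psi> z = 0 \<and> deriv (\<lambda>z. \<theta> (z\<^sup>2) * \<Theta> u z) z \<noteq> 0" by blast
  qed (use nz lam Psi_u Psi_shift q_nz in auto)
  then have "p * ?D lam * (\<Theta> v u * \<Theta> u v) = \<theta> (lam\<^sup>2) * K * I lam * (\<Theta> v u * \<Theta> u v)"
    unfolding \<Psi>_def using I3[OF lam] by (simp add: mult_ac)
  moreover have "\<Theta> v u * \<Theta> u v \<noteq> 0"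
  proof -
    have "u / v \<notin> qpowers q" using gen'(3) qpowers_inverse_iff[of "u / v"] by (simp add: field_simps)
    then show ?thesis using Theta_eq_0_iff nz gen' by (simp add: mult.commute)
  qed
  ultimately show ?thesis by (simp add: p_def K_def I_def mult_ac)
qed

end

section \<open>Rational functions with prescribed simple poles\<close>

lemma joukowski_mult: "a \<noteq> 0 \<Longrightarrow> 2 * a * joukowski a = 1 + a\<^sup>2"
  by (simp add: joukowski_def distrib_left power2_eq_square)

lemma joukowski_eq_iff:
  assumes "a \<noteq> 0" "c \<noteq> 0" shows "joukowski a = joukowski c \<longleftrightarrow> a = c \<or> a * c = 1"
proof
  assume e: "joukowski a = joukowski c"
  have "c * (1 + a\<^sup>2) = a * (1 + c\<^sup>2)"
    using joukowski_mult[OF assms(1)] joukowski_mult[OF assms(2)] e by algebra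
  then have "(a - c) * (a * c - 1) = 0" by algebra
  then show "a = c \<or> a * c = 1" by simp
next
  assume "a = c \<or> a * c = 1"
  then have "a = c \<or> c = inverse a" using inverse_unique by blast
  then show "joukowski a = joukowski c" by (auto simp: joukowski_def add.commute)
qed

text \<open>Up to a constant, the linear polynomial with root \<open>joukowski a\<close>.\<close>

definition jlin :: "complex \<Rightarrow> complex poly" where
  "jlin a = [:1 + a\<^sup>2, - 2 * a:]"

lemma jlin_joukowski:
  assumes "z \<noteq> 0" shows "poly (jlin a) (joukowski z) = (1 - a * z) * (1 - a / z)"
proof -
  have w: "z * inverse z = 1" using assms by simp
  have "poly (jlin a) (joukowski z) = 1 + a\<^sup>2 - a * (2 * joukowski z)"
    by (simp add: jlin_def mult_ac)
  also have "2 * joukowski z = z + inverse z" by (simp add: joukowski_def)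
  also have "1 + a\<^sup>2 - a * (z + inverse z) = (1 - a * z) * (1 - a * inverse z)"
    using w by algebra
  finally show ?thesis by (simp add: divide_inverse)
qed

lemma jlin_factor: "a \<noteq> 0 \<Longrightarrow> jlin a = smult (- 2 * a) [:- joukowski a, 1:]"
  using joukowski_mult[of a] by (simp add: jlin_def)

lemma jlin_root_iff: "a \<noteq> 0 \<Longrightarrow> poly (jlin a) x = 0 \<longleftrightarrow> x = joukowski a"
  by (auto simp: jlin_factor)

lemma jlin_nz: "a \<noteq> 0 \<Longrightarrow> jlin a \<noteq> 0"
  by (simp add: jlin_def)

lemma degree_jlin: "a \<noteq> 0 \<Longrightarrow> degree (jlin a) = 1"
  by (simp add: jlin_def)

lemma order_prod_linear:
  fixes A :: "complex set"
  assumes "finite A" shows "order x (\<Prod>a\<in>A. [:- a, 1:]) \<le> 1"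
  using assms
proof (induction A rule: finite_induct)
  case (insert a A)
  have nz: "(\<Prod>a\<in>A. [:- a, 1:]) \<noteq> 0" using insert by simp
  have o: "order x ([:- a, 1:] * (\<Prod>a\<in>A. [:- a, 1:])) = order x [:- a, 1:] + order x (\<Prod>a\<in>A. [:- a, 1:])"
    using nz by (intro order_mult) (simp only: mult_eq_0_iff, simp)
  have "poly (\<Prod>b\<in>A. [:- b, 1:]) a \<noteq> 0"
    unfolding poly_prod using insert.hyps by auto
  then have "order x (\<Prod>b\<in>A. [:- b, 1:]) = 0" if "x = a"
    using that by (simp add: order_0I)
  moreover have "order x [:- a, 1:] = 0" if "x \<noteq> a"
    using that by (intro order_0I) simp
  moreover have "order a [:- a, 1:] \<le> 1" using order_degree[of "[:- a, 1:]" a] by simp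
  ultimately show ?case using insert o by (cases "x = a") auto
qed simp

lemma quot_of_Fract:
  fixes p r :: "complex poly"
  assumes "r \<noteq> 0" and "quot_of_fract (Fract p r) = (p0, r0)"
  shows "p * r0 = p0 * r" "r0 \<noteq> 0" "r0 dvd r" "coprime p0 r0"
proof -
  have "Fract p0 r0 = Fract p r" using assms(2) Fract_quot_of_fract[of "Fract p r"] by simp
  moreover show "r0 \<noteq> 0" using assms(2) snd_quot_of_fract_nonzero[of "Fract p r"] by simp
  ultimately show e: "p * r0 = p0 * r" using assms(1) by (simp add: eq_fract)
  show c: "coprime p0 r0" using assms(2) coprime_quot_of_fract[of "Fract p r"] by simp
  have "r0 dvd p0 * r" by (metis e dvd_triv_right)
  then show "r0 dvd r" using c by (simp add: coprime_dvd_mult_right_iff coprime_commute)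
qed

lemma eval_rat_Fract:
  fixes p r :: "complex poly"
  assumes "poly r x \<noteq> 0" shows "eval_rat (Fract p r) x = poly p x / poly r x"
proof -
  obtain p0 r0 where pr: "quot_of_fract (Fract p r) = (p0, r0)" by (metis surj_pair)
  have "r \<noteq> 0" using assms by auto
  note q = quot_of_Fract[OF this pr]
  have "poly r0 x \<noteq> 0" using q(3) assms by (metis dvdE mult_eq_0_iff poly_mult)
  moreover have "poly p x * poly r0 x = poly p0 x * poly r x" using q(1) by (metis poly_mult)
  ultimately show ?thesis using assms pr by (simp add: eval_rat_def field_simps)
qed

locale q_parameters = q_base +
  fixes b :: "nat \<Rightarrow> complex"
  assumes prod_b: "(\<Prod>j=1..6. b j) = q"
    and b_div: "\<And>i j. 1 \<le> i \<Longrightarrow> i < j \<Longrightarrow> j \<le> 6 \<Longrightarrow> b i / b j \<notin> qpowers q"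
    and b_mult': "\<And>i j. 1 \<le> i \<Longrightarrow> i \<le> j \<Longrightarrow> j \<le> 6 \<Longrightarrow> b i * b j \<notin> qpowers q"
begin

lemma b_nz: "j \<in> {1..6} \<Longrightarrow> b j \<noteq> 0"
  using prod_b q_nz by (metis finite_atLeastAtMost prod_zero)

lemma b_mult: "i \<in> {1..6} \<Longrightarrow> j \<in> {1..6} \<Longrightarrow> b i * b j \<notin> qpowers q"
  using b_mult'[of i j] b_mult'[of j i] by (cases "i \<le> j") (auto simp: mult.commute)

lemma b_shift_mult:
  assumes "i \<in> {1..6}" "j \<in> {1..6}" shows "b i * q powi m * (b j * q powi n) \<notin> qpowers q"
proof
  assume "b i * q powi m * (b j * q powi n) \<in> qpowers q"
  then have "b i * b j * (q powi m * q powi n) \<in> qpowers q" by (simp add: mult_ac)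
  then show False using qpowers_mult_cancel b_mult[OF assms] qpowers_mult qpowers_powi by blast
qed

lemma b_shift_inj:
  assumes "i \<in> {1..6}" "j \<in> {1..6}" "b i * q powi m = b j * q powi n"
  shows "i = j \<and> m = n"
proof -
  have nz: "q powi m \<noteq> 0" "q powi n \<noteq> 0" using q_nz by (simp_all add: power_int_eq_0_iff)
  have e: "b i / b j = q powi n / q powi m" "b j / b i = q powi m / q powi n"
    using assms nz b_nz by (auto simp: field_simps)
  have "q powi n / q powi m \<in> qpowers q" "q powi m / q powi n \<in> qpowers q"
    using q_nz by (simp_all flip: power_int_diff)
  then have "i = j" using b_div[of i j] b_div[of j i] assms e by (metis atLeastAtMost_iff nat_neq_iff)
  then show ?thesis using assms b_nz q_powi_inj by auto
qed

definition pole_factor :: "nat \<Rightarrow> nat \<Rightarrow> complex" where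
  "pole_factor j i = b j * q powi (- int i)"

lemma pole_factor_nz: "j \<in> {1..6} \<Longrightarrow> pole_factor j i \<noteq> 0"
  using b_nz q_nz by (simp add: pole_factor_def power_int_eq_0_iff)

lemma joukowski_pole_factor_inj:
  assumes "j \<in> {1..6}" "j' \<in> {1..6}" "joukowski (pole_factor j i) = joukowski (pole_factor j' i')"
  shows "j = j' \<and> i = i'"
proof -
  have "pole_factor j i * pole_factor j' i' \<noteq> 1"
    using b_shift_mult[OF assms(1,2)] qpowers_1 unfolding pole_factor_def by metis
  then have "pole_factor j i = pole_factor j' i'"
    using joukowski_eq_iff[OF pole_factor_nz[OF assms(1)] pole_factor_nz[OF assms(2)]] assms(3) by blast
  then show ?thesis using b_shift_inj[OF assms(1,2)] unfolding pole_factor_def by fastforce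
qed

definition den :: "(nat \<Rightarrow> nat) \<Rightarrow> complex poly" where
  "den n = (\<Prod>j=1..6. \<Prod>i=1..n j. jlin (pole_factor j i))"

text \<open>
  The functions whose poles at the points of the \<open>j\<close>-th family have index at most \<open>n j\<close>, written with
  a common denominator, which makes sums and numerators easy to handle. The space \<open>V\<close> is the union.
\<close>

definition Vn :: "(nat \<Rightarrow> nat) \<Rightarrow> complex poly fract set" where
  "Vn n = {Fract p (den n) | p. degree p \<le> degree (den n)}"

definition pole_set :: "(nat \<Rightarrow> nat) \<Rightarrow> complex set" where
  "pole_set n = {joukowski (pole_factor j i) | j i. j \<in> {1..6} \<and> i \<in> {1..n j}}"

lemma den_nz: "den n \<noteq> 0"
  using jlin_nz pole_factor_nz by (auto simp: den_def)

lemma den_root_iff: "poly (den n) x = 0 \<longleftrightarrow> x \<in> pole_set n"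
proof -
  have "poly (den n) x = 0 \<longleftrightarrow> (\<exists>j\<in>{1..6}. \<exists>i\<in>{1..n j}. poly (jlin (pole_factor j i)) x = 0)"
    by (simp add: den_def poly_prod)
  also have "\<dots> \<longleftrightarrow> (\<exists>j\<in>{1..6}. \<exists>i\<in>{1..n j}. x = joukowski (pole_factor j i))"
    using jlin_root_iff pole_factor_nz by (intro bex_cong refl) blast
  also have "\<dots> \<longleftrightarrow> x \<in> pole_set n" unfolding pole_set_def by blast
  finally show ?thesis .
qed

lemma degree_den: "degree (den n) = (\<Sum>j=1..6. n j)"
proof -
  have "degree (den n) = (\<Sum>j=1..6. degree (\<Prod>i=1..n j. jlin (pole_factor j i)))"
    unfolding den_def using jlin_nz pole_factor_nz by (intro degree_prod_eq_sum_degree) auto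
  also have "\<dots> = (\<Sum>j=1..6. \<Sum>i=1..n j. 1)"
    using jlin_nz pole_factor_nz degree_jlin
    by (intro sum.cong refl) (subst degree_prod_eq_sum_degree, auto)
  finally show ?thesis by simp
qed

text \<open>
  The factors of \<open>den\<close> have distinct roots: this is where the conditions on \<open>b i / b j\<close> and \<open>b i * b j\<close>
  make the poles of the space simple.
\<close>

lemma den_linear_factors:
  obtains c where "c \<noteq> 0" "den n = smult c (\<Prod>x\<in>pole_set n. [:- x, 1:])"
proof -
  define S where "S = (SIGMA j:{1..6::nat}. {1..n j})"
  have fin: "finite S" by (simp add: S_def)
  have inj: "inj_on (\<lambda>(j, i). joukowski (pole_factor j i)) S"
    using joukowski_pole_factor_inj by (fastforce simp: inj_on_def S_def)
  have im: "(\<lambda>(j, i). joukowski (pole_factor j i)) ` S = pole_set n"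
    unfolding pole_set_def S_def by (auto simp: image_iff) blast+
  have "den n = (\<Prod>(j, i)\<in>S. jlin (pole_factor j i))"
    unfolding den_def S_def by (subst prod.Sigma) auto
  also have "\<dots> = (\<Prod>(j, i)\<in>S. smult (- 2 * pole_factor j i) [:- joukowski (pole_factor j i), 1:])"
    using pole_factor_nz jlin_factor by (intro prod.cong) (auto simp: S_def)
  also have "\<dots> = smult (\<Prod>(j, i)\<in>S. - 2 * pole_factor j i) (\<Prod>(j, i)\<in>S. [:- joukowski (pole_factor j i), 1:])"
    by (simp only: case_prod_unfold prod_smult)
  also have "(\<Prod>(j, i)\<in>S. [:- joukowski (pole_factor j i), 1:]) = (\<Prod>x\<in>pole_set n. [:- x, 1:])"
    unfolding im[symmetric] prod.reindex[OF inj] by (simp add: case_prod_unfold)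
  finally have "den n = smult (\<Prod>(j, i)\<in>S. - 2 * pole_factor j i) (\<Prod>x\<in>pole_set n. [:- x, 1:])" .
  moreover have "(\<Prod>(j, i)\<in>S. - 2 * pole_factor j i) \<noteq> 0"
  proof -
    have "- 2 * pole_factor (fst s) (snd s) \<noteq> 0" if "s \<in> S" for s
      using pole_factor_nz[of "fst s" "snd s"] that by (auto simp: S_def)
    then show ?thesis by (simp add: case_prod_unfold prod_zero_iff[OF fin])
  qed
  ultimately show ?thesis using that by blast
qed

lemma finite_pole_set: "finite (pole_set n)"
  using poly_roots_finite[OF den_nz[of n]] by (simp add: den_root_iff)

lemma pole_set_allowed: "pole_set n \<subseteq> allowed_poles q b"
proof
  fix x assume "x \<in> pole_set n"
  then obtain j i where *: "j \<in> {1..6}" "i \<in> {1..n j}" "x = joukowski (pole_factor j i)"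
    by (auto simp: pole_set_def)
  then have "- int i < 0" by simp
  then show "x \<in> allowed_poles q b"
    using * pole_factor_nz unfolding allowed_poles_def pole_factor_def by blast
qed

lemma allowed_pole_in_pole_set:
  assumes "x \<in> allowed_poles q b"
  shows "\<exists>N. \<forall>M\<ge>N. x \<in> pole_set (\<lambda>_. M)"
proof -
  obtain z j m where *: "x = joukowski z" "z \<noteq> 0" "j \<in> {1..6}" "m < (0::int)"
    "z = b j * q powi m \<or> inverse z = b j * q powi m"
    using assms unfolding allowed_poles_def by blast
  have "joukowski z = joukowski (inverse z)" by (simp add: joukowski_def add.commute)
  then have "x = joukowski (b j * q powi m)" using * by metis
  also have "b j * q powi m = pole_factor j (nat (- m))" unfolding pole_factor_def using *(4) by simp
  finally have "x = joukowski (pole_factor j (nat (- m)))" .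
  then have "x \<in> pole_set (\<lambda>_. M)" if "M \<ge> nat (- m)" for M
  proof -
    have "nat (- m) \<in> {1..M}" using that *(4) by simp
    then show ?thesis using * \<open>x = joukowski (pole_factor j (nat (- m)))\<close> unfolding pole_set_def by blast
  qed
  then show ?thesis by blast
qed

lemma Vn_subset_V: "Vn n \<subseteq> V q b"
proof
  fix f assume "f \<in> Vn n"
  then obtain p where p: "f = Fract p (den n)" "degree p \<le> degree (den n)" by (auto simp: Vn_def)
  obtain p0 r0 where pr: "quot_of_fract f = (p0, r0)" by (metis surj_pair)
  note q = quot_of_Fract[OF den_nz pr[unfolded p(1)]]
  have "degree p0 \<le> degree r0"
  proof (cases "p0 = 0")
    case False
    then have "p \<noteq> 0" using q(1) den_nz by auto
    have "degree p + degree r0 = degree p0 + degree (den n)"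
      using q(1) degree_mult_eq[OF \<open>p \<noteq> 0\<close> q(2)] degree_mult_eq[OF False den_nz[of n]] by simp
    then show ?thesis using p(2) by simp
  qed simp
  moreover have "x \<in> allowed_poles q b \<and> order x r0 = 1" if "poly r0 x = 0" for x
  proof -
    have "poly (den n) x = 0" using q(3) that by (metis dvdE mult_eq_0_iff poly_mult)
    then have "x \<in> allowed_poles q b" using den_root_iff pole_set_allowed by blast
    moreover obtain c where "c \<noteq> 0" "den n = smult c (\<Prod>x\<in>pole_set n. [:- x, 1:])"
      using den_linear_factors by blast
    then have "order x (den n) \<le> 1" using order_prod_linear[OF finite_pole_set] by (simp add: order_smult)
    then have "order x r0 \<le> 1" using dvd_imp_order_le[OF den_nz q(3)] order_trans by blast
    moreover have "order x r0 \<noteq> 0" using that q(2) order_root by blast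
    ultimately show ?thesis by simp
  qed
  ultimately show "f \<in> V q b" by (simp add: V_def pr)
qed

text \<open>
  A denominator with finitely many simple allowed roots divides \<open>den\<close> for all large constant bounds.
\<close>

lemma V_subset_Vn:
  assumes "f \<in> V q b"
  shows "\<exists>N. \<forall>M\<ge>N. f \<in> Vn (\<lambda>_. M)"
proof -
  obtain p r where pr: "quot_of_fract f = (p, r)" by (metis surj_pair)
  have r: "r \<noteq> 0" "f = Fract p r"
    using pr snd_quot_of_fract_nonzero[of f] Fract_quot_of_fract[of f] by auto
  have deg: "degree p \<le> degree r" and roots: "\<And>x. poly r x = 0 \<Longrightarrow> x \<in> allowed_poles q b \<and> order x r = 1"
    using assms by (auto simp: V_def pr)
  have fin: "finite {x. poly r x = 0}" using poly_roots_finite[OF r(1)] .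
  have "\<exists>N. \<forall>x\<in>{x. poly r x = 0}. \<forall>M\<ge>N. x \<in> pole_set (\<lambda>_. M)"
  proof -
    have "\<forall>x\<in>{x. poly r x = 0}. \<exists>N. \<forall>M\<ge>N. x \<in> pole_set (\<lambda>_. M)"
      using roots allowed_pole_in_pole_set by blast
    then obtain h where h: "\<forall>x\<in>{x. poly r x = 0}. \<forall>M\<ge>h x. x \<in> pole_set (\<lambda>_. M)" by metis
    define N where "N = (\<Sum>x\<in>{x. poly r x = 0}. h x)"
    have "h x \<le> N" if "x \<in> {x. poly r x = 0}" for x
      unfolding N_def using fin that by (intro member_le_sum) auto
    then show ?thesis using h order_trans by blast
  qed
  then obtain N where N: "\<And>x M. poly r x = 0 \<Longrightarrow> M \<ge> N \<Longrightarrow> x \<in> pole_set (\<lambda>_. M)" by blast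
  have "f \<in> Vn (\<lambda>_. M)" if M: "M \<ge> N" for M
  proof -
    have "rsquarefree r" using r(1) roots order_root[of r] unfolding rsquarefree_def by (metis order_0I)
    then have "r = smult (lead_coeff r) (\<Prod>x|poly r x = 0. [:- x, 1:])"
      using complex_poly_decompose_rsquarefree by metis
    moreover obtain c where c: "c \<noteq> 0" "den (\<lambda>_. M) = smult c (\<Prod>x\<in>pole_set (\<lambda>_. M). [:- x, 1:])"
      using den_linear_factors by blast
    moreover have "(\<Prod>x|poly r x = 0. [:- x, 1:]) dvd (\<Prod>x\<in>pole_set (\<lambda>_. M). [:- x, 1:])"
      using N M by (intro prod_dvd_prod_subset finite_pole_set) auto
    ultimately have "r dvd den (\<lambda>_. M)"
      by (metis dvd_smult r(1) leading_coeff_0_iff smult_dvd)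
    then obtain s where s: "den (\<lambda>_. M) = r * s" by (elim dvdE)
    then have snz: "s \<noteq> 0" using den_nz[of "\<lambda>_. M"] by (metis mult_zero_right)
    have "f = Fract (p * s) (den (\<lambda>_. M))"
      using r snz unfolding s by (simp add: eq_fract)
    moreover have "degree (p * s) \<le> degree (den (\<lambda>_. M))"
      using degree_mult_le[of p s] degree_mult_eq[OF r(1) snz] deg unfolding s by simp
    ultimately show ?thesis unfolding Vn_def by blast
  qed
  then show ?thesis by blast
qed

section \<open>Separating contours for the integrand\<close>

text \<open>
  A contour straddling these parameters encircles the poles \<open>b j * q powi - i\<close> with \<open>i \<le> M\<close> of the
  rational function as well as those of the weight.
\<close>

definition params :: "nat \<Rightarrow> complex set" where
  "params M = (\<lambda>j. pole_factor j M) ` {1..6}"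

lemma params_factors_nz:
  assumes z: "z \<in> pole_free (params M) (params M)" and j: "j \<in> {1..6}"
  shows "z \<noteq> 0" "PP (b j) z \<noteq> 0" "\<And>i. i \<in> {1..M} \<Longrightarrow> poly (jlin (pole_factor j i)) (joukowski z) \<noteq> 0"
    "\<And>k. k \<ge> - int M \<Longrightarrow> PP (b j * q powi k) z \<noteq> 0"
proof -
  show z0: "z \<noteq> 0" using z by (simp add: pole_free_def)
  let ?t = "pole_factor j M"
  have nz: "P (?t * z) \<noteq> 0" "P (?t / z) \<noteq> 0" using z j by (auto simp: pole_free_def params_def)
  have t: "?t * q ^ n = b j * q powi (int n - int M)" for n
    using q_nz by (simp add: pole_factor_def power_int_diff power_int_minus field_simps)
  have tz: "1 - b j * q powi (int n - int M) * z \<noteq> 0" "1 - b j * q powi (int n - int M) / z \<noteq> 0"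
    "P (b j * q powi (int n - int M) * z) \<noteq> 0" "P (b j * q powi (int n - int M) / z) \<noteq> 0" for n
  proof -
    have e: "?t * z * q ^ n = b j * q powi (int n - int M) * z" "?t / z * q ^ n = b j * q powi (int n - int M) / z"
      using t[of n] by (simp_all add: mult_ac)
    have "P (?t * z * q ^ n) \<noteq> 0" "P (?t / z * q ^ n) \<noteq> 0"
      using nz P_shift_power[of "?t * z" n] P_shift_power[of "?t / z" n] by auto
    then show "P (b j * q powi (int n - int M) * z) \<noteq> 0" "P (b j * q powi (int n - int M) / z) \<noteq> 0"
      unfolding e by blast+
    then show "1 - b j * q powi (int n - int M) * z \<noteq> 0" "1 - b j * q powi (int n - int M) / z \<noteq> 0"
      using P_shift[of "b j * q powi (int n - int M) * z"] P_shift[of "b j * q powi (int n - int M) / z"]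
      by auto
  qed
  show PPk: "PP (b j * q powi k) z \<noteq> 0" if "k \<ge> - int M" for k
    using tz(3,4)[of "nat (k + int M)"] that by (simp add: PP_def)
  show "PP (b j) z \<noteq> 0" using PPk[of 0] by simp
  show "poly (jlin (pole_factor j i)) (joukowski z) \<noteq> 0" if "i \<in> {1..M}" for i
    using tz(1,2)[of "M - i"] that by (simp add: jlin_joukowski[OF z0] pole_factor_def)
qed

lemma den_nz_on:
  assumes "z \<in> pole_free (params M) (params M)" "\<forall>j\<in>{1..6}. n j \<le> M"
  shows "poly (den n) (joukowski z) \<noteq> 0"
proof -
  have "poly (jlin (pole_factor j i)) (joukowski z) \<noteq> 0" if "j \<in> {1..6}" "i \<in> {1..n j}" for j i
    using params_factors_nz(3)[OF assms(1) that(1), of i] assms(2) that by force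
  then show ?thesis by (auto simp: den_def poly_prod)
qed

lemma not_pole_free_params:
  assumes "z \<notin> pole_free (params M) (params M)"
  shows "z = 0 \<or> (\<exists>j\<in>{1..6}. \<exists>n. z = inverse (b j) * q powi (int M - int n) \<and> z = 1 / (pole_factor j M * q ^ n)) \<or>
    (\<exists>j\<in>{1..6}. \<exists>n. z = b j * q powi (int n - int M) \<and> z = pole_factor j M * q ^ n)"
proof -
  have "pole_factor j M * q ^ n = b j * q powi (int n - int M)" for j n
    using q_nz by (simp add: pole_factor_def power_int_diff power_int_minus field_simps)
  moreover have "1 / (b j * q powi (int n - int M)) = inverse (b j) * q powi (int M - int n)" for j n
    using q_nz by (simp add: power_int_diff field_simps)
  ultimately show ?thesis using assms unfolding not_pole_free_iff params_def by auto
qed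

lemma params_straddling_exists: "\<exists>\<gamma>. straddles (params M) \<gamma>"
proof (rule straddling_contour_exists)
  fix s t n assume st: "s \<in> params M" "t \<in> params M"
  then have "s * t \<notin> qpowers q" using b_shift_mult by (auto simp: params_def pole_factor_def)
  moreover have "q ^ n \<in> qpowers q" using qpowers_powi[of "int n"] by simp
  ultimately show "s * t * q ^ n \<noteq> 1" using qpowers_mult_cancel qpowers_1 by metis
qed (simp add: params_def)

lemma integrand_meromorphic:
  assumes "lam \<noteq> 0" shows "integrand q b lam f meromorphic_on -{0}"
proof -
  have "joukowski analytic_on -{0}" unfolding joukowski_def[abs_def] by (auto intro!: analytic_intros)
  moreover have "poly p analytic_on UNIV" for p :: "complex poly"
    by (auto simp: analytic_on_open holomorphic_on_open intro!: exI poly_DERIV)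
  ultimately have "(\<lambda>z. poly p (joukowski z)) analytic_on -{0}" for p :: "complex poly"
    by (intro analytic_on_compose[unfolded o_def, of joukowski "-{0}" "poly p"])
      (auto intro: analytic_on_subset[of _ UNIV])
  then show ?thesis
    unfolding integrand_def[abs_def] eval_rat_def case_prod_unfold
    using assms by (intro meromorphic_intros analytic_on_imp_meromorphic_on analytic_intros) auto
qed

lemma integrand_analytic:
  assumes "lam \<noteq> 0" "f = Fract p (den n)" "\<forall>j\<in>{1..6}. n j \<le> M"
  shows "integrand q b lam f analytic_on pole_free (params M) (params M)"
proof -
  let ?D = "pole_free (params M) (params M)"
  have oD: "open ?D" by (intro pole_free_open_connected) (auto simp: params_def)
  have D0: "z \<noteq> 0" if "z \<in> ?D" for z using that by (simp add: pole_free_def)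
  have "joukowski holomorphic_on ?D" unfolding joukowski_def[abs_def] using D0 by (intro holomorphic_intros) auto
  then have J: "(\<lambda>z. poly p (joukowski z)) holomorphic_on ?D" for p :: "complex poly"
    using holomorphic_on_compose[of joukowski ?D "poly p", unfolded o_def] by (auto intro: holomorphic_intros)
  have "(\<lambda>z. poly p (joukowski z) / poly (den n) (joukowski z) *
      (P (z\<^sup>2) * P (z powi (-2)) * \<theta> (lam * z) * \<theta> (lam / z)) /
      (\<Prod>j=1..6. P (b j * z) * P (b j / z)) / (2 * of_real pi * \<i> * z)) holomorphic_on ?D"
    using D0 assms(1) den_nz_on[OF _ assms(3)] params_factors_nz(2)
    by (intro holomorphic_intros J) (auto simp: PP_def)
  then have "integrand q b lam f holomorphic_on ?D"
    by (rule holomorphic_transform)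
       (use den_nz_on[OF _ assms(3)] eval_rat_Fract in \<open>simp add: integrand_def assms(2)\<close>)
  then show ?thesis using oD by (simp add: analytic_on_open)
qed

lemma integrand_pole:
  assumes "lam \<noteq> 0" "f = Fract p (den n)" "\<forall>j\<in>{1..6}. n j \<le> M" "is_pole (integrand q b lam f) z"
  shows "z \<notin> pole_free (params M) (params M)"
proof
  assume z: "z \<in> pole_free (params M) (params M)"
  have "integrand q b lam f analytic_on {z}"
    by (rule analytic_on_subset[OF integrand_analytic[OF assms(1-3)]]) (use z in simp)
  then show False using analytic_at_imp_no_pole assms(4) by blast
qed

text \<open>
  The integrand has poles only in the sequences that the contour straddles, and the parameter
  conditions keep the inner sequences apart from the outer ones.
\<close>

lemma straddling_is_separating:
  assumes "lam \<noteq> 0" "f = Fract p (den n)" "\<forall>j\<in>{1..6}. n j \<le> M" and g: "straddles (params M) \<gamma>"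
  shows "separating_contour q b (integrand q b lam f) \<gamma>"
  unfolding separating_contour_def
proof (intro conjI ballI)
  note str = g[unfolded straddles_def]
  show "valid_path \<gamma>" "pathfinish \<gamma> = pathstart \<gamma>" "0 \<notin> path_image \<gamma>" "winding_number \<gamma> 0 = 1"
    using str by auto
  fix j :: nat and u assume j: "j \<in> {1..6}" and u: "u \<in> qpowers q"
  obtain k where k: "u = q powi k" using u by (auto simp: qpowers_iff)
  have nz: "b j * u \<noteq> 0" "inverse (b j) * u \<noteq> 0" using b_nz[OF j] qpowers_nz[OF u] by auto
  have clash: "b j * u \<noteq> inverse (b i) * q powi m" "inverse (b j) * u \<noteq> b i * q powi m"
    if "i \<in> {1..6}" for i :: nat and m :: int
  proof -
    have "b j * q powi k * (b i * q powi (- m)) \<noteq> 1" "b j * q powi (- k) * (b i * q powi m) \<noteq> 1"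
      using b_shift_mult[OF j that] qpowers_1 by metis+
    then show "b j * u \<noteq> inverse (b i) * q powi m" "inverse (b j) * u \<noteq> b i * q powi m"
      using b_nz[OF j] b_nz[OF that] q_nz unfolding k
      by (auto simp: power_int_minus power_int_eq_0_iff field_simps)
  qed
  have inT: "pole_factor i M \<in> params M" "pole_factor i M \<noteq> 0" if "i \<in> {1..6}" for i
    using that pole_factor_nz by (auto simp: params_def)
  show "is_pole (integrand q b lam f) (b j * u) \<longrightarrow>
      b j * u \<notin> path_image \<gamma> \<and> winding_number \<gamma> (b j * u) = 1"
  proof
    assume "is_pole (integrand q b lam f) (b j * u)"
    then obtain i n where "i \<in> {1..6}" "b j * u = pole_factor i M * q ^ n"
      using not_pole_free_params[OF integrand_pole[OF assms(1-3)]] nz clash by blast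
    then show "b j * u \<notin> path_image \<gamma> \<and> winding_number \<gamma> (b j * u) = 1"
      using str inT by simp
  qed
  show "is_pole (integrand q b lam f) (inverse (b j) * u) \<longrightarrow>
      inverse (b j) * u \<notin> path_image \<gamma> \<and> winding_number \<gamma> (inverse (b j) * u) = 0"
  proof
    assume "is_pole (integrand q b lam f) (inverse (b j) * u)"
    then obtain i n where "i \<in> {1..6}" "inverse (b j) * u = 1 / (pole_factor i M * q ^ n)"
      using not_pole_free_params[OF integrand_pole[OF assms(1-3)]] nz clash by blast
    then show "inverse (b j) * u \<notin> path_image \<gamma> \<and> winding_number \<gamma> (inverse (b j) * u) = 0"
      using str inT by simp
  qed
qed

text \<open>
  A separating contour may pass through removable singularities, where the integrand need not have
  the limit as its value. They are removed first, at the price of countably many points.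
\<close>

lemma separating_contour_integral_unique:
  assumes "lam \<noteq> 0" "f = Fract p (den n)"
    and g1: "separating_contour q b (integrand q b lam f) g1"
    and g2: "separating_contour q b (integrand q b lam f) g2"
  shows "contour_integral g1 (integrand q b lam f) = contour_integral g2 (integrand q b lam f)"
proof -
  define G where "G = integrand q b lam f"
  define M where "M = (\<Sum>j=1..6. n j)"
  have nM: "\<forall>j\<in>{1..6}. n j \<le> M" unfolding M_def by (auto intro: member_le_sum)
  let ?E = "pole_free (params M) (params M)"
  have mero: "G meromorphic_on -{0}" unfolding G_def using integrand_meromorphic[OF assms(1)] .
  have an: "G analytic_on ?E" unfolding G_def by (rule integrand_analytic[OF assms(1,2) nM])
  define S where "S = {z. is_pole G z}"
  define D where "D = -{0} - S"
  have oD: "open D" unfolding D_def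
  proof (rule open_diff_sparse_pts)
    show "S sparse_in -{0}"
      using meromorphic_on_imp_not_pole_cosparse[OF mero] by (simp add: eventually_cosparse S_def)
  qed auto
  have cE: "countable (- ?E)" by (intro pole_free_open_connected) (auto simp: params_def)
  have S_E: "S \<subseteq> - ?E" unfolding S_def G_def using integrand_pole[OF assms(1,2) nM] by blast
  have "countable (- D)"
    using countable_subset[OF S_E cE] unfolding D_def by (simp add: Diff_eq)
  then have "connected (UNIV - (- D))" by (intro connected_open_diff_countable) auto
  then have cD: "connected D" by (simp add: Diff_eq)
  define H where "H = remove_sings G"
  have "H analytic_on {z}" if zD: "z \<in> D" for z
  proof -
    have iso: "isolated_singularity_at G z" and ne: "not_essential G z"
      using mero zD by (auto simp: D_def intro!: meromorphic_on_isolated_singularity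
          meromorphic_on_not_essential elim: meromorphic_on_subset)
    obtain c where "G \<midarrow>z\<rightarrow> c" using ne zD by (auto simp: not_essential_def D_def S_def)
    then show ?thesis unfolding H_def using remove_sings_analytic_at[OF iso] by blast
  qed
  then have holH: "H holomorphic_on D"
    by (intro analytic_imp_holomorphic) (subst analytic_on_analytic_at, auto)
  have pole_form: "\<exists>j\<in>{1..6}. \<exists>u\<in>qpowers q. z = b j * u \<or> z = inverse (b j) * u" if "z \<in> S" "z \<noteq> 0" for z
    using not_pole_free_params[of z M] S_E that by blast
  have sep: "path_image g \<subseteq> D \<and> (\<forall>j\<in>{1..6}. \<forall>u\<in>qpowers q.
      (b j * u \<in> S \<longrightarrow> winding_number g (b j * u) = 1) \<and>
      (inverse (b j) * u \<in> S \<longrightarrow> winding_number g (inverse (b j) * u) = 0))"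
    if "separating_contour q b G g" for g
    using that pole_form unfolding separating_contour_def D_def S_def by blast
  have GH: "contour_integral g G = contour_integral g H" if "separating_contour q b G g" for g
  proof (rule contour_integral_spike_countable[OF cE])
    show "valid_path g" using that by (simp add: separating_contour_def)
    fix z assume "z \<in> path_image g - - ?E"
    then have "G analytic_on {z}" using an by (auto elim: analytic_on_subset)
    then show "G z = H z" by (simp add: H_def)
  qed
  have "contour_integral g1 H = contour_integral g2 H"
  proof (rule contour_integral_eq_of_same_winding[OF oD cD holH])
    fix w assume "w \<notin> D"
    then consider "w = 0" | "w \<in> S" "w \<noteq> 0" by (auto simp: D_def)
    then show "winding_number g1 w = winding_number g2 w"
    proof cases
      case 1
      then show ?thesis using g1 g2 by (simp add: separating_contour_def)
    next
      case 2
      then show ?thesis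
        using pole_form[OF 2] sep[OF g1[folded G_def]] sep[OF g2[folded G_def]] by metis
    qed
  qed (use g1 g2 sep[OF g1[folded G_def]] sep[OF g2[folded G_def]] in \<open>auto simp: separating_contour_def\<close>)
  then show ?thesis using GH g1 g2 unfolding G_def by metis
qed

end

section \<open>Shifting the parameters by powers of the base\<close>

context q_base begin

text \<open>
  The correction factor is what the quasi-periodicity of \<open>\<theta>\<close> accumulates over \<open>k\<close> steps.
\<close>

lemma theta_powi:
  assumes x: "x \<noteq> 0"
  shows "\<theta> (x * q powi k) * (q powi (k * (k - 1) div 2) * (- x) powi k) = \<theta> x"
proof -
  define E where "E k = \<theta> (x * q powi k) * (q powi (k * (k - 1) div 2) * (- x) powi k)" for k
  have step: "E (k + 1) = E k" for k
  proof -
    have "(k + 1) * (k + 1 - 1) = k * (k - 1) + 2 * k" by (simp add: algebra_simps)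
    then have "(k + 1) * (k + 1 - 1) div 2 = k * (k - 1) div 2 + k" by simp
    then have 1: "q powi ((k + 1) * (k + 1 - 1) div 2) = q powi (k * (k - 1) div 2) * q powi k"
      by (simp only: power_int_add[OF disjI1, OF q_nz])
    have 2: "(- x) powi (k + 1) = (- x) powi k * (- x)" using x by (simp add: power_int_add)
    have nz: "x * q powi k \<noteq> 0" using x q_nz by (simp add: power_int_eq_0_iff)
    have eq: "x * q powi (k + 1) = q * (x * q powi k)" using q_nz by (simp add: power_int_add)
    have 3: "\<theta> (x * q powi (k + 1)) = - \<theta> (x * q powi k) / (x * q powi k)"
      unfolding eq using theta_shift[OF nz] .
    show ?thesis unfolding E_def 1 2 3 using nz by (simp add: mult_ac)
  qed
  have "E k = E 0"
  proof (induction k rule: int_induct[of _ 0])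
    case (step2 i) then show ?case using step[of "i - 1"] by simp
  qed (use step in auto)
  then show ?thesis by (simp add: E_def)
qed

lemma P_qpoch:
  assumes nz: "P (a * q powi k) \<noteq> 0"
  shows "P a = qpoch q a k * P (a * q powi k)"
proof (cases "k \<ge> 0")
  case True
  then have "q powi k = q ^ nat k" by (simp add: power_int_def)
  then show ?thesis using True P_shift_power[of a "nat k"] by (simp add: qpoch_def)
next
  case False
  define n where "n = nat (- k)"
  define X where "X = (\<Prod>i=1..n. 1 - a * q powi (- int i))"
  have k: "k = - int n" using False by (simp add: n_def)
  have "(\<Prod>i<n. 1 - a * q powi k * q ^ i) = X" unfolding X_def
  proof (rule prod.reindex_bij_witness[where i = "\<lambda>i. n - i" and j = "\<lambda>i. n - i"])
    fix i assume "i \<in> {..<n}"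
    then have "q powi (- int (n - i)) = q powi (k + int i)" by (simp add: k)
    also have "\<dots> = q powi k * q ^ i" using q_nz by (simp add: power_int_add)
    finally show "1 - a * q powi (- int (n - i)) = 1 - a * q powi k * q ^ i" by (simp add: mult_ac)
  qed auto
  then have e: "P (a * q powi k) = X * P (a * q powi k * q ^ n)"
    using P_shift_power[of "a * q powi k" n] by simp
  have "q powi k * q ^ n = 1" using q_nz by (simp add: k power_int_minus)
  then have aa: "a * q powi k * q ^ n = a" by (simp add: mult.assoc)
  have e: "P (a * q powi k) = X * P a" using e unfolding aa .
  then have "X \<noteq> 0" using nz by auto
  moreover have "qpoch q a k = inverse X" using False by (simp add: qpoch_def X_def n_def)
  ultimately show ?thesis using e by simp
qed

lemma prod_powi_const:
  "finite A \<Longrightarrow> x \<noteq> 0 \<Longrightarrow> (\<Prod>j\<in>A. x powi k j) = (x :: complex) powi (\<Sum>j\<in>A. k j)"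
  by (induction A rule: finite_induct) (auto simp: power_int_add)

end

context q_parameters begin

abbreviation D :: "complex \<Rightarrow> complex" where "D \<equiv> theta_difference q b"

definition shifted :: "(nat \<Rightarrow> int) \<Rightarrow> nat \<Rightarrow> complex" where
  "shifted k j = b j * q powi k j"

text \<open>
  The denominator of the value of the functional. It appears here as the multiplier of the theta
  difference when the parameters are shifted.
\<close>

definition shift_multiplier :: "(nat \<Rightarrow> int) \<Rightarrow> complex" where
  "shift_multiplier k = (\<Prod>j=1..6. q powi (k j * (k j - 1) div 2) * b j powi k j)"

lemma shift_multiplier_nz: "shift_multiplier k \<noteq> 0"
  using b_nz q_nz by (auto simp: shift_multiplier_def power_int_eq_0_iff)

lemma theta_difference_shifted:
  assumes k: "(\<Sum>j=1..6. k j) = 0" and lam: "lam \<noteq> 0"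
  shows "theta_difference q (shifted k) lam * shift_multiplier k = D lam"
proof -
  have one: "(\<Prod>j=1..6. x powi k j) = 1" "(\<Prod>j=1..6. x powi (- k j)) = 1" if "x \<noteq> 0" for x :: complex
    using prod_powi_const[of "{1..6}" x k] prod_powi_const[of "{1..6}" x "\<lambda>j. - k j"] that k
    by (simp_all add: sum_negf)
  have "(\<Prod>j=1..6. \<theta> (lam * shifted k j)) * shift_multiplier k =
      (\<Prod>j=1..6. \<theta> (lam * shifted k j)) * shift_multiplier k * (\<Prod>j=1..6. (- lam) powi k j)"
    using one(1)[of "- lam"] lam by simp
  also have "\<dots> = (\<Prod>j=1..6. \<theta> (lam * shifted k j) *
      (q powi (k j * (k j - 1) div 2) * b j powi k j) * (- lam) powi k j)"
    unfolding shift_multiplier_def by (simp only: prod.distrib)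
  also have "\<dots> = (\<Prod>j=1..6. \<theta> (lam * b j))"
  proof (intro prod.cong refl)
    fix j assume "j \<in> {1..6::nat}"
    then have "lam * b j \<noteq> 0" using b_nz lam by simp
    from theta_powi[OF this, of "k j"]
    show "\<theta> (lam * shifted k j) * (q powi (k j * (k j - 1) div 2) * b j powi k j) * (- lam) powi k j
        = \<theta> (lam * b j)"
      using power_int_mult_distrib[of "- lam" "b j" "k j"] by (simp add: shifted_def mult_ac)
  qed
  finally have 1: "(\<Prod>j=1..6. \<theta> (lam * shifted k j)) * shift_multiplier k = (\<Prod>j=1..6. \<theta> (lam * b j))" .
  have "(\<Prod>j=1..6. \<theta> (lam / shifted k j)) * shift_multiplier k =
      (\<Prod>j=1..6. \<theta> (lam / shifted k j)) * shift_multiplier k * (\<Prod>j=1..6. (- lam) powi (- k j)) * (\<Prod>j=1..6. q powi k j)"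
    using one(2)[of "- lam"] one(1)[OF q_nz] lam by simp
  also have "\<dots> = (\<Prod>j=1..6. \<theta> (lam / shifted k j) *
      (q powi (k j * (k j - 1) div 2) * b j powi k j) * (- lam) powi (- k j) * q powi k j)"
    unfolding shift_multiplier_def by (simp only: prod.distrib)
  also have "\<dots> = (\<Prod>j=1..6. \<theta> (lam / b j))"
  proof (intro prod.cong refl)
    fix j assume j: "j \<in> {1..6::nat}"
    then have nz: "lam / b j \<noteq> 0" using b_nz lam by simp
    have "- k j * (- k j - 1) = k j * (k j - 1) + 2 * k j" by (simp add: algebra_simps)
    then have "- k j * (- k j - 1) div 2 = k j * (k j - 1) div 2 + k j" by simp
    then have qq: "q powi (- k j * (- k j - 1) div 2) = q powi (k j * (k j - 1) div 2) * q powi k j"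
      by (simp only: power_int_add[OF disjI1, OF q_nz])
    have "(- (lam / b j)) powi (- k j) = (- lam * inverse (b j)) powi (- k j)"
      by (simp add: divide_inverse)
    also have "\<dots> = (- lam) powi (- k j) * inverse (b j) powi (- k j)"
      by (rule power_int_mult_distrib)
    also have "inverse (b j) powi (- k j) = b j powi k j"
      by (simp add: power_int_minus power_int_inverse)
    finally have ll: "(- (lam / b j)) powi (- k j) = (- lam) powi (- k j) * b j powi k j" .
    have ss: "lam / b j * q powi (- k j) = lam / shifted k j"
      by (simp add: shifted_def power_int_minus divide_inverse mult_ac)
    show "\<theta> (lam / shifted k j) * (q powi (k j * (k j - 1) div 2) * b j powi k j) *
        (- lam) powi (- k j) * q powi k j = \<theta> (lam / b j)"
      using theta_powi[OF nz, of "- k j"] unfolding qq ll ss by (simp only: mult_ac)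
  qed
  finally have 2: "(\<Prod>j=1..6. \<theta> (lam / shifted k j)) * shift_multiplier k = (\<Prod>j=1..6. \<theta> (lam / b j))" .
  show ?thesis unfolding theta_difference_def 1[symmetric] 2[symmetric] by (simp add: algebra_simps)
qed

definition qpoch_pairs :: "(nat \<Rightarrow> int) \<Rightarrow> complex" where
  "qpoch_pairs k = (\<Prod>i=1..6. \<Prod>j\<in>{i<..6}. qpoch q (b i * b j) (k i + k j))"

lemma pairs_shifted: "pairs b = qpoch_pairs k * pairs (shifted k)"
proof -
  have "P (b i * b j) = qpoch q (b i * b j) (k i + k j) * P (shifted k i * shifted k j)"
    if "i \<in> {1..6}" "j \<in> {i<..6}" for i j
  proof -
    have ij: "i \<in> {1..6}" "j \<in> {1..6}" using that by auto
    have e: "b i * b j * q powi (k i + k j) = shifted k i * shifted k j"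
      using q_nz by (simp add: shifted_def power_int_add mult_ac)
    have "shifted k i * shifted k j \<notin> qpowers q" unfolding shifted_def by (rule b_shift_mult[OF ij])
    then have "P (b i * b j * q powi (k i + k j)) \<noteq> 0" unfolding e using P_eq_0_imp_qpowers by blast
    from P_qpoch[OF this] show ?thesis unfolding e .
  qed
  then show ?thesis unfolding pairs_def qpoch_pairs_def by (simp add: prod.distrib[symmetric])
qed

section \<open>The products in the statement span the space\<close>

definition num :: "(nat \<Rightarrow> int) \<Rightarrow> complex poly" where
  "num k = (\<Prod>j=1..6. \<Prod>i<nat (k j). jlin (b j * q ^ i))"

definition poch_fract :: "(nat \<Rightarrow> int) \<Rightarrow> complex poly fract" where
  "poch_fract k = Fract (num k) (den (\<lambda>j. nat (- k j)))"

lemma degree_num: "degree (num k) = (\<Sum>j=1..6. nat (k j))"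
proof -
  have nz: "jlin (b j * q ^ i) \<noteq> 0" "degree (jlin (b j * q ^ i)) = 1" if "j \<in> {1..6}" for i j
    using jlin_nz degree_jlin b_nz[OF that] q_nz by simp_all
  have "degree (num k) = (\<Sum>j=1..6. degree (\<Prod>i<nat (k j). jlin (b j * q ^ i)))"
    unfolding num_def using nz(1) by (intro degree_prod_eq_sum_degree) simp
  also have "\<dots> = (\<Sum>j=1..6. \<Sum>i<nat (k j). 1)"
    using nz by (intro sum.cong refl) (simp add: degree_prod_eq_sum_degree)
  finally show ?thesis by simp
qed

lemma degree_num_den:
  assumes "(\<Sum>j=1..6. k j) = 0" shows "degree (num k) = degree (den (\<lambda>j. nat (- k j)))"
proof -
  have "int (\<Sum>j=1..6. nat (k j)) - int (\<Sum>j=1..6. nat (- k j)) = (\<Sum>j=1..6. int (nat (k j)) - int (nat (- k j)))"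
    by (simp only: of_nat_sum sum_subtractf)
  also have "\<dots> = (\<Sum>j=1..6. k j)" by (intro sum.cong) auto
  finally have "(\<Sum>j=1..6. nat (k j)) = (\<Sum>j=1..6. nat (- k j))" using assms by linarith
  then show ?thesis by (simp add: degree_num degree_den)
qed

lemma poch_fract_in_Vn: "(\<Sum>j=1..6. k j) = 0 \<Longrightarrow> poch_fract k \<in> Vn (\<lambda>j. nat (- k j))"
  using degree_num_den unfolding Vn_def poch_fract_def by fastforce

lemma eval_poch_fract:
  assumes z: "z \<noteq> 0" and nz: "poly (den (\<lambda>j. nat (- k j))) (joukowski z) \<noteq> 0"
  shows "eval_rat (poch_fract k) (joukowski z) = (\<Prod>j=1..6. qpoch q (b j * z) (k j) * qpoch q (b j / z) (k j))"
proof -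
  have q2: "qpoch q (b j * z) (k j) * qpoch q (b j / z) (k j) =
     (\<Prod>i<nat (k j). poly (jlin (b j * q ^ i)) (joukowski z)) /
     (\<Prod>i=1..nat (- k j). poly (jlin (pole_factor j i)) (joukowski z))" for j
  proof (cases "k j \<ge> 0")
    case True
    then show ?thesis unfolding jlin_joukowski[OF z]
      by (simp add: qpoch_def prod.distrib mult_ac)
  next
    case False
    then show ?thesis unfolding jlin_joukowski[OF z]
      by (simp add: qpoch_def prod.distrib pole_factor_def mult_ac divide_inverse)
  qed
  have "eval_rat (poch_fract k) (joukowski z) = poly (num k) (joukowski z) / poly (den (\<lambda>j. nat (- k j))) (joukowski z)"
    unfolding poch_fract_def by (rule eval_rat_Fract[OF nz])
  also have "\<dots> = (\<Prod>j=1..6. qpoch q (b j * z) (k j) * qpoch q (b j / z) (k j))"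
    unfolding q2 by (simp only: num_def den_def poly_prod prod_dividef)
  finally show ?thesis .
qed

lemma shifted_sum_prod: "(\<Sum>j=1..6. k j) = 0 \<Longrightarrow> (\<Prod>j=1..6. shifted k j) = q"
  using prod_powi_const[of "{1..6}" q k] prod_b q_nz by (simp add: shifted_def prod.distrib)

lemma straddles_shifted:
  assumes g: "straddles (params M) \<gamma>" and k: "\<forall>j\<in>{1..6}. - k j \<le> int M"
  shows "straddles (shifted k ` {1..6}) \<gamma>"
proof -
  have "\<exists>t\<in>params M. t \<noteq> 0 \<and> (\<forall>n. \<exists>m. shifted k j * q ^ n = t * q ^ m)" if j: "j \<in> {1..6}" for j
  proof (intro bexI[of _ "pole_factor j M"] conjI allI)
    fix n
    define m where "m = nat (int M + k j) + n"
    have "- k j \<le> int M" using k j by blast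
    then have "int m = int M + k j + int n" by (simp add: m_def)
    then have "pole_factor j M * q ^ m = b j * (q powi (- int M) * q powi (int M + k j + int n))"
      by (simp add: pole_factor_def flip: power_int_of_nat)
    also have "q powi (- int M) * q powi (int M + k j + int n) = q powi (- int M + (int M + k j + int n))"
      by (rule power_int_add[symmetric]) (use q_nz in simp)
    also have "- int M + (int M + k j + int n) = k j + int n" by simp
    finally show "\<exists>m. shifted k j * q ^ n = pole_factor j M * q ^ m"
      using q_nz by (intro exI[of _ m]) (simp add: shifted_def power_int_add mult_ac)
  qed (use j pole_factor_nz in \<open>auto simp: params_def\<close>)
  then have shift: "\<exists>t0\<in>params M. t0 \<noteq> 0 \<and> (\<exists>m. t * q ^ n = t0 * q ^ m)"
    if "t \<in> shifted k ` {1..6}" for t n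
    using that by blast
  note str = g[unfolded straddles_def]
  show ?thesis unfolding straddles_def
  proof (intro conjI ballI allI)
    fix t n assume "t \<in> shifted k ` {1..6}"
    then obtain t0 m where t: "t0 \<in> params M" "t0 \<noteq> 0" "t * q ^ n = t0 * q ^ m" using shift by blast
    show "t * q ^ n \<notin> path_image \<gamma>" "winding_number \<gamma> (t * q ^ n) = 1"
      "t \<noteq> 0 \<longrightarrow> 1 / (t * q ^ n) \<notin> path_image \<gamma> \<and> winding_number \<gamma> (1 / (t * q ^ n)) = 0"
      unfolding t(3) using str t(1,2) by blast+
  qed (use str in blast)+
qed

text \<open>
  Multiplying the weight by \<open>(b z, b / z)\<^sub>k\<close> replaces \<open>b\<close> by \<open>b q\<^sup>k\<close>.
\<close>

lemma integrand_poch_fract: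
  assumes z: "z \<in> pole_free (params M) (params M)" and k: "\<forall>j\<in>{1..6}. - k j \<le> int M"
  shows "integrand q b lam (poch_fract k) z = 1 / (2 * of_real pi * \<i>) * six_integrand (shifted k) lam z"
proof -
  have z0: "z \<noteq> 0" using z by (simp add: pole_free_def)
  have dn: "poly (den (\<lambda>j. nat (- k j))) (joukowski z) \<noteq> 0" 
    using k by (intro den_nz_on[OF z]) (auto simp: nat_le_iff)
  define X where "X = (\<Prod>j=1..6. qpoch q (b j * z) (k j) * qpoch q (b j / z) (k j))"
  define C where "C = (\<Prod>j=1..6. PP (shifted k j) z)"
  have "PP (b j) z = qpoch q (b j * z) (k j) * qpoch q (b j / z) (k j) * PP (shifted k j) z"
    if j: "j \<in> {1..6}" for j
  proof -
    have e: "shifted k j * z = b j * z * q powi k j" "shifted k j / z = b j / z * q powi k j"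
      by (simp_all add: shifted_def)
    have "- k j \<le> int M" using k j by blast
    then have "PP (shifted k j) z \<noteq> 0"
      unfolding shifted_def by (intro params_factors_nz(4)[OF z j]) simp
    then have "P (b j * z * q powi k j) * P (b j / z * q powi k j) \<noteq> 0"
      unfolding PP_def e .
    then have nz: "P (b j * z * q powi k j) \<noteq> 0" "P (b j / z * q powi k j) \<noteq> 0" by auto
    have "PP (b j) z = (qpoch q (b j * z) (k j) * P (b j * z * q powi k j)) *
        (qpoch q (b j / z) (k j) * P (b j / z * q powi k j))"
      unfolding PP_def P_qpoch[OF nz(1), symmetric] P_qpoch[OF nz(2), symmetric] ..
    then show ?thesis unfolding PP_def e by (simp only: mult_ac)
  qed
  then have XC: "(\<Prod>j=1..6. PP (b j) z) = X * C" by (simp add: X_def C_def prod.distrib)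
  moreover have "(\<Prod>j=1..6. PP (b j) z) \<noteq> 0" using params_factors_nz(2)[OF z] by simp
  ultimately have "X \<noteq> 0" "C \<noteq> 0" by auto
  have "integrand q b lam (poch_fract k) z =
      X * (P (z\<^sup>2) * P (1 / z\<^sup>2) * \<theta> (lam * z) * \<theta> (lam / z)) / (X * C) / (2 * of_real pi * \<i> * z)"
    unfolding integrand_def eval_poch_fract[OF z0 dn] X_def[symmetric] XC[unfolded PP_def, symmetric]
    by (simp add: power_int_minus inverse_eq_divide)
  also have "\<dots> = 1 / (2 * of_real pi * \<i>) * six_integrand (shifted k) lam z"
    unfolding six_integrand_def C_def[symmetric] using \<open>X \<noteq> 0\<close> by (simp add: mult_ac)
  finally show ?thesis .
qed

text \<open>
  The functional takes the value \<open>v\<close> on \<open>f\<close> for every choice of \<open>lam\<close>; multiplied out, so that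
  the exceptional \<open>lam\<close> need not be excluded.
\<close>

definition has_value :: "(real \<Rightarrow> complex) \<Rightarrow> complex poly fract \<Rightarrow> complex \<Rightarrow> bool" where
  "has_value \<gamma> f v \<longleftrightarrow> (\<forall>lam. lam \<noteq> 0 \<longrightarrow>
     P q * \<theta> (lam\<^sup>2) * pairs b * contour_integral \<gamma> (integrand q b lam f) = 2 * D lam * v)"

lemma has_value_poch_fract:
  assumes g: "straddles (params M) \<gamma>" and k: "\<forall>j\<in>{1..6}. - k j \<le> int M"
    and sum: "(\<Sum>j=1..6. k j) = 0"
  shows "has_value \<gamma> (poch_fract k) (qpoch_pairs k / shift_multiplier k)"
  unfolding has_value_def
proof (intro allI impI)
  fix lam :: complex assume lam: "lam \<noteq> 0"
  let ?c = "shifted k" and ?p = "2 * of_real pi * \<i>"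
  have g': "straddles (?c ` {1..6}) \<gamma>" by (rule straddles_shifted[OF g k])
  have gen: "(?c 1)\<^sup>2 \<notin> qpowers q" "?c 1 * ?c 2 \<notin> qpowers q" "(?c 2)\<^sup>2 \<notin> qpowers q"
    unfolding shifted_def power2_eq_square by (rule b_shift_mult; simp)+
  have gen': "?c 2 / ?c 1 \<notin> qpowers q"
  proof
    assume "?c 2 / ?c 1 \<in> qpowers q"
    then have "inverse (?c 2 / ?c 1) * (q powi k 2 * q powi (- k 1)) \<in> qpowers q"
      by (intro qpowers_mult qpowers_inverse qpowers_powi)
    moreover have "inverse (?c 2 / ?c 1) * (q powi k 2 * q powi (- k 1)) = b 1 / b 2"
      using q_nz b_nz[of 2] by (simp add: shifted_def power_int_minus power_int_eq_0_iff field_simps)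
    ultimately show False using b_div[of 1 2] by simp
  qed
  have "contour_integral \<gamma> (integrand q b lam (poch_fract k)) = contour_integral \<gamma> (\<lambda>z. 1 / ?p * six_integrand ?c lam z)"
    using integrand_poch_fract[OF _ k] straddles_pole_free[OF g] by (intro contour_integral_cong) auto
  also have "\<dots> = 1 / ?p * contour_integral \<gamma> (six_integrand ?c lam)"
    by (rule contour_integral_lmul[OF six_integrand_integrable[OF g' lam]])
  finally have I: "contour_integral \<gamma> (six_integrand ?c lam) = ?p * contour_integral \<gamma> (integrand q b lam (poch_fract k))"
    by simp
  have "P q * \<theta> (lam\<^sup>2) * pairs ?c * (?p * contour_integral \<gamma> (integrand q b lam (poch_fract k))) =
      4 * of_real pi * \<i> * theta_difference q ?c lam"
    using six_parameter_integral[OF shifted_sum_prod[OF sum] gen(1,2) gen' gen(3) g' lam]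
    unfolding I .
  then have "?p * (P q * \<theta> (lam\<^sup>2) * pairs ?c * contour_integral \<gamma> (integrand q b lam (poch_fract k))) =
      ?p * (2 * theta_difference q ?c lam)"
    by (simp add: mult_ac)
  then have M: "P q * \<theta> (lam\<^sup>2) * pairs ?c * contour_integral \<gamma> (integrand q b lam (poch_fract k)) =
      2 * theta_difference q ?c lam"
    by (simp add: mult_ac)
  have "theta_difference q ?c lam = D lam / shift_multiplier k"
    using theta_difference_shifted[OF sum lam] shift_multiplier_nz by (metis nonzero_mult_div_cancel_right)
  then have "qpoch_pairs k * (P q * \<theta> (lam\<^sup>2) * pairs ?c * contour_integral \<gamma> (integrand q b lam (poch_fract k))) =
      qpoch_pairs k * (2 * (D lam / shift_multiplier k))"
    unfolding M by simp
  then show "P q * \<theta> (lam\<^sup>2) * pairs b * contour_integral \<gamma> (integrand q b lam (poch_fract k)) =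
      2 * D lam * (qpoch_pairs k / shift_multiplier k)"
    unfolding pairs_shifted[of k] by (simp add: mult_ac)
qed

lemma Vn_mono:
  assumes "\<forall>j\<in>{1..6}. n j \<le> n' j" shows "Vn n \<subseteq> Vn n'"
proof
  fix f assume "f \<in> Vn n"
  then obtain p where p: "f = Fract p (den n)" "degree p \<le> degree (den n)" by (auto simp: Vn_def)
  have "den n dvd den n'" unfolding den_def
    using assms by (intro prod_dvd_prod prod_dvd_prod_subset) auto
  then obtain s where s: "den n' = den n * s" by (elim dvdE)
  have snz: "s \<noteq> 0" using den_nz[of n'] unfolding s by (metis mult_zero_right)
  have "f = Fract (p * s) (den n')"
    unfolding p(1) s using den_nz[of n] snz by (simp add: eq_fract mult_ac)
  moreover have "degree (p * s) \<le> degree (den n')"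
    using degree_mult_le[of p s] degree_mult_eq[OF den_nz[of n] snz] p(2) unfolding s by simp
  ultimately show "f \<in> Vn n'" unfolding Vn_def by blast
qed

lemma Vn_add: "f \<in> Vn n \<Longrightarrow> g \<in> Vn n \<Longrightarrow> f + g \<in> Vn n"
proof -
  assume "f \<in> Vn n" "g \<in> Vn n"
  then obtain p p' where p: "f = Fract p (den n)" "degree p \<le> degree (den n)"
    "g = Fract p' (den n)" "degree p' \<le> degree (den n)" by (auto simp: Vn_def)
  have "f + g = Fract (p + p') (den n)"
    unfolding p(1,3) using den_nz[of n] by (simp add: eq_fract algebra_simps)
  moreover have "degree (p + p') \<le> degree (den n)" using p by (simp add: degree_add_le)
  ultimately show ?thesis unfolding Vn_def by blast
qed

lemma to_fract_mult_Fract: "to_fract [:c:] * Fract p r = Fract (smult c p) (r :: complex poly)"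
  by (simp add: to_fract_def)

lemma Vn_scale: "f \<in> Vn n \<Longrightarrow> to_fract [:c:] * f \<in> Vn n"
  unfolding Vn_def using degree_smult_le order_trans by (fastforce simp: to_fract_mult_Fract)

lemma integral_add:
  assumes g: "straddles (params M) \<gamma>" and fg: "f \<in> Vn (\<lambda>_. M)" "h \<in> Vn (\<lambda>_. M)" and lam: "lam \<noteq> 0"
  shows "contour_integral \<gamma> (integrand q b lam (f + h)) =
    contour_integral \<gamma> (integrand q b lam f) + contour_integral \<gamma> (integrand q b lam h)"
proof -
  let ?E = "pole_free (params M) (params M)" and ?r = "den (\<lambda>_. M)"
  have im: "path_image \<gamma> \<subseteq> ?E" using straddles_pole_free[OF g] .
  have v: "valid_path \<gamma>" using g by (simp add: straddles_def)
  have oE: "open ?E" by (intro pole_free_open_connected) (auto simp: params_def)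
  obtain p p' where p: "f = Fract p ?r" "h = Fract p' ?r" using fg by (auto simp: Vn_def)
  have i: "integrand q b lam (Fract p ?r) contour_integrable_on \<gamma>" for p
    by (rule contour_integrable_holomorphic_simple[OF analytic_imp_holomorphic oE v im],
        rule integrand_analytic[OF lam refl]) simp
  have sum: "f + h = Fract (p + p') ?r"
    unfolding p using den_nz by (simp add: eq_fract algebra_simps)
  have "contour_integral \<gamma> (integrand q b lam (f + h)) =
      contour_integral \<gamma> (\<lambda>z. integrand q b lam f z + integrand q b lam h z)"
  proof (rule contour_integral_cong)
    fix z assume "z \<in> path_image \<gamma>"
    then have nz: "poly ?r (joukowski z) \<noteq> 0" using den_nz_on[of z M] im by auto
    have "eval_rat (f + h) (joukowski z) = eval_rat f (joukowski z) + eval_rat h (joukowski z)"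
      unfolding sum unfolding p eval_rat_Fract[OF nz] by (simp add: add_divide_distrib)
    then show "integrand q b lam (f + h) z = integrand q b lam f z + integrand q b lam h z"
      unfolding integrand_def by (simp add: distrib_right add_divide_distrib)
  qed simp
  also have "\<dots> = contour_integral \<gamma> (integrand q b lam f) + contour_integral \<gamma> (integrand q b lam h)"
    unfolding p by (rule contour_integral_add[OF i i])
  finally show ?thesis .
qed

lemma integral_scale:
  assumes g: "straddles (params M) \<gamma>" and f: "f \<in> Vn (\<lambda>_. M)" and lam: "lam \<noteq> 0"
  shows "contour_integral \<gamma> (integrand q b lam (to_fract [:c:] * f)) =
    c * contour_integral \<gamma> (integrand q b lam f)"
proof -
  let ?E = "pole_free (params M) (params M)" and ?r = "den (\<lambda>_. M)"
  have im: "path_image \<gamma> \<subseteq> ?E" using straddles_pole_free[OF g] .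
  have v: "valid_path \<gamma>" using g by (simp add: straddles_def)
  have oE: "open ?E" by (intro pole_free_open_connected) (auto simp: params_def)
  obtain p where p: "f = Fract p ?r" using f by (auto simp: Vn_def)
  have i: "integrand q b lam f contour_integrable_on \<gamma>" unfolding p
    by (rule contour_integrable_holomorphic_simple[OF analytic_imp_holomorphic oE v im],
        rule integrand_analytic[OF lam refl]) simp
  have "contour_integral \<gamma> (integrand q b lam (to_fract [:c:] * f)) =
      contour_integral \<gamma> (\<lambda>z. c * integrand q b lam f z)"
  proof (rule contour_integral_cong)
    fix z assume "z \<in> path_image \<gamma>"
    then have nz: "poly ?r (joukowski z) \<noteq> 0" using den_nz_on[of z M] im by auto
    have "eval_rat (to_fract [:c:] * f) (joukowski z) = c * eval_rat f (joukowski z)"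
      unfolding p to_fract_mult_Fract eval_rat_Fract[OF nz] by simp
    then show "integrand q b lam (to_fract [:c:] * f) z = c * integrand q b lam f z"
      unfolding integrand_def by simp
  qed simp
  also have "\<dots> = c * contour_integral \<gamma> (integrand q b lam f)"
    by (rule contour_integral_lmul[OF i])
  finally show ?thesis .
qed

lemma has_value_add:
  assumes "straddles (params M) \<gamma>" "f \<in> Vn (\<lambda>_. M)" "h \<in> Vn (\<lambda>_. M)"
    and "has_value \<gamma> f v" "has_value \<gamma> h w"
  shows "has_value \<gamma> (f + h) (v + w)"
  using assms(4,5) integral_add[OF assms(1-3)] unfolding has_value_def by (simp add: algebra_simps)

lemma has_value_scale:
  assumes "straddles (params M) \<gamma>" "f \<in> Vn (\<lambda>_. M)" and "has_value \<gamma> f v"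
  shows "has_value \<gamma> (to_fract [:c:] * f) (c * v)"
  unfolding has_value_def
proof (intro allI impI)
  fix lam :: complex assume lam: "lam \<noteq> 0"
  have "P q * \<theta> (lam\<^sup>2) * pairs b * (c * contour_integral \<gamma> (integrand q b lam f)) =
      c * (P q * \<theta> (lam\<^sup>2) * pairs b * contour_integral \<gamma> (integrand q b lam f))"
    by (simp only: mult_ac)
  also have "\<dots> = c * (2 * D lam * v)" using assms(3) lam unfolding has_value_def by simp
  finally show "P q * \<theta> (lam\<^sup>2) * pairs b * contour_integral \<gamma> (integrand q b lam (to_fract [:c:] * f)) =
      2 * D lam * (c * v)"
    unfolding integral_scale[OF assms(1,2) lam] by (simp only: mult_ac)
qed

text \<open>
  The product with exponent \<open>- n j\<close> at \<open>b j\<close> and \<open>n j\<close> at another parameter has its last pole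
  where \<open>f\<close> has its own. A multiple of it removes this pole and creates only earlier ones.
\<close>

lemma reduce_pole_order:
  assumes j: "j \<in> {1..6}" "n j > 0" and f: "f \<in> Vn n"
  obtains k c g where "(\<Sum>i=1..6. k i) = 0" "\<forall>i\<in>{1..6}. nat (- k i) \<le> n i"
    "g \<in> Vn (n(j := n j - 1))" "f = g + to_fract [:c:] * poch_fract k"
proof -
  obtain p where p: "f = Fract p (den n)" "degree p \<le> degree (den n)" using f by (auto simp: Vn_def)
  define j' where "j' = (if j = 1 then 2 else 1 :: nat)"
  have j': "j' \<in> {1..6}" "j' \<noteq> j" by (auto simp: j'_def)
  define k where "k i = (if i = j then - int (n j) else 0) + (if i = j' then int (n j) else 0)" for i
  have ksum: "(\<Sum>i=1..6. k i) = 0" using j j' by (simp add: k_def sum.distrib sum.delta)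
  define n1 where "n1 = (\<lambda>i. nat (- k i))"
  have n1: "n1 i = (if i = j then n j else 0)" for i using j' by (auto simp: n1_def k_def)
  define n2 where "n2 = n(j := 0)"
  define n3 where "n3 = n(j := n j - 1)"
  define a where "a = pole_factor j (n j)"
  define x where "x = joukowski a"
  have anz: "a \<noteq> 0" unfolding a_def using pole_factor_nz[OF j(1)] .
  have d12: "den n = den n1 * den n2"
    unfolding den_def prod.distrib[symmetric] by (intro prod.cong) (auto simp: n1 n2_def)
  have d3: "den n = jlin a * den n3"
  proof -
    have "(\<Prod>i=1..n l. jlin (pole_factor l i)) =
        (if l = j then jlin a else 1) * (\<Prod>i=1..n3 l. jlin (pole_factor l i))" for l
    proof (cases "l = j")
      case True
      then obtain m where m: "n l = Suc m" using j(2) by (cases "n l") auto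
      then show ?thesis using True by (simp add: n3_def a_def mult.commute)
    qed (simp add: n3_def)
    then show ?thesis using j unfolding den_def by (simp add: prod.distrib prod.delta)
  qed
  have num_x: "poly (num k) x \<noteq> 0"
  proof
    assume "poly (num k) x = 0"
    then obtain l i where l: "l \<in> {1..6}" "i < nat (k l)" "poly (jlin (b l * q ^ i)) x = 0"
      by (auto simp: num_def poly_prod)
    then have "l = j'" by (auto simp: k_def split: if_splits)
    have nz: "b l * q ^ i \<noteq> 0" using b_nz[OF l(1)] q_nz by simp
    have "joukowski (b l * q ^ i) = joukowski a" using l(3) jlin_root_iff[OF nz] by (simp add: x_def)
    then have "b l * q powi int i = b j * q powi (- int (n j)) \<or>
        b l * q powi int i * (b j * q powi (- int (n j))) = 1"
      using joukowski_eq_iff[OF nz anz] by (simp add: a_def pole_factor_def)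
    then show False
      using b_shift_inj[OF l(1) j(1), of "int i" "- int (n j)"] \<open>l = j'\<close> j'(2)
        b_shift_mult[OF l(1) j(1), of "int i" "- int (n j)"] qpowers_1 by metis
  qed
  have den_x: "poly (den n2) x \<noteq> 0"
  proof
    assume "poly (den n2) x = 0"
    then obtain l i where l: "l \<in> {1..6}" "i \<in> {1..n2 l}" "x = joukowski (pole_factor l i)"
      unfolding den_root_iff pole_set_def by blast
    then have "l = j" using joukowski_pole_factor_inj[OF j(1) l(1)] unfolding x_def a_def by blast
    then show False using l(2) by (simp add: n2_def)
  qed
  \<comment> \<open>chosen so that the numerator of \<open>f - c * poch_fract k\<close> over \<open>den n\<close> vanishes at \<open>x\<close>\<close>
  define c where "c = poly p x / (poly (num k) x * poly (den n2) x)"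
  define p1 where "p1 = p - smult c (num k * den n2)"
  have "poly p1 x = 0" using num_x den_x by (simp add: p1_def c_def)
  then have "[:- x, 1:] dvd p1" by (simp add: poly_eq_0_iff_dvd)
  then have "jlin a dvd p1" unfolding jlin_factor[OF anz] x_def[symmetric]
    by (rule smult_dvd) (use anz in simp)
  then obtain p2 where p2: "p1 = jlin a * p2" by (elim dvdE)
  have "degree p1 \<le> degree (den n)"
    unfolding p1_def
  proof (rule degree_diff_le)
    have "degree (smult c (num k * den n2)) \<le> degree (num k) + degree (den n2)"
      using degree_smult_le degree_mult_le order_trans by blast
    also have "\<dots> = degree (den n)"
      using degree_num_den[OF ksum] unfolding d12 degree_mult_eq[OF den_nz den_nz] n1_def by simp
    finally show "degree (smult c (num k * den n2)) \<le> degree (den n)" .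
  qed (rule p(2))
  moreover have "degree (den n) = 1 + degree (den n3)"
    unfolding d3 degree_mult_eq[OF jlin_nz[OF anz] den_nz] degree_jlin[OF anz] ..
  moreover have "degree p1 = 1 + degree p2" if "p2 \<noteq> 0"
    unfolding p2 degree_mult_eq[OF jlin_nz[OF anz] that] degree_jlin[OF anz] ..
  ultimately have "degree p2 \<le> degree (den n3)" by (cases "p2 = 0") auto
  then have "Fract p2 (den n3) \<in> Vn n3" unfolding Vn_def by blast
  moreover have "f = Fract p2 (den n3) + to_fract [:c:] * poch_fract k"
  proof -
    have e1: "Fract p2 (den n3) = Fract p1 (den n)"
      unfolding p2 d3 using den_nz[of n3] jlin_nz[OF anz] by (simp add: eq_fract mult_ac)
    have "to_fract [:c:] * poch_fract k = Fract (smult c (num k)) (den n1)"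
      unfolding poch_fract_def to_fract_mult_Fract n1_def ..
    also have "\<dots> = Fract (smult c (num k * den n2)) (den n)"
      unfolding d12 using den_nz[of n1] den_nz[of n2] by (simp add: eq_fract mult_ac)
    finally have e2: "to_fract [:c:] * poch_fract k = Fract (smult c (num k * den n2)) (den n)" .
    show ?thesis unfolding e1 e2 p(1) p1_def
      using den_nz[of n] by (simp add: eq_fract algebra_simps)
  qed
  moreover have "nat (- k i) \<le> n i" for i using n1[of i] unfolding n1_def by (auto split: if_splits)
  ultimately show ?thesis using that[of k _ c] ksum unfolding n3_def by blast
qed

text \<open>
  The products span the space, so what holds for them extends by linearity.
\<close>

lemma has_value_exists:
  assumes g: "straddles (params M) \<gamma>" and "f \<in> Vn n" "\<forall>j\<in>{1..6}. n j \<le> M"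
  shows "\<exists>v. has_value \<gamma> f v"
  using assms(2,3)
proof (induction "\<Sum>j=1..6. n j" arbitrary: n f)
  case 0
  then have n0: "n j = 0" if "j \<in> {1..6}" for j using that by simp
  have d: "den n = 1" unfolding den_def by (intro prod.neutral) (simp add: n0)
  obtain p where p: "f = Fract p 1" "degree p = 0" using 0(2) by (auto simp: Vn_def d)
  then obtain c where "p = [:c:]" by (metis degree_eq_zeroE)
  then have f: "f = to_fract [:c:] * poch_fract (\<lambda>_. 0)" by (simp add: p poch_fract_def num_def den_def to_fract_def)
  have "poch_fract (\<lambda>_. 0) \<in> Vn (\<lambda>_. 0)" using poch_fract_in_Vn[of "\<lambda>_. 0"] by simp
  then have "poch_fract (\<lambda>_. 0) \<in> Vn (\<lambda>_. M)" using Vn_mono[of "\<lambda>_. 0" "\<lambda>_. M"] by auto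
  then show ?case unfolding f using has_value_scale[OF g] has_value_poch_fract[OF g, of "\<lambda>_. 0"] by auto
next
  case (Suc s)
  have "\<exists>j\<in>{1..6}. n j > 0"
  proof (rule ccontr)
    assume "\<not> (\<exists>j\<in>{1..6}. n j > 0)"
    then have "(\<Sum>j=1..6. n j) = 0" by simp
    then show False using Suc(2) by simp
  qed
  then obtain j where j: "j \<in> {1..6}" "n j > 0" by blast
  obtain k c h where k: "(\<Sum>i=1..6. k i) = 0" "\<forall>i\<in>{1..6}. nat (- k i) \<le> n i"
    "h \<in> Vn (n(j := n j - 1))" "f = h + to_fract [:c:] * poch_fract k"
    using reduce_pole_order[OF j Suc(3)] by metis
  let ?n = "n(j := n j - 1)"
  have "(\<Sum>i=1..6. n i) = n j + (\<Sum>i\<in>{1..6} - {j}. n i)" using j by (intro sum.remove) auto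
  moreover have "(\<Sum>i=1..6. ?n i) = ?n j + (\<Sum>i\<in>{1..6} - {j}. ?n i)" using j by (intro sum.remove) auto
  moreover have "(\<Sum>i\<in>{1..6} - {j}. ?n i) = (\<Sum>i\<in>{1..6} - {j}. n i)" by (intro sum.cong) auto
  ultimately have "s = (\<Sum>i=1..6. ?n i)" using Suc(2) j(2) by simp
  moreover have nM: "\<forall>i\<in>{1..6}. ?n i \<le> M" using Suc(4) by (auto intro: le_trans[OF diff_le_self])
  ultimately obtain v where v: "has_value \<gamma> h v" using Suc(1)[OF _ k(3)] by blast
  have kM: "\<forall>i\<in>{1..6}. nat (- k i) \<le> M" using k(2) Suc(4) le_trans by blast
  have fM: "poch_fract k \<in> Vn (\<lambda>_. M)" using poch_fract_in_Vn[OF k(1)] Vn_mono[OF kM] by blast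
  have hM: "h \<in> Vn (\<lambda>_. M)" using k(3) Vn_mono[OF nM] by blast
  have "\<forall>i\<in>{1..6}. - k i \<le> int M" using kM by (simp add: nat_le_iff)
  then have "has_value \<gamma> (poch_fract k) (qpoch_pairs k / shift_multiplier k)" by (rule has_value_poch_fract[OF g _ k(1)])
  then have "has_value \<gamma> f (v + c * (qpoch_pairs k / shift_multiplier k))"
    unfolding k(4) by (intro has_value_add[OF g hM Vn_scale[OF fM] v] has_value_scale[OF g fM])
  then show ?case by blast
qed

section \<open>The functional\<close>

text \<open>
  The choice \<open>lam = b 1\<close> is always generic, by the lemma that follows.
\<close>

definition J :: "complex poly fract \<Rightarrow> complex" where
  "J f = P q * \<theta> ((b 1)\<^sup>2) * pairs b / (2 * D (b 1)) *
     contour_integral (SOME \<gamma>. separating_contour q b (integrand q b (b 1) f) \<gamma>) (integrand q b (b 1) f)"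

lemma theta_difference_b1: "D (b 1) \<noteq> 0"
proof -
  have b1: "b 1 \<noteq> 0" using b_nz by simp
  \<comment> \<open>the second product in the braces contains \<open>\<theta> 1 = 0\<close>\<close>
  have z: "\<theta> (b 1 / b 1) = 0" using theta_eq_0_iff[of 1] b1 by simp
  have nz: "\<theta> (b 1 * b j) \<noteq> 0" if "j \<in> {1..6}" for j
    using theta_eq_0_iff[of "b 1 * b j"] b1 b_nz[OF that] b_mult[OF _ that, of 1] by simp
  have "(\<Prod>j=1..6. \<theta> (b 1 / b j)) = 0"
    using z by (intro prod_zero bexI[of _ 1]) auto
  then have "D (b 1) = (\<Prod>j=1..6. \<theta> (b 1 * b j))" unfolding theta_difference_def by simp
  also have "\<dots> \<noteq> 0" using nz by simp
  finally show ?thesis .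
qed

lemma contour_integral_separating:
  assumes g: "straddles (params M) \<gamma>" and f: "f \<in> Vn (\<lambda>_. M)" and lam: "lam \<noteq> 0"
    and s: "separating_contour q b (integrand q b lam f) \<gamma>'"
  shows "contour_integral \<gamma>' (integrand q b lam f) = contour_integral \<gamma> (integrand q b lam f)"
proof -
  obtain p where p: "f = Fract p (den (\<lambda>_. M))" using f by (auto simp: Vn_def)
  have "separating_contour q b (integrand q b lam f) \<gamma>"
    by (rule straddling_is_separating[OF lam p _ g]) simp
  then show ?thesis by (rule separating_contour_integral_unique[OF lam p s])
qed

lemma separating_contour_exists:
  assumes f: "f \<in> V q b" and lam: "lam \<noteq> 0"
  shows "\<exists>\<gamma>. separating_contour q b (integrand q b lam f) \<gamma>"
proof -
  obtain M p where p: "f = Fract p (den (\<lambda>_. M))" using V_subset_Vn[OF f] by (auto simp: Vn_def)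
  obtain \<gamma> where "straddles (params M) \<gamma>" using params_straddling_exists by blast
  then show ?thesis using straddling_is_separating[OF lam p] by auto
qed

lemma J_eq:
  assumes g: "straddles (params M) \<gamma>" and f: "f \<in> Vn (\<lambda>_. M)" and v: "has_value \<gamma> f v"
  shows "J f = v"
proof -
  have b1: "b 1 \<noteq> 0" using b_nz by simp
  have "f \<in> V q b" using f Vn_subset_V by blast
  from someI_ex[OF separating_contour_exists[OF this b1]]
  have "J f = P q * \<theta> ((b 1)\<^sup>2) * pairs b / (2 * D (b 1)) * contour_integral \<gamma> (integrand q b (b 1) f)"
    unfolding J_def using contour_integral_separating[OF g f b1] by simp
  also have "\<dots> = (P q * \<theta> ((b 1)\<^sup>2) * pairs b * contour_integral \<gamma> (integrand q b (b 1) f)) / (2 * D (b 1))"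
    by simp
  also have "\<dots> = v" using v b1 theta_difference_b1 unfolding has_value_def by simp
  finally show ?thesis .
qed

lemma common_Vn:
  assumes "f \<in> V q b" "h \<in> V q b"
  obtains M \<gamma> where "f \<in> Vn (\<lambda>_. M)" "h \<in> Vn (\<lambda>_. M)" "straddles (params M) \<gamma>"
proof -
  obtain N1 N2 where "\<forall>M\<ge>N1. f \<in> Vn (\<lambda>_. M)" "\<forall>M\<ge>N2. h \<in> Vn (\<lambda>_. M)"
    using V_subset_Vn assms by metis
  then have "f \<in> Vn (\<lambda>_. max N1 N2)" "h \<in> Vn (\<lambda>_. max N1 N2)" by auto
  then show ?thesis using that params_straddling_exists by blast
qed

lemma J_linear: "linear_functional_on (V q b) J"
  unfolding linear_functional_on_def
proof (intro conjI ballI allI)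
  fix f h assume "f \<in> V q b" "h \<in> V q b"
  then obtain M \<gamma> where M: "f \<in> Vn (\<lambda>_. M)" "h \<in> Vn (\<lambda>_. M)" and g: "straddles (params M) \<gamma>"
    using common_Vn by blast
  obtain v w where vw: "has_value \<gamma> f v" "has_value \<gamma> h w"
    using has_value_exists[OF g M(1)] has_value_exists[OF g M(2)] by auto
  show "J (f + h) = J f + J h"
    using J_eq[OF g Vn_add[OF M] has_value_add[OF g M vw]] J_eq[OF g M(1) vw(1)] J_eq[OF g M(2) vw(2)]
    by simp
next
  fix c f assume "f \<in> V q b"
  then obtain M \<gamma> where M: "f \<in> Vn (\<lambda>_. M)" and g: "straddles (params M) \<gamma>"
    using common_Vn by blast
  obtain v where v: "has_value \<gamma> f v" using has_value_exists[OF g M] by auto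
  show "J (to_fract [:c:] * f) = c * J f"
    using J_eq[OF g Vn_scale[OF M] has_value_scale[OF g M v]] J_eq[OF g M v] by simp
qed

lemma J_poch_fract:
  assumes k: "(\<Sum>j=1..6. k j) = 0"
  shows "poch_fract k \<in> V q b" "J (poch_fract k) = qpoch_pairs k / shift_multiplier k"
proof -
  show V: "poch_fract k \<in> V q b" using poch_fract_in_Vn[OF k] Vn_subset_V by blast
  define M where "M = (\<Sum>j=1..6. nat (- k j))"
  have kM: "\<forall>j\<in>{1..6}. nat (- k j) \<le> M" unfolding M_def by (auto intro: member_le_sum)
  then have km: "\<forall>j\<in>{1..6}. - k j \<le> int M" by (simp add: nat_le_iff)
  obtain \<gamma> where g: "straddles (params M) \<gamma>" using params_straddling_exists by blast
  have "poch_fract k \<in> Vn (\<lambda>_. M)" using poch_fract_in_Vn[OF k] Vn_mono[OF kM] by blast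
  then show "J (poch_fract k) = qpoch_pairs k / shift_multiplier k"
    using J_eq[OF g] has_value_poch_fract[OF g km k] by blast
qed

lemma J_integral:
  assumes f: "f \<in> V q b" and lam: "lam \<noteq> 0" "D lam \<noteq> 0"
    and s: "separating_contour q b (integrand q b lam f) \<gamma>'"
  shows "J f = P q * \<theta> (lam\<^sup>2) * pairs b / (2 * D lam) * contour_integral \<gamma>' (integrand q b lam f)"
proof -
  obtain M \<gamma> where M: "f \<in> Vn (\<lambda>_. M)" and g: "straddles (params M) \<gamma>"
    using common_Vn[OF f f] by blast
  obtain v where v: "has_value \<gamma> f v" using has_value_exists[OF g M] by auto
  have "P q * \<theta> (lam\<^sup>2) * pairs b * contour_integral \<gamma> (integrand q b lam f) = 2 * D lam * v"
    using v lam(1) unfolding has_value_def by blast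
  then show ?thesis
    unfolding contour_integral_separating[OF g M lam(1) s] J_eq[OF g M v] using lam(2) by simp
qed

end

theorem proposition3p2:
  fixes q :: complex and b :: "nat \<Rightarrow> complex"
  assumes "0 < norm q" and "norm q < 1"
    and "(\<Prod>j=1..6. b j) = q"
    and "\<And>i j. 1 \<le> i \<Longrightarrow> i < j \<Longrightarrow> j \<le> 6 \<Longrightarrow> b i / b j \<notin> qpowers q"
    and "\<And>i j. 1 \<le> i \<Longrightarrow> i \<le> j \<Longrightarrow> j \<le> 6 \<Longrightarrow> b i * b j \<notin> qpowers q"
  shows "\<exists>J :: complex poly fract \<Rightarrow> complex.
    linear_functional_on (V q b) J \<and>
    (\<forall>k :: nat \<Rightarrow> int. (\<Sum>j=1..6. k j) = 0 \<longrightarrow>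
      (\<exists>f\<in>V q b.
        (\<forall>z. z \<noteq> 0 \<longrightarrow> joukowski z \<notin> allowed_poles q b \<longrightarrow>
          eval_rat f (joukowski z) = (\<Prod>j=1..6. qpoch q (b j * z) (k j) * qpoch q (b j / z) (k j))) \<and>
        J f = (\<Prod>i=1..6. \<Prod>j\<in>{i<..6}. qpoch q (b i * b j) (k i + k j)) /
              (\<Prod>j=1..6. q powi (k j * (k j - 1) div 2) * b j powi k j))) \<and>
    (\<forall>lam. lam \<noteq> 0 \<longrightarrow> theta_difference q b lam \<noteq> 0 \<longrightarrow>
      (\<forall>f\<in>V q b.
        (\<exists>\<gamma>. separating_contour q b (integrand q b lam f) \<gamma>) \<and>
        (\<forall>\<gamma>. separating_contour q b (integrand q b lam f) \<gamma> \<longrightarrow>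
          J f = qpoch_inf q q * qtheta q (lam\<^sup>2) *
                (\<Prod>i=1..6. \<Prod>j\<in>{i<..6}. qpoch_inf q (b i * b j)) /
                (2 * theta_difference q b lam) *
                contour_integral \<gamma> (integrand q b lam f))))"
proof -
  interpret q_parameters q b
    by unfold_locales (use assms in auto)
  have eval: "eval_rat (poch_fract k) (joukowski z) = (\<Prod>j=1..6. qpoch q (b j * z) (k j) * qpoch q (b j / z) (k j))"
    if "z \<noteq> 0" "joukowski z \<notin> allowed_poles q b" for k z
  proof (rule eval_poch_fract[OF that(1)])
    show "poly (den (\<lambda>j. nat (- k j))) (joukowski z) \<noteq> 0"
      using den_root_iff pole_set_allowed that(2) by blast
  qed
  show ?thesis
  proof (intro exI[of _ J] conjI allI impI ballI)
    fix k :: "nat \<Rightarrow> int" assume k: "(\<Sum>j=1..6. k j) = 0"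
    show "\<exists>f\<in>V q b.
        (\<forall>z. z \<noteq> 0 \<longrightarrow> joukowski z \<notin> allowed_poles q b \<longrightarrow>
          eval_rat f (joukowski z) = (\<Prod>j=1..6. qpoch q (b j * z) (k j) * qpoch q (b j / z) (k j))) \<and>
        J f = (\<Prod>i=1..6. \<Prod>j\<in>{i<..6}. qpoch q (b i * b j) (k i + k j)) /
              (\<Prod>j=1..6. q powi (k j * (k j - 1) div 2) * b j powi k j)"
      using J_poch_fract[OF k] eval unfolding qpoch_pairs_def shift_multiplier_def by (intro bexI[of _ "poch_fract k"]) auto
  next
    fix lam f \<gamma> assume "lam \<noteq> 0" "D lam \<noteq> 0" "f \<in> V q b"
      "separating_contour q b (integrand q b lam f) \<gamma>"
    then show "J f = qpoch_inf q q * qtheta q (lam\<^sup>2) *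
                (\<Prod>i=1..6. \<Prod>j\<in>{i<..6}. qpoch_inf q (b i * b j)) /
                (2 * theta_difference q b lam) *
                contour_integral \<gamma> (integrand q b lam f)"
      using J_integral unfolding pairs_def by blast
  qed (use J_linear separating_contour_exists in auto)
qed

end
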